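(* Let $X$ be a downward skip-free continuous-time Markov chain on $\mathbb{N}$ satisfying the standing assumptions of the context. Suppose $\mathbb{P}_x[\tau_0<\infty]=1$ for all $x\ge0$ and the boundary $\infty$ is entrance. Then the quasi-stationary distribution $\nu_{\lambda_0}(y):=\lambda_0W^{(-\lambda_0)}(0,y)$ ($y\ge0$) is the Yaglom limit: $$\lim_{t\to\infty}\mathbb{P}_x[X_t=y\mid\tau_0>t]=\nu_{\lambda_0}(y)\qquad(x,y>0).$$
   Context: $\mathbb{N}=\{0,1,2,\dots\}$. $(\{X_t\}_{t\ge0},\{\mathbb{P}_x\}_{x\in\mathbb{N}})$ is a continuous-time Markov chain on $\mathbb{N}$ with càdlàg paths, whose $Q$-matrix $Q=(Q(x,y))_{x,y\ge0}$ is conservative ($\sum_{y}Q(x,y)=0$ for all $x$), killed at its explosion time $\lim_{z\to\infty}\tau_z^+$. For $A\subset\mathbb{N}$, $\tau_A:=\inf\{t>0: X_t\in A\}$ (with $\inf\emptyset=\infty$), $\tau_x:=\tau_{\{x\}}$, $\tau_z^+:=\tau_{[z,\infty)\cap\mathbb{N}}$; $Q(x):=-Q(x,x)$. $\mathbb{E}_x[Y,A]$ means $\mathbb{E}_x[Y1_A]$; $\mathbb{P}_\nu:=\sum_y\nu(y)\mathbb{P}_y$. Standing assumptions: $X$ is downward skip-free, i.e. $Q(x,y)=0$ for $0\le y\le x-2$; $X$ is irreducible on $\mathbb{N}\setminus\{0\}$: $\mathbb{P}_x[\tau_y<\infty]>0$ for $x\ge1$, $y\ge0$; $X$ is regular on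 $\mathbb{N}\setminus\{0\}$: $\mathbb{P}_x[\tau_{\mathbb{N}\setminus\{x\}}>0]=1$ for $x\ge1$; and $0$ is a trap: $\mathbb{P}_0[X_t=0]=1$ for all $t$. Scale function: for $z\ge1$, $n_z$ is $Q(z)$ times the law under $\mathbb{P}_z$ of the path of $X$ after its first exit time from $z$, stopped upon returning to $z$. Thus, writing $\sigma_z:=\tau_{\mathbb{N}\setminus\{z\}}$ and $R_z:=\inf\{t>\sigma_z:X_t=z\}$, for $x<z$, $n_z[e^{-q\tau_x},\tau_x<\infty]=Q(z)\,\mathbb{E}_z[e^{-q(\tau_x-\sigma_z)},\ \tau_x<R_z]$. For $q\ge0$, $W^{(q)}(x,z):=1/n_z[e^{-q\tau_x},\tau_x<\infty]$ for $0\le x<z$ and $W^{(q)}(x,z):=0$ for $x\ge z$; $W:=W^{(0)}$. For fixed $x,y$, $q\mapsto W^{(q)}(x,y)$ is a polynomial, $W^{(q)}(x,y)=\sum_{n\ge0}q^nW^{n+1}(x,y)$ ($W^n$ = matrix power, finite sum), and this formula defines $W^{(q)}(x,y)$ for all $q\in\mathbb{C}$. Decay parameter: $\lambda_0:=\sup\{\lambda\ge0:\mathbb{E}_x[e^{\lambda\tau_0}]<\infty\text{ for some }x\ge1\}$. The boundary $\infty$ is called entrance if $\sum_{y\ge0}W(0,y)<\infty$ and non-entrance otherwise. A probability distribution $\nu$ on $\mathbb{N}$ is a quasi-stationary distribution if $\nu(y)=\mathbb{P}_\nu[X_t=y\mid\tau_0>t]$ for every $y\ge0$, $t\ge0$.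 *)

theory Defs
  imports "HOL-Probability.Probability"
begin

(* A process X has type real => 'w => nat option, where None is the cemetery state; only times
   t >= 0 matter. *)

definition hitting_time :: "(real \<Rightarrow> 'w \<Rightarrow> nat option) \<Rightarrow> nat set \<Rightarrow> 'w \<Rightarrow> ereal" where
  "hitting_time X A \<omega> = (INF t\<in>{t. 0 < t \<and> X t \<omega> \<in> Some ` A}. ereal t)"

(* The times tau_z^+ are nondecreasing in z, so their limit is the supremum. *)
definition explosion_time :: "(real \<Rightarrow> 'w \<Rightarrow> nat option) \<Rightarrow> 'w \<Rightarrow> ereal" where
  "explosion_time X \<omega> = (SUP z. hitting_time X {z..} \<omega>)"

definition exit_time :: "(real \<Rightarrow> 'w \<Rightarrow> nat option) \<Rightarrow> nat \<Rightarrow> 'w \<Rightarrow> ereal" where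
  "exit_time X z = hitting_time X (- {z})"

definition return_time :: "(real \<Rightarrow> 'w \<Rightarrow> nat option) \<Rightarrow> nat \<Rightarrow> 'w \<Rightarrow> ereal" where
  "return_time X z \<omega> = (INF t\<in>{t. exit_time X z \<omega> < ereal t \<and> X t \<omega> = Some z}. ereal t)"

definition past :: "'w measure \<Rightarrow> (real \<Rightarrow> 'w \<Rightarrow> nat option) \<Rightarrow> real \<Rightarrow> 'w set set" where
  "past M X s = sigma_sets (space M)
     {{\<omega> \<in> space M. X u \<omega> = c} | u c. 0 \<le> u \<and> u \<le> s}"

(* M carries only the common sample space and sigma-algebra of the laws P x. In the discrete space
   of natural numbers, convergence is eventual equality, which is how the cadlag property is
   expressed here. *)
locale ctmc =
  fixes M :: "'w measure"
    and P :: "nat \<Rightarrow> 'w measure"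
    and X :: "real \<Rightarrow> 'w \<Rightarrow> nat option"
    and Q :: "nat \<Rightarrow> nat \<Rightarrow> real"
  assumes prob_space_P: "\<And>x. prob_space (P x)"
    and sets_P: "\<And>x. sets (P x) = sets M"
    and measurable_X: "\<And>t. 0 \<le> t \<Longrightarrow> X t \<in> measurable M (count_space UNIV)"
    and start: "\<And>x. \<P>(\<omega> in P x. X 0 \<omega> = Some x) = 1"
    and markov: "\<And>x y z s t A. 0 \<le> s \<Longrightarrow> 0 \<le> t \<Longrightarrow> A \<in> past M X s \<Longrightarrow>
      \<P>(\<omega> in P x. \<omega> \<in> A \<and> X s \<omega> = Some y \<and> X (s + t) \<omega> = Some z)
        = \<P>(\<omega> in P x. \<omega> \<in> A \<and> X s \<omega> = Some y) * \<P>(\<omega> in P y. X t \<omega> = Some z)"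
    and alive: "\<And>\<omega> t. \<omega> \<in> space M \<Longrightarrow> 0 \<le> t \<Longrightarrow> ereal t < explosion_time X \<omega> \<Longrightarrow> X t \<omega> \<noteq> None"
    and right_continuous: "\<And>\<omega> t. \<omega> \<in> space M \<Longrightarrow> 0 \<le> t \<Longrightarrow> ereal t < explosion_time X \<omega> \<Longrightarrow>
      (\<forall>\<^sub>F s in at_right t. X s \<omega> = X t \<omega>)"
    and left_limits: "\<And>\<omega> t. \<omega> \<in> space M \<Longrightarrow> 0 < t \<Longrightarrow> ereal t < explosion_time X \<omega> \<Longrightarrow>
      (\<exists>y. \<forall>\<^sub>F s in at_left t. X s \<omega> = Some y)"
    and killed: "\<And>\<omega> t. \<omega> \<in> space M \<Longrightarrow> 0 \<le> t \<Longrightarrow> explosion_time X \<omega> \<le> ereal t \<Longrightarrow> X t \<omega> = None"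
    and Q_matrix: "\<And>x y.
      ((\<lambda>t. (\<P>(\<omega> in P x. X t \<omega> = Some y) - of_bool (x = y)) / t) \<longlongrightarrow> Q x y) (at_right 0)"
    and conservative: "\<And>x. (\<lambda>y. Q x y) sums 0"

locale downward_skip_free_chain = ctmc M P X Q
  for M :: "'w measure" and P :: "nat \<Rightarrow> 'w measure"
    and X :: "real \<Rightarrow> 'w \<Rightarrow> nat option" and Q :: "nat \<Rightarrow> nat \<Rightarrow> real" +
  assumes skip_free: "\<And>x y. y + 2 \<le> x \<Longrightarrow> Q x y = 0"
    and irreducible: "\<And>x y. 1 \<le> x \<Longrightarrow> \<P>(\<omega> in P x. hitting_time X {y} \<omega> < \<infinity>) > 0"
    and regular: "\<And>x. 1 \<le> x \<Longrightarrow> \<P>(\<omega> in P x. exit_time X x \<omega> > 0) = 1"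
    and trap: "\<And>t. 0 \<le> t \<Longrightarrow> \<P>(\<omega> in P 0. X t \<omega> = Some 0) = 1"

(* n_z[exp(-q tau_x), tau_x < infinity] for x < z and q >= 0, where n_z is Q(z) = - Q(z,z) times
   the law under P_z of the path after its first exit from z, stopped upon returning to z. *)
definition excursion_transform ::
  "(nat \<Rightarrow> 'w measure) \<Rightarrow> (real \<Rightarrow> 'w \<Rightarrow> nat option) \<Rightarrow> (nat \<Rightarrow> nat \<Rightarrow> real)
    \<Rightarrow> real \<Rightarrow> nat \<Rightarrow> nat \<Rightarrow> real" where
  "excursion_transform P X Q q x z = - Q z z *
     (\<integral>\<omega>. exp (- q * real_of_ereal (hitting_time X {x} \<omega> - exit_time X z \<omega>))
          * of_bool (hitting_time X {x} \<omega> < return_time X z \<omega>) \<partial>P z)"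

(* W^(q)(x,z) for q >= 0. *)
definition excursion_scale ::
  "(nat \<Rightarrow> 'w measure) \<Rightarrow> (real \<Rightarrow> 'w \<Rightarrow> nat option) \<Rightarrow> (nat \<Rightarrow> nat \<Rightarrow> real)
    \<Rightarrow> real \<Rightarrow> nat \<Rightarrow> nat \<Rightarrow> real" where
  "excursion_scale P X Q q x z = (if x < z then 1 / excursion_transform P X Q q x z else 0)"

abbreviation scale0 ::
  "(nat \<Rightarrow> 'w measure) \<Rightarrow> (real \<Rightarrow> 'w \<Rightarrow> nat option) \<Rightarrow> (nat \<Rightarrow> nat \<Rightarrow> real)
    \<Rightarrow> nat \<Rightarrow> nat \<Rightarrow> real" where
  "scale0 P X Q \<equiv> excursion_scale P X Q 0"

(* Powers of an infinite matrix; the series has finitely many nonzero terms when the matrix is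
   strictly upper triangular. *)
primrec matpow :: "(nat \<Rightarrow> nat \<Rightarrow> real) \<Rightarrow> nat \<Rightarrow> nat \<Rightarrow> nat \<Rightarrow> real" where
  "matpow A 0 = (\<lambda>x y. of_bool (x = y))"
| "matpow A (Suc n) = (\<lambda>x y. \<Sum>u. matpow A n x u * A u y)"

(* W^(q)(x,y) for arbitrary real or complex q; the series is finite because W is strictly upper
   triangular. *)
definition scale ::
  "(nat \<Rightarrow> 'w measure) \<Rightarrow> (real \<Rightarrow> 'w \<Rightarrow> nat option) \<Rightarrow> (nat \<Rightarrow> nat \<Rightarrow> real)
    \<Rightarrow> 'a::real_normed_field \<Rightarrow> nat \<Rightarrow> nat \<Rightarrow> 'a" where
  "scale P X Q q x y = (\<Sum>n. q ^ n * of_real (matpow (scale0 P X Q) (Suc n) x y))"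

(* exp(lam * tau) for lam >= 0 and tau in [0,infinity], with 0 * infinity = 0. *)
definition exp_time :: "real \<Rightarrow> ereal \<Rightarrow> ennreal" where
  "exp_time lam \<tau> =
     (if \<tau> = \<infinity> \<and> 0 < lam then \<infinity> else ennreal (exp (lam * real_of_ereal \<tau>)))"

(* For a downward skip-free chain the set contains 0 and is bounded above by Q(1), because a path
   from x >= 1 has to spend a holding time in 1 before reaching 0; hence the supremum can be taken
   in the reals. *)
definition decay_parameter ::
  "(nat \<Rightarrow> 'w measure) \<Rightarrow> (real \<Rightarrow> 'w \<Rightarrow> nat option) \<Rightarrow> real" where
  "decay_parameter P X = Sup {lam. 0 \<le> lam \<and>
     (\<exists>x\<ge>1. (\<integral>\<^sup>+ \<omega>. exp_time lam (hitting_time X {0} \<omega>) \<partial>P x) < \<infinity>)}"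

definition entrance ::
  "(nat \<Rightarrow> 'w measure) \<Rightarrow> (real \<Rightarrow> 'w \<Rightarrow> nat option) \<Rightarrow> (nat \<Rightarrow> nat \<Rightarrow> real) \<Rightarrow> bool" where
  "entrance P X Q \<longleftrightarrow> summable (\<lambda>y. scale0 P X Q 0 y)"

definition prob_from ::
  "(nat \<Rightarrow> 'w measure) \<Rightarrow> (nat \<Rightarrow> real) \<Rightarrow> ('w \<Rightarrow> bool) \<Rightarrow> real" where
  "prob_from P \<nu> E = (\<Sum>x. \<nu> x * \<P>(\<omega> in P x. E \<omega>))"

(* A vanishing denominator would force nu = 0 (division by zero is zero), contradicting total
   mass one. *)
definition quasi_stationary ::
  "(nat \<Rightarrow> 'w measure) \<Rightarrow> (real \<Rightarrow> 'w \<Rightarrow> nat option) \<Rightarrow> (nat \<Rightarrow> real) \<Rightarrow> bool" where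
  "quasi_stationary P X \<nu> \<longleftrightarrow> (\<forall>y. 0 \<le> \<nu> y) \<and> \<nu> sums 1 \<and>
     (\<forall>y. \<forall>t\<ge>0. \<nu> y =
        prob_from P \<nu> (\<lambda>\<omega>. X t \<omega> = Some y \<and> hitting_time X {0} \<omega> > ereal t)
        / prob_from P \<nu> (\<lambda>\<omega>. hitting_time X {0} \<omega> > ereal t))"

definition nu_decay ::
  "(nat \<Rightarrow> 'w measure) \<Rightarrow> (real \<Rightarrow> 'w \<Rightarrow> nat option) \<Rightarrow> (nat \<Rightarrow> nat \<Rightarrow> real) \<Rightarrow> nat \<Rightarrow> real" where
  "nu_decay P X Q y = decay_parameter P X * scale P X Q (- decay_parameter P X) 0 y"

end

theory Submission
  imports Defs
begin

text \<open>Write G for the Green function of the chain killed at 0. On a grid of mesh h, decompose the visits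
  to z by what happens after the first step away from z; letting h tend to 0 gives
  W(x,z) = G(z,z) - G(x,z). In particular G(x,z) is at most W(0,z), with equality for x \<ge> z.
  If the boundary is entrance, the occupation times above a high level are thus uniformly small. This
  yields a lower bound, uniform in the starting point, for the probability to be in 1 at a fixed time,
  and a uniform comparison of the survival probabilities with the one from 1. Hence the Doob
  transforms of the semigroup contract oscillations (the argument of Champagnat and Villemonais), and
  the conditional laws converge to a limit alpha that does not depend on the starting point. Survival
  under alpha is exponential, with the decay parameter lambda as rate, and integrating
  alpha P_t = exp(- lambda t) alpha over t gives alpha = lambda (W(0,.) - alpha W), a triangular
  system whose solution is the scale function at - lambda.\<close>

section \<open>Honest absorbed semigroups and their Green function\<close>

text \<open>The assumptions give the Markov property at fixed times only and state skip-freeness for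
  \<open>Q\<close> only, whereas the scale function is built from random times of one excursion. On
  a grid the end of an excursion has an integer index, so the Markov property at each fixed grid
  time suffices; path properties enter when the mesh goes to 0. W and G are linked by balancing
  occupation times. If R is the probability that an excursion from z meets x < z before returning,
  then \<open>G(z,z) = 1 / Q(z) + (1 - R) G(z,z) + R G(x,z)\<close>, since skip-freeness and certain
  absorption leave no third way for the excursion to end. Hence
  \<open>Q(z) R (G(z,z) - G(x,z)) = 1\<close>, and \<open>Q(z) R\<close> is the reciprocal of
  W(x,z). The convergence half sees the chain only through its transition kernels and the numbers
  W(0,y). Occupation bounds control time averages, not fixed times; so tails are estimated at one
  suitable time of a window, and the loss up to the end of the window is paid by monotonicity of
  survival and the return probability at 1.\<close>

lemma integrable_pmf_bounded:
  fixes f :: "'a \<Rightarrow> real"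
  assumes "\<And>x. \<bar>f x\<bar> \<le> B"
  shows "integrable (measure_pmf q) f"
  by (rule measure_pmf.integrable_const_bound[where B=B]) (auto simp: assms)

text \<open>The nonnegative integral composes without integrability conditions; boundedness of
  \<open>f\<close> transfers the identity to expectations.\<close>

lemma expectation_bind_pmf:
  fixes f :: "'a \<Rightarrow> real" and k :: "'b \<Rightarrow> 'a pmf"
  assumes f: "\<And>x. 0 \<le> f x" "\<And>x. f x \<le> B"
  shows "measure_pmf.expectation (bind_pmf q k) f
    = measure_pmf.expectation q (\<lambda>x. measure_pmf.expectation (k x) f)"
proof -
  have int: "integrable (measure_pmf r) f" for r
    by (rule integrable_pmf_bounded[where B=B]) (use f in \<open>simp add: abs_of_nonneg\<close>)
  have le: "measure_pmf.expectation (k x) f \<le> B" for x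
    using measure_pmf.integral_le_const[OF int[of "k x"], of B] f(2) by simp
  have nn: "(\<integral>\<^sup>+x. ennreal (f x) \<partial>r) = ennreal (measure_pmf.expectation r f)" for r :: "'a pmf"
    using nn_integral_eq_integral[OF int] f(1) by simp
  have "ennreal (measure_pmf.expectation (bind_pmf q k) f)
      = (\<integral>\<^sup>+x. ennreal (measure_pmf.expectation (k x) f) \<partial>q)"
    by (simp only: nn_integral_bind_pmf nn[symmetric])
  also have "\<dots> = ennreal (measure_pmf.expectation q (\<lambda>x. measure_pmf.expectation (k x) f))"
    using f(1) by (intro nn_integral_eq_integral integrable_pmf_bounded[where B=B])
      (simp_all add: abs_of_nonneg integral_nonneg le)
  finally show ?thesis
    using f(1) by (simp add: integral_nonneg)
qed

text \<open>Taking values in \<open>pmf\<close> encodes honesty: no mass is lost by explosion. For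
  the given chain this has to be proved from path properties.\<close>

locale absorbed_semigroup =
  fixes K :: "real \<Rightarrow> nat \<Rightarrow> nat pmf"
  assumes K_0: "\<And>x. K 0 x = return_pmf x"
    and K_add: "\<And>s t x. 0 \<le> s \<Longrightarrow> 0 \<le> t \<Longrightarrow> K (s + t) x = bind_pmf (K s x) (K t)"
    and K_trap: "\<And>t. 0 \<le> t \<Longrightarrow> K t 0 = return_pmf 0"
    and K_tendsto: "\<And>x. ((\<lambda>t. pmf (K t x) x) \<longlongrightarrow> 1) (at_right 0)"
    and K_reach: "\<And>x y. 1 \<le> x \<Longrightarrow> \<exists>t>0. 0 < pmf (K t x) y"
begin

abbreviation p :: "real \<Rightarrow> nat \<Rightarrow> nat \<Rightarrow> real" where
  "p t x y \<equiv> pmf (K t x) y"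

section \<open>Continuity and positivity of the transition probabilities\<close>

lemma p_add: "0 \<le> s \<Longrightarrow> 0 \<le> t \<Longrightarrow> p (s + t) x y = measure_pmf.expectation (K s x) (\<lambda>u. p t u y)"
  by (simp add: K_add pmf_bind)

lemma p_add_ge:
  assumes "0 \<le> s" "0 \<le> t"
  shows "p s x y * p t y z \<le> p (s + t) x z"
proof -
  have "p s x y * p t y z = measure_pmf.expectation (K s x) (\<lambda>u. if u = y then p t y z else 0)"
    by (subst integral_measure_pmf_real[of "{y}"]) (auto split: if_splits)
  also have "\<dots> \<le> p (s + t) x z"
    unfolding p_add[OF assms]
    by (intro integral_mono integrable_pmf_bounded[where B=1]) (auto simp: pmf_le_1)
  finally show ?thesis .
qed

lemma p_add_ge2:
  assumes "0 \<le> s" "0 \<le> t" "y \<noteq> y'"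
  shows "p s x y * p t y z + p s x y' * p t y' z \<le> p (s + t) x z"
proof -
  have "p s x y * p t y z + p s x y' * p t y' z
      = measure_pmf.expectation (K s x) (\<lambda>u. if u = y \<or> u = y' then p t u z else 0)"
    using assms(3) by (subst integral_measure_pmf_real[of "{y,y'}"]) (auto split: if_splits)
  also have "\<dots> \<le> p (s + t) x z"
    unfolding p_add[OF assms(1,2)]
    by (intro integral_mono integrable_pmf_bounded[where B=1]) (auto simp: pmf_le_1)
  finally show ?thesis .
qed

lemma p_trap: "0 \<le> t \<Longrightarrow> p t 0 y = of_bool (y = 0)"
  by (simp add: K_trap pmf_return indicator_def)

lemma p_diag_near_1: assumes "m < 1" shows "\<exists>h>0. \<forall>s\<in>{0..h}. m < p s y y"
proof -
  have "\<forall>\<^sub>F t in at_right 0. m < p t y y"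
    using order_tendstoD(1)[OF K_tendsto assms] .
  then obtain b where b: "b > 0" "\<And>t. 0 < t \<Longrightarrow> t < b \<Longrightarrow> m < p t y y"
    by (auto simp: eventually_at_right_field)
  have "m < p s y y" if "s \<in> {0..b/2}" for s
    using that b assms by (cases "s = 0") (auto simp: K_0)
  then show ?thesis
    using b(1) by (intro exI[of _ "b/2"]) auto
qed

lemma p_pow_le: "0 \<le> t \<Longrightarrow> p t y y ^ n \<le> p (real n * t) y y"
proof (induction n)
  case (Suc n)
  have "p t y y ^ Suc n \<le> p (real n * t) y y * p t y y"
    using Suc by (simp add: mult.commute mult_left_mono)
  also have "\<dots> \<le> p (real n * t + t) y y"
    using Suc.prems by (intro p_add_ge) auto
  finally show ?case
    by (simp add: algebra_simps)
qed (simp add: K_0)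

text \<open>Cut \<open>[0,t]\<close> into pieces so short that the return probability of each is
  positive.\<close>

lemma p_diag_pos: assumes "0 \<le> t" shows "0 < p t y y"
proof -
  obtain h where h: "h > 0" "\<And>s. s \<in> {0..h} \<Longrightarrow> 0 < p s y y"
    using p_diag_near_1[of 0 y] by auto
  obtain n :: nat where n: "t / h < n"
    using reals_Archimedean2 by blast
  then have n0: "n > 0"
    using assms h(1) by (cases n) (auto simp: divide_less_0_iff)
  have "t / n \<in> {0..h}"
    using n n0 assms h(1) by (auto simp: field_simps)
  then have "0 < p (t / n) y y ^ n"
    using h(2) by simp
  also have "\<dots> \<le> p t y y"
    using p_pow_le[of "t / n" y n] assms n0 by simp
  finally show ?thesis .
qed

text \<open>Split at time \<open>s\<close> by whether the chain is in \<open>x\<close>. The bound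
  does not involve \<open>t\<close> or \<open>y\<close>, so it is a modulus of continuity uniform in
  time.\<close>

lemma p_lipschitz:
  assumes "0 \<le> s" "0 \<le> t"
  shows "\<bar>p (s + t) x y - p t x y\<bar> \<le> 1 - p s x x"
proof -
  let ?I = "\<lambda>u. if u = x then p t x y else 0"
  have 1: "p s x x * p t x y = measure_pmf.expectation (K s x) ?I"
    by (subst integral_measure_pmf_real[of "{x}"]) (auto split: if_splits)
  have 2: "1 - p s x x = measure_pmf.expectation (K s x) (indicator (-{x}))"
    using measure_pmf.prob_compl[of "{x}" "K s x"] by (simp add: Compl_eq_Diff_UNIV measure_pmf_single)
  have "p (s + t) x y \<le> measure_pmf.expectation (K s x) (\<lambda>u. ?I u + indicator (-{x}) u)"
    unfolding p_add[OF assms]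
    by (intro integral_mono integrable_pmf_bounded[where B=2]) (auto simp: pmf_le_1 indicator_def intro: order_trans[OF pmf_le_1])
  also have "\<dots> = p s x x * p t x y + (1 - p s x x)"
    unfolding 1 2
    by (intro Bochner_Integration.integral_add integrable_pmf_bounded[where B=1]) (auto simp: pmf_le_1 indicator_def)
  finally have "p (s + t) x y - p t x y \<le> (1 - p s x x) - p t x y * (1 - p s x x)"
    by (simp add: algebra_simps)
  moreover have "p t x y * (1 - p s x x) \<le> 1 - p s x x" "0 \<le> p t x y * (1 - p s x x)"
    by (auto intro!: mult_left_le_one_le simp: pmf_le_1)
  moreover have "p s x x * p t x y \<le> p (s + t) x y"
    using p_add_ge[OF assms] .
  ultimately show ?thesis
    by (auto simp: abs_le_iff algebra_simps)
qed

lemma continuous_on_p: "continuous_on {0..} (\<lambda>t. p t x y)"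
  unfolding continuous_on_iff
proof (intro ballI allI impI)
  fix t e :: real assume "t \<in> {0..}" "0 < e"
  obtain h where h: "h > 0" "\<And>s. s \<in> {0..h} \<Longrightarrow> 1 - e < p s x x"
    using p_diag_near_1[of "1 - e" x] \<open>0 < e\<close> by auto
  have "dist (p t' x y) (p t x y) < e" if "t' \<in> {0..}" "dist t' t < h" for t'
    using p_lipschitz[of "t' - t" t x y] p_lipschitz[of "t - t'" t' x y] h(2)[of "\<bar>t - t'\<bar>"] that \<open>t \<in> {0..}\<close>
    by (cases "t \<le> t'") (auto simp: dist_real_def)
  then show "\<exists>d>0. \<forall>t'\<in>{0..}. dist t' t < d \<longrightarrow> dist (p t' x y) (p t x y) < e"
    using h(1) by blast
qed

text \<open>Nothing is known about \<open>K\<close> at negative times, hence the cut-off before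
  \<open>p\<close> is treated as a function on the real line.\<close>

lemma measurable_p: "(\<lambda>t. indicator {0..} t * p t x y) \<in> borel_measurable borel"
  using borel_measurable_continuous_on_indicator[OF _ continuous_on_p] by simp

lemma grid_interval_subset: "0 < h \<Longrightarrow> {real k * h..<b} \<subseteq> {0..}"
  by (auto intro: order_trans[of 0 "real k * h"])

lemma measurable_p_interval:
  "A \<in> sets borel \<Longrightarrow> A \<subseteq> {0..} \<Longrightarrow> (\<lambda>t. ennreal (p t x y) * indicator A t) \<in> borel_measurable borel"
proof -
  assume A: "A \<in> sets borel" "A \<subseteq> {0..}"
  have "(\<lambda>t. ennreal (p t x y) * indicator A t)
      = (\<lambda>t. ennreal (indicator {0..} t * p t x y) * indicator A t)"
    using A(2) by (auto simp: indicator_def fun_eq_iff)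
  then show ?thesis
    using A(1) measurable_p[of x y] by simp
qed

lemma p_diag_min: assumes "0 \<le> T" shows "\<exists>m>0. \<forall>s\<in>{0..T}. m \<le> p s y y"
proof -
  have "continuous_on {0..T} (\<lambda>t. p t y y)"
    by (rule continuous_on_subset[OF continuous_on_p]) auto
  then obtain s where "s \<in> {0..T}" "\<And>r. r \<in> {0..T} \<Longrightarrow> p s y y \<le> p r y y"
    using continuous_attains_inf[of "{0..T}" "\<lambda>t. p t y y"] assms by auto
  then show ?thesis
    using p_diag_pos[of s y] by (intro exI[of _ "p s y y"]) auto
qed

section \<open>The Green function as a limit of grid sums\<close>

definition green :: "nat \<Rightarrow> nat \<Rightarrow> ennreal" where
  "green x y = (\<integral>\<^sup>+t. ennreal (p t x y) * indicator {0..} t \<partial>lborel)"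

definition grid_sum :: "real \<Rightarrow> nat \<Rightarrow> nat \<Rightarrow> ennreal" where
  "grid_sum h x y = (\<Sum>k. ennreal (p (real k * h) x y))"

lemma green_grid:
  assumes "0 < h"
  shows "green x y = (\<Sum>k. \<integral>\<^sup>+t. ennreal (p t x y) * indicator {real k * h..<real (Suc k) * h} t \<partial>lborel)"
proof -
  have un: "{0..} = (\<Union>k. {real k * h..<real (Suc k) * h})"
  proof (intro set_eqI iffI)
    fix t assume "t \<in> {0::real..}"
    then have "t \<in> {real (nat \<lfloor>t / h\<rfloor>) * h..<real (Suc (nat \<lfloor>t / h\<rfloor>)) * h}"
      using floor_divide_lower[OF assms, of t] floor_divide_upper[OF assms, of t] assms
      by (auto simp: algebra_simps)
    then show "t \<in> (\<Union>k. {real k * h..<real (Suc k) * h})"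
      by blast
  qed (use assms in \<open>auto intro: order_trans[rotated]\<close>)
  have disj: "disjoint_family (\<lambda>k. {real k * h..<real (Suc k) * h})"
  proof -
    have "{real i * h..<real (Suc i) * h} \<inter> {real j * h..<real (Suc j) * h} = {}" if "i < j" for i j
    proof -
      have "real (Suc i) * h \<le> real j * h"
        using that assms by (intro mult_right_mono) auto
      then show ?thesis by auto
    qed
    then show ?thesis
      unfolding disjoint_family_on_def by (metis inf_commute linorder_neqE_nat)
  qed
  have "ennreal (p t x y) * indicator {0..} t
      = (\<Sum>k. ennreal (p t x y) * indicator {real k * h..<real (Suc k) * h} t)" for t
  proof -
    have "(\<Sum>k. ennreal (p t x y) * indicator {real k * h..<real (Suc k) * h} t)
      = ennreal (p t x y) * (\<Sum>k. indicator {real k * h..<real (Suc k) * h} t)"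
      by simp
    then show ?thesis
      unfolding un using suminf_indicator[OF disj, of t] by simp
  qed
  then show ?thesis
    unfolding green_def using assms
    by (subst nn_integral_suminf[symmetric]) (auto intro!: measurable_p_interval grid_interval_subset)
qed

text \<open>A chain in \<open>y\<close> at a grid time is in \<open>y\<close> with probability at
  least \<open>m\<close> at every time of the cell that begins there; integration over the cell
  gives the factor \<open>m * h\<close>.\<close>

lemma grid_sum_le_green:
  assumes "0 < h" "0 \<le> m" "\<And>s. s \<in> {0..h} \<Longrightarrow> m \<le> p s y y"
  shows "ennreal (m * h) * grid_sum h x y \<le> green x y"
proof -
  have "ennreal (m * h) * ennreal (p (real k * h) x y)
      \<le> (\<integral>\<^sup>+t. ennreal (p t x y) * indicator {real k * h..<real (Suc k) * h} t \<partial>lborel)" for k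
  proof -
    have "ennreal (m * h) * ennreal (p (real k * h) x y)
        = (\<integral>\<^sup>+t. ennreal (m * p (real k * h) x y) * indicator {real k * h..<real (Suc k) * h} t \<partial>lborel)"
      using assms(1,2) by (simp add: nn_integral_cmult_indicator algebra_simps flip: ennreal_mult)
    also have "\<dots> \<le> (\<integral>\<^sup>+t. ennreal (p t x y) * indicator {real k * h..<real (Suc k) * h} t \<partial>lborel)"
    proof (intro nn_integral_mono)
      fix t :: real
      show "ennreal (m * p (real k * h) x y) * indicator {real k * h..<real (Suc k) * h} t
        \<le> ennreal (p t x y) * indicator {real k * h..<real (Suc k) * h} t"
      proof (cases "t \<in> {real k * h..<real (Suc k) * h}")
        case True
        then have r: "t - real k * h \<in> {0..h}"
          by (auto simp: algebra_simps)
        have "m * p (real k * h) x y \<le> p (real k * h) x y * p (t - real k * h) y y"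
          using mult_right_mono[OF assms(3)[OF r], of "p _ x y"] by (simp add: mult.commute)
        also have "\<dots> \<le> p t x y"
          using p_add_ge[of "real k * h" "t - real k * h" x y y] r assms(1) by simp
        finally show ?thesis
          using True by (simp add: ennreal_leI)
      qed simp
    qed
    finally show ?thesis .
  qed
  then show ?thesis
    unfolding green_grid[OF assms(1)] grid_sum_def
    by (subst ennreal_suminf_cmult[symmetric]) (intro suminf_le summableI, auto)
qed

text \<open>The reverse comparison looks forward to the right end of the cell, where a chain seen in
  \<open>y\<close> inside the cell is again in \<open>y\<close> with probability at least
  \<open>m\<close>; this explains the shift to \<open>Suc k\<close>.\<close>

lemma green_le_grid_sum:
  assumes "0 < h" "0 \<le> m" "\<And>s. s \<in> {0..h} \<Longrightarrow> m \<le> p s y y"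
  shows "ennreal m * green x y \<le> ennreal h * grid_sum h x y"
proof -
  have "ennreal m * (\<integral>\<^sup>+t. ennreal (p t x y) * indicator {real k * h..<real (Suc k) * h} t \<partial>lborel)
      \<le> ennreal h * ennreal (p (real (Suc k) * h) x y)" for k
  proof -
    have "ennreal m * (\<integral>\<^sup>+t. ennreal (p t x y) * indicator {real k * h..<real (Suc k) * h} t \<partial>lborel)
      = (\<integral>\<^sup>+t. ennreal m * (ennreal (p t x y) * indicator {real k * h..<real (Suc k) * h} t) \<partial>lborel)"
      using assms(1)
      by (intro nn_integral_cmult[symmetric])
        (auto intro!: measurable_p_interval grid_interval_subset simp del: of_nat_Suc)
    also have "\<dots> \<le> (\<integral>\<^sup>+t. ennreal (p (real (Suc k) * h) x y) * indicator {real k * h..<real (Suc k) * h} t \<partial>lborel)"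
    proof (intro nn_integral_mono)
      fix t :: real
      show "ennreal m * (ennreal (p t x y) * indicator {real k * h..<real (Suc k) * h} t)
        \<le> ennreal (p (real (Suc k) * h) x y) * indicator {real k * h..<real (Suc k) * h} t"
      proof (cases "t \<in> {real k * h..<real (Suc k) * h}")
        case True
        then have r: "real (Suc k) * h - t \<in> {0..h}"
          by (auto simp: algebra_simps)
        have t0: "0 \<le> t"
          using True assms(1) by (auto intro: order_trans[rotated])
        have "m * p t x y \<le> p t x y * p (real (Suc k) * h - t) y y"
          using mult_right_mono[OF assms(3)[OF r], of "p _ x y"] by (simp add: mult.commute)
        also have "\<dots> \<le> p (real (Suc k) * h) x y"
          using p_add_ge[of t "real (Suc k) * h - t" x y y] r t0 by simp
        finally have "ennreal (m * p t x y) \<le> ennreal (p (real (Suc k) * h) x y)"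
          by (rule ennreal_leI)
        then show ?thesis
          using True assms(2) by (simp add: ennreal_mult)
      qed simp
    qed
    also have "\<dots> = ennreal h * ennreal (p (real (Suc k) * h) x y)"
      using assms(1) by (simp add: nn_integral_cmult_indicator algebra_simps flip: ennreal_mult)
    finally show ?thesis .
  qed
  then have "ennreal m * green x y \<le> ennreal h * (\<Sum>k. ennreal (p (real (Suc k) * h) x y))"
    unfolding green_grid[OF assms(1)]
    by (subst (1 2) ennreal_suminf_cmult[symmetric]) (intro suminf_le summableI, auto)
  also have "(\<Sum>k. ennreal (p (real (Suc k) * h) x y)) \<le> grid_sum h x y"
    unfolding grid_sum_def
    by (subst suminf_offset[OF summableI, of _ 1]) (auto intro: add_increasing)
  finally show ?thesis
    by (simp add: mult_left_mono)
qed

text \<open>From \<open>y\<close> the chain is absorbed within time \<open>T\<close> with positive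
  probability. On the grid of mesh \<open>T\<close>, every visit to \<open>y\<close> therefore adds
  fresh absorbed mass \<open>p T y 0\<close>, and the total absorbed mass is at most 1. State 0
  itself is excluded: nothing is removed at the trap, and its occupation time is infinite.\<close>

lemma green_finite: assumes "1 \<le> y" shows "green x y < \<infinity>"
proof -
  obtain T where T: "T > 0" "0 < p T y 0"
    using K_reach[OF assms] by blast
  obtain m where m: "m > 0" "\<And>s. s \<in> {0..T} \<Longrightarrow> m \<le> p s y y"
    using p_diag_min[of T y] T(1) by auto
  have tele: "(\<Sum>k<n. p (real k * T) x y * p T y 0) \<le> p (real n * T) x 0" for n
  proof (induction n)
    case (Suc n)
    have "p (real n * T) x 0 + p (real n * T) x y * p T y 0 \<le> p (real n * T + T) x 0"
      using p_add_ge2[of "real n * T" T 0 y x 0] T(1) assms by (simp add: p_trap)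
    then show ?case
      using Suc by (simp add: algebra_simps)
  qed simp
  have "(\<Sum>k<n. ennreal (p (real k * T) x y)) \<le> ennreal (1 / p T y 0)" for n
  proof -
    have "(\<Sum>k<n. p (real k * T) x y) * p T y 0 \<le> 1"
      using order_trans[OF tele[of n] pmf_le_1] by (simp add: sum_distrib_right)
    then show ?thesis
      using T(2) by (auto simp: field_simps intro!: ennreal_leI)
  qed
  then have "grid_sum T x y \<le> ennreal (1 / p T y 0)"
    unfolding grid_sum_def by (intro suminf_le_const summableI) auto
  then have "grid_sum T x y < \<infinity>"
    by (rule order.strict_trans1) simp
  then have "ennreal T * grid_sum T x y < \<infinity>"
    by (simp add: ennreal_mult_less_top)
  then have "ennreal m * green x y < \<infinity>"
    using order.strict_trans1[OF green_le_grid_sum[of T m y x]] T(1) m by auto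
  then show ?thesis
    using m(1) by (auto simp: ennreal_mult_less_top)
qed

text \<open>Both comparisons hold with \<open>m\<close> as close to 1 as desired once the mesh is
  small, which squeezes the Riemann sums onto the integral.\<close>

lemma tendsto_grid_sum:
  assumes "1 \<le> y" and h: "\<And>n. 0 < h n" "h \<longlonglongrightarrow> 0"
  shows "(\<lambda>n. h n * enn2real (grid_sum (h n) x y)) \<longlonglongrightarrow> enn2real (green x y)"
    and "\<forall>\<^sub>F n in sequentially. grid_sum (h n) x y < \<infinity>"
proof -
  define g where "g = enn2real (green x y)"
  have g: "green x y = ennreal g" "g \<ge> 0"
    using green_finite[OF assms(1), of x] by (auto simp: g_def)
  have ev: "\<forall>\<^sub>F n in sequentially. grid_sum (h n) x y < \<infinity> \<and>
      m * (h n * enn2real (grid_sum (h n) x y)) \<le> g \<and> m * g \<le> h n * enn2real (grid_sum (h n) x y)"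
    if m: "0 < m" "m < 1" for m
  proof -
    obtain d where d: "d > 0" "\<And>s. s \<in> {0..d} \<Longrightarrow> m < p s y y"
      using p_diag_near_1[OF m(2)] by blast
    have "\<forall>\<^sub>F n in sequentially. h n < d"
      using order_tendstoD(2)[OF h(2) d(1)] .
    then show ?thesis
    proof eventually_elim
      case (elim n)
      have le: "\<And>s. s \<in> {0..h n} \<Longrightarrow> m \<le> p s y y"
        using d(2) elim by (force intro!: less_imp_le)
      have 1: "ennreal (m * h n) * grid_sum (h n) x y \<le> ennreal g"
        using grid_sum_le_green[OF h(1) _ le, where x=x] m(1) g(1) by simp
      have fin: "grid_sum (h n) x y < \<infinity>"
      proof (rule ccontr)
        assume "\<not> grid_sum (h n) x y < \<infinity>"
        then have "ennreal (m * h n) * grid_sum (h n) x y = \<infinity>"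
          using m(1) h(1)[of n] by (simp add: ennreal_mult_top less_top[symmetric])
        with 1 show False by (simp add: top_unique)
      qed
      then obtain e where e: "grid_sum (h n) x y = ennreal e" "0 \<le> e"
        by (cases "grid_sum (h n) x y") auto
      have 2: "ennreal m * ennreal g \<le> ennreal (h n) * grid_sum (h n) x y"
        using green_le_grid_sum[OF h(1) _ le, where x=x] m(1) g(1) by simp
      show ?case
        using 1 2 e g(2) m(1) h(1)[of n] by (simp add: mult.assoc flip: ennreal_mult)
    qed
  qed
  show "\<forall>\<^sub>F n in sequentially. grid_sum (h n) x y < \<infinity>"
    using ev[of "1/2"] by (auto elim!: eventually_mono)
  show "(\<lambda>n. h n * enn2real (grid_sum (h n) x y)) \<longlonglongrightarrow> enn2real (green x y)"
    unfolding g_def[symmetric]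
  proof (rule order_tendstoI)
    fix a assume a: "a < g"
    show "\<forall>\<^sub>F n in sequentially. a < h n * enn2real (grid_sum (h n) x y)"
    proof (cases "a < 0")
      case True
      have "a < h n * enn2real (grid_sum (h n) x y)" for n
        using h(1)[of n] by (intro order.strict_trans2[OF True] mult_nonneg_nonneg) auto
      then show ?thesis
        by (intro always_eventually allI)
    next
      case False
      then have "0 \<le> a / g" "a / g < 1" "0 < g" using a by auto
      then obtain m where m: "a / g < m" "m < 1" "0 < m"
        using dense[of "a/g" 1] by force
      have "a < m * g" using m \<open>0 < g\<close> by (simp add: field_simps)
      with ev[OF m(3,2)] show ?thesis
        by (auto elim!: eventually_mono)
    qed
  next
    fix a assume a: "g < a"
    obtain m where m: "g / a < m" "m < 1"
      using dense[of "g/a" 1] a g(2) by auto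
    moreover have "0 \<le> g / a" using a g(2) by auto
    ultimately have "0 < m" by linarith
    have "g < m * a" using a g(2) m(1) by (simp add: field_simps)
    have "\<forall>\<^sub>F n in sequentially. m * (h n * enn2real (grid_sum (h n) x y)) < m * a"
      using ev[OF \<open>0 < m\<close> m(2)] by eventually_elim (use \<open>g < m * a\<close> in auto)
    then show "\<forall>\<^sub>F n in sequentially. h n * enn2real (grid_sum (h n) x y) < a"
      using \<open>0 < m\<close> by simp
  qed
qed

section \<open>Survival probabilities\<close>

definition surv :: "real \<Rightarrow> nat \<Rightarrow> real" where
  "surv t x = 1 - p t x 0"

lemma surv_nonneg: "0 \<le> surv t x"
  by (simp add: surv_def pmf_le_1)

lemma surv_le_1: "surv t x \<le> 1"
  by (simp add: surv_def)

lemma surv_0: "surv 0 x = of_bool (x \<noteq> 0)"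
  by (simp add: surv_def K_0)

lemma surv_trap: "0 \<le> t \<Longrightarrow> surv t 0 = 0"
  by (simp add: surv_def p_trap)

lemma surv_measure: "surv t x = measure (K t x) {0<..}"
proof -
  have "{0<..} = UNIV - {0::nat}" by auto
  then show ?thesis
    using measure_pmf.prob_compl[of "{0}" "K t x"] by (simp add: surv_def measure_pmf_single)
qed

lemma p_le_surv: "1 \<le> y \<Longrightarrow> p t x y \<le> surv t x"
  unfolding surv_measure measure_pmf_single[symmetric] by (rule measure_pmf.finite_measure_mono) auto

lemma surv_pos: "0 \<le> t \<Longrightarrow> 1 \<le> x \<Longrightarrow> 0 < surv t x"
  using p_le_surv[of x t x] p_diag_pos[of t x] by simp

lemma surv_add:
  assumes "0 \<le> s" "0 \<le> t"
  shows "surv (s + t) x = measure_pmf.expectation (K s x) (surv t)"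
proof -
  have "measure_pmf.expectation (K s x) (\<lambda>u. 1 - p t u 0) = 1 - p (s + t) x 0"
    unfolding p_add[OF assms]
    by (subst Bochner_Integration.integral_diff) (auto intro!: integrable_pmf_bounded[where B=1] simp: pmf_le_1)
  then show ?thesis
    by (simp add: surv_def[abs_def])
qed

lemma surv_antimono: "0 \<le> s \<Longrightarrow> s \<le> t \<Longrightarrow> surv t x \<le> surv s x"
  using p_add_ge[of s "t - s" x 0 0] by (simp add: surv_def p_trap)

lemma integrable_surv: "integrable (measure_pmf q) (surv t)"
  by (rule integrable_pmf_bounded[where B=1]) (auto simp: surv_nonneg surv_le_1)

lemma surv_add_ge: assumes "0 \<le> s" "0 \<le> t" shows "p s x y * surv t y \<le> surv (s + t) x"
proof -
  have "p s x y * surv t y = measure_pmf.expectation (K s x) (\<lambda>u. if u = y then surv t y else 0)"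
    by (subst integral_measure_pmf_real[of "{y}"]) (auto split: if_splits)
  also have "\<dots> \<le> surv (s + t) x"
    unfolding surv_add[OF assms]
    by (intro integral_mono integrable_surv integrable_pmf_bounded[where B=1])
      (auto simp: surv_nonneg surv_le_1)
  finally show ?thesis .
qed

lemma green_pos: "0 < green y y"
proof -
  obtain h where h: "h > 0" "\<And>s. s \<in> {0..h} \<Longrightarrow> 1/2 < p s y y"
    using p_diag_near_1[of "1/2" y] by auto
  have "0 < ennreal (1/2 * h) * grid_sum h y y"
  proof -
    have "ennreal (p (real 0 * h) y y) \<le> grid_sum h y y"
      unfolding grid_sum_def
      by (rule order_trans[OF _ sum_le_suminf[OF summableI, of "{0}"]]) auto
    then have "1 \<le> grid_sum h y y"
      by (simp add: K_0)
    then have "0 < grid_sum h y y"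
      by (rule order.strict_trans2[OF zero_less_one])
    then show ?thesis
      using h(1) by (simp add: ennreal_zero_less_mult_iff)
  qed
  also have "\<dots> \<le> green y y"
    by (rule grid_sum_le_green) (use h in \<open>auto intro: less_imp_le\<close>)
  finally show ?thesis .
qed

lemma green_0: "1 \<le> y \<Longrightarrow> green 0 y = 0"
  unfolding green_def by (subst nn_integral_cong[where v="\<lambda>_. 0"]) (auto simp: p_trap indicator_def)

text \<open>The Markov property at time \<open>t\<close>, integrated over the remaining
  time.\<close>

lemma nn_integral_p_shift:
  assumes "0 \<le> t" and A: "A \<in> sets borel" "A \<subseteq> {0..}"
  shows "(\<integral>\<^sup>+r. ennreal (p (t + r) x y) * indicator A r \<partial>lborel)
    = (\<Sum>u. ennreal (p t x u) * (\<integral>\<^sup>+r. ennreal (p r u y) * indicator A r \<partial>lborel))"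
proof -
  have eq: "ennreal (p (t + r) x y) * indicator A r
      = (\<Sum>u. ennreal (p t x u) * (ennreal (p r u y) * indicator A r))" for r
  proof (cases "r \<in> A")
    case True
    then have "0 \<le> r" using A(2) by auto
    then have "ennreal (p (t + r) x y) = (\<integral>\<^sup>+u. ennreal (p r u y) \<partial>K t x)"
      using assms(1) by (simp only: K_add ennreal_pmf_bind)
    also have "\<dots> = (\<Sum>u. ennreal (p t x u) * ennreal (p r u y))"
      by (simp only: nn_integral_measure_pmf nn_integral_count_space_nat)
    finally show ?thesis
      using True by (simp only: indicator_simps mult_1_right)
  next
    case False
    show ?thesis
      by (simp only: indicator_simps(2)[OF False] mult_zero_right suminf_zero)
  qed
  have m: "(\<lambda>r. ennreal (p r u y) * indicator A r) \<in> borel_measurable lborel" for u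
    unfolding measurable_lborel2 by (rule measurable_p_interval[OF A])
  have "(\<integral>\<^sup>+r. ennreal (p (t + r) x y) * indicator A r \<partial>lborel)
    = (\<integral>\<^sup>+r. (\<Sum>u. ennreal (p t x u) * (ennreal (p r u y) * indicator A r)) \<partial>lborel)"
    by (simp only: eq)
  also have "\<dots> = (\<Sum>u. \<integral>\<^sup>+r. ennreal (p t x u) * (ennreal (p r u y) * indicator A r) \<partial>lborel)"
    by (intro nn_integral_suminf borel_measurable_times_ennreal[OF borel_measurable_const m])
  also have "\<dots> = (\<Sum>u. ennreal (p t x u) * (\<integral>\<^sup>+r. ennreal (p r u y) * indicator A r \<partial>lborel))"
    by (simp only: nn_integral_cmult[OF m])
  finally show ?thesis .
qed

end

text \<open>What the convergence argument needs from the scale function: \<open>w y\<close> stands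
  for W(0,y), a bound for the occupation time of \<open>y\<close> from anywhere, exact at
  \<open>y = 1\<close> because every path to 0 from a state above 1 passes through 1.\<close>

locale entrance_semigroup = absorbed_semigroup +
  fixes w :: "nat \<Rightarrow> real"
  assumes w_nonneg: "\<And>y. 0 \<le> w y"
    and w_summable: "summable w"
    and green_le: "\<And>x y. 1 \<le> x \<Longrightarrow> 1 \<le> y \<Longrightarrow> green x y \<le> ennreal (w y)"
    and green_1: "\<And>x. 1 \<le> x \<Longrightarrow> green x 1 = ennreal (w 1)"
begin

section \<open>Estimates uniform in the starting point\<close>

lemma w_pos: "0 < w 1"
  using green_pos[of 1] green_1[of 1] by simp

lemma suminf_surv: "(\<Sum>u. ennreal (p t x u) * (of_bool (u \<noteq> 0) * c)) = ennreal (surv t x) * c"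
proof -
  have "(\<Sum>u. ennreal (p t x u) * of_bool (u \<noteq> 0)) = (\<integral>\<^sup>+u. of_bool (u \<noteq> 0) \<partial>K t x)"
    by (simp add: nn_integral_measure_pmf nn_integral_count_space_nat)
  also have "\<dots> = (\<integral>\<^sup>+u. indicator {0<..} u \<partial>K t x)"
    by (intro nn_integral_cong) (auto simp: indicator_def)
  also have "\<dots> = ennreal (surv t x)"
    by (simp add: surv_measure measure_pmf.emeasure_eq_measure)
  finally show ?thesis
    by (simp add: mult.assoc[symmetric])
qed

abbreviation tail :: "nat \<Rightarrow> real \<Rightarrow> nat \<Rightarrow> real" where
  "tail z t x \<equiv> measure (measure_pmf (K t x)) {z<..}"

lemma tail_nn: "ennreal (tail z t x) = (\<Sum>y. ennreal (p t x (y + Suc z)))"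
proof -
  have "ennreal (tail z t x) = (\<integral>\<^sup>+u. indicator {z<..} u \<partial>K t x)"
    by (simp add: measure_pmf.emeasure_eq_measure)
  also have "\<dots> = (\<Sum>u. ennreal (p t x u) * indicator {z<..} u)"
    by (simp add: nn_integral_measure_pmf nn_integral_count_space_nat)
  also have "\<dots> = (\<Sum>y. ennreal (p t x (y + Suc z)) * indicator {z<..} (y + Suc z))
      + (\<Sum>y<Suc z. ennreal (p t x y) * indicator {z<..} y)"
    by (rule suminf_offset) (rule summableI)
  finally show ?thesis by simp
qed

text \<open>After time \<open>t\<close> each \<open>y > z\<close> is occupied for a mean time of at
  most \<open>w y\<close>, whatever the state at \<open>t\<close>; the factor
  \<open>surv t x\<close> appears because mass already in 0 contributes nothing.\<close>

lemma tail_integral: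
  assumes "0 \<le> t" and A: "A \<in> sets borel" "A \<subseteq> {0..}"
  shows "(\<integral>\<^sup>+r. ennreal (tail z (t + r) x) * indicator A r \<partial>lborel)
    \<le> ennreal (surv t x * (\<Sum>y. w (y + Suc z)))"
proof -
  have le: "(\<integral>\<^sup>+r. ennreal (p r u y) * indicator A r \<partial>lborel) \<le> of_bool (u \<noteq> 0) * ennreal (w y)"
    if "1 \<le> y" for u y
  proof -
    have "(\<integral>\<^sup>+r. ennreal (p r u y) * indicator A r \<partial>lborel) \<le> green u y"
      unfolding green_def using A(2) by (intro nn_integral_mono) (auto simp: indicator_def)
    also have "\<dots> \<le> of_bool (u \<noteq> 0) * ennreal (w y)"
      using that green_le[of u y] by (cases "u = 0") (auto simp: green_0)
    finally show ?thesis .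
  qed
  have meas: "(\<lambda>r. ennreal (p (t + r) x y) * indicator A r) \<in> borel_measurable borel" for y
  proof -
    have "(\<lambda>r. ennreal (p (t + r) x y) * indicator A r)
      = (\<lambda>r. ennreal (indicator {0..} (t + r) * p (t + r) x y) * indicator A r)"
      using assms by (auto simp: indicator_def fun_eq_iff)
    moreover have "(\<lambda>r. indicator {0..} (t + r) * p (t + r) x y) \<in> borel_measurable borel"
      by (rule measurable_compose[OF _ measurable_p]) simp
    ultimately show ?thesis
      using A(1) by simp
  qed
  have "(\<integral>\<^sup>+r. ennreal (tail z (t + r) x) * indicator A r \<partial>lborel)
      = (\<Sum>y. \<integral>\<^sup>+r. ennreal (p (t + r) x (y + Suc z)) * indicator A r \<partial>lborel)"
    unfolding tail_nn using meas by (subst nn_integral_suminf[symmetric]) auto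
  also have "\<dots> \<le> (\<Sum>y. \<Sum>u. ennreal (p t x u) * (of_bool (u \<noteq> 0) * ennreal (w (y + Suc z))))"
    unfolding nn_integral_p_shift[OF assms]
    by (intro suminf_le summableI mult_left_mono le) auto
  also have "\<dots> = (\<Sum>y. ennreal (surv t x) * ennreal (w (y + Suc z)))"
    by (simp only: suminf_surv)
  also have "\<dots> = ennreal (surv t x * (\<Sum>y. w (y + Suc z)))"
    using suminf_ennreal2[of "\<lambda>y. w (y + Suc z)"] suminf_nonneg[of "\<lambda>y. w (y + Suc z)"]
      summable_ignore_initial_segment[OF w_summable, of "Suc z"] w_nonneg
    by (simp only: ennreal_suminf_cmult ennreal_mult surv_nonneg)
  finally show ?thesis .
qed

text \<open>An averaging argument: if the tail exceeded \<open>c / l * surv t x\<close> throughout a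
  window of length \<open>l\<close>, the occupation time above \<open>z\<close> would exceed the
  bound of \<open>tail_integral\<close>.\<close>

lemma tail_dip:
  assumes "0 \<le> t" "1 \<le> x" "0 < l" "(\<Sum>y. w (y + Suc z)) < c"
  shows "\<exists>s\<in>{t..t+l}. tail z s x \<le> c / l * surv t x"
proof (rule ccontr)
  assume "\<not> ?thesis"
  then have gt: "c / l * surv t x < tail z (t + r) x" if "r \<in> {0..l}" for r
    using that by (auto simp: not_le)
  have c: "0 < c"
    using assms(4) suminf_nonneg[OF summable_ignore_initial_segment[OF w_summable, of "Suc z"]] w_nonneg
    by force
  have "ennreal (c * surv t x) = (\<integral>\<^sup>+r. ennreal (c / l * surv t x) * indicator {0..l} r \<partial>lborel)"
    using assms c surv_nonneg[of t x] by (simp add: nn_integral_cmult_indicator flip: ennreal_mult)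
  also have "\<dots> \<le> (\<integral>\<^sup>+r. ennreal (tail z (t + r) x) * indicator {0..l} r \<partial>lborel)"
    using gt by (intro nn_integral_mono) (auto simp: indicator_def intro!: ennreal_leI intro: less_imp_le)
  also have "\<dots> \<le> ennreal (surv t x * (\<Sum>y. w (y + Suc z)))"
    by (rule tail_integral) (use assms in auto)
  finally have "c * surv t x \<le> (\<Sum>y. w (y + Suc z)) * surv t x"
    using suminf_nonneg[OF summable_ignore_initial_segment[OF w_summable, of "Suc z"]] w_nonneg
      surv_nonneg[of t x]
    by (simp add: mult.commute ennreal_le_iff)
  then show False
    using assms(4) surv_pos[OF assms(1,2)] by auto
qed

lemma tail_small: "0 < c \<Longrightarrow> \<exists>z. (\<Sum>y. w (y + Suc z)) < c"
proof -
  assume "0 < c"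
  then obtain N where "\<And>n. N \<le> n \<Longrightarrow> norm (\<Sum>y. w (y + n)) < c"
    using suminf_exist_split[OF _ w_summable, of c] by blast
  from this[of "Suc N"] show ?thesis
    by (intro exI[of _ N]) auto
qed

text \<open>The tail above level 0 is survival itself. A window of length \<open>c / e\<close> makes
  the dip level equal to \<open>e\<close>, and survival can only decrease after the dip.\<close>

lemma surv_uniform_small: assumes "0 < e" shows "\<exists>T>0. \<forall>x. surv T x \<le> e"
proof -
  define c where "c = (\<Sum>y. w (y + Suc 0)) + 1"
  have c: "0 < c"
    using suminf_nonneg[OF summable_ignore_initial_segment[OF w_summable, of "Suc 0"]] w_nonneg
    by (simp add: c_def add_nonneg_pos)
  have "surv (c / e) x \<le> e" for x
  proof (cases "x = 0")
    case False
    then obtain s where "s \<in> {0..c / e}" "tail 0 s x \<le> c / (c / e) * surv 0 x"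
      using tail_dip[of 0 x "c / e" 0 c] c assms by (auto simp: c_def)
    then show ?thesis
      using surv_antimono[of s "c / e" x] c assms by (simp add: surv_measure[symmetric] surv_0 False)
  qed (use assms c in \<open>simp add: surv_trap\<close>)
  then show ?thesis
    using c assms by (intro exI[of _ "c / e"]) auto
qed

text \<open>State 1 reaches any given state with positive probability and can then survive from
  there; finitely many states admit a common constant.\<close>

lemma surv_compare_finite: "\<exists>C\<ge>0. \<forall>u\<le>z. \<forall>t\<ge>0. surv t u \<le> C * surv t 1"
proof (induction z)
  case 0
  show ?case by (intro exI[of _ 0]) (simp add: surv_trap)
next
  case (Suc z)
  then obtain C where C: "C \<ge> 0" "\<And>u t. u \<le> z \<Longrightarrow> 0 \<le> t \<Longrightarrow> surv t u \<le> C * surv t 1"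
    by blast
  obtain q where q: "q > 0" "0 < p q 1 (Suc z)"
    using K_reach[of 1 "Suc z"] by auto
  have "surv t (Suc z) \<le> 1 / p q 1 (Suc z) * surv t 1" if "0 \<le> t" for t
  proof -
    have "p q 1 (Suc z) * surv t (Suc z) \<le> surv (q + t) 1"
      using q that by (intro surv_add_ge) auto
    also have "\<dots> \<le> surv t 1"
      using q that by (intro surv_antimono) auto
    finally show ?thesis using q by (simp add: field_simps)
  qed
  moreover have "surv t u \<le> max C (1 / p q 1 (Suc z)) * surv t 1"
    if "surv t u \<le> C * surv t 1 \<or> surv t u \<le> 1 / p q 1 (Suc z) * surv t 1" for t u
    using that surv_nonneg[of t 1]
    by (meson max.cobounded1 max.cobounded2 mult_right_mono order_trans)
  ultimately have "\<forall>u\<le>Suc z. \<forall>t\<ge>0. surv t u \<le> max C (1 / p q 1 (Suc z)) * surv t 1"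
    using C(2) by (metis le_Suc_eq)
  then show ?case
    using C(1) by (intro exI[of _ "max C (1 / p q 1 (Suc z))"]) auto
qed

text \<open>Before time 1 the chain has been in a finite set with probability close to 1, uniformly in
  the starting point; the small exceptional probability beats the rate at which the survival
  probability from 1 decreases.\<close>

lemma surv_compare: "\<exists>C>0. \<forall>t\<ge>0. \<forall>x. surv t x \<le> C * surv t 1"
proof -
  define \<rho> where "\<rho> = p 1 1 1"
  have \<rho>: "0 < \<rho>" by (simp add: \<rho>_def p_diag_pos)
  have step: "\<rho> * surv t 1 \<le> surv (t + 1) 1" if "0 \<le> t" for t
    using surv_add_ge[of 1 t 1 1] that by (simp add: \<rho>_def add.commute)
  \<comment> \<open>Survival from 1 keeps at least the factor \<open>\<rho>\<close> per unit of
    time, so an exceptional mass of \<open>\<rho> / 2\<close> is affordable.\<close>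
  obtain z where z: "(\<Sum>y. w (y + Suc z)) < \<rho> / 2"
    using tail_small[of "\<rho> / 2"] \<rho> by auto
  obtain C where C: "C \<ge> 0" "\<And>u t. u \<le> z \<Longrightarrow> 0 \<le> t \<Longrightarrow> surv t u \<le> C * surv t 1"
    using surv_compare_finite[of z] by auto
  \<comment> \<open>With this choice the states up to \<open>z\<close> and the exceptional tail each
    contribute at most half of \<open>\<rho> * B\<close>, so the induction reproduces the same
    constant \<open>B\<close>.\<close>
  define B where "B = max 1 (2 * C / \<rho>)"
  have B: "1 \<le> B" "C \<le> \<rho> / 2 * B"
    using \<rho> by (auto simp: B_def field_simps max_def)
  have nat: "surv (real n) x \<le> B * surv (real n) 1" for n x
  proof (induction n arbitrary: x)
    case 0
    then show ?case using B by (auto simp: surv_0)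
  next
    case (Suc n)
    show ?case
    proof (cases "x = 0")
      case False
      then obtain s where s: "s \<in> {0..1}" "tail z s x \<le> \<rho> / 2"
        using tail_dip[of 0 x 1 z "\<rho> / 2"] z by (auto simp: surv_0)
      have "surv (real (Suc n)) x \<le> surv (s + real n) x"
        using s by (intro surv_antimono) auto
      also have "\<dots> = measure_pmf.expectation (K s x) (surv (real n))"
        using s by (intro surv_add) auto
      also have "\<dots> \<le> measure_pmf.expectation (K s x)
          (\<lambda>u. C * surv (real n) 1 + B * surv (real n) 1 * indicator {z<..} u)"
      proof (intro integral_mono integrable_surv integrable_pmf_bounded[where B="\<bar>C * surv (real n) 1\<bar> + \<bar>B * surv (real n) 1\<bar>"])
        fix u
        have "0 \<le> C * surv (real n) 1" "0 \<le> B * surv (real n) 1"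
          using C B surv_nonneg by auto
        then show "surv (real n) u \<le> C * surv (real n) 1 + B * surv (real n) 1 * indicator {z<..} u"
          using C(2)[of u "real n"] Suc.IH[of u] by (cases "u \<le> z") (auto simp: indicator_def)
      qed (auto simp: indicator_def)
      also have "\<dots> = C * surv (real n) 1 + B * surv (real n) 1 * tail z s x"
        by (subst Bochner_Integration.integral_add) (auto simp: measure_pmf.emeasure_eq_measure)
      also have "\<dots> \<le> \<rho> / 2 * B * surv (real n) 1 + B * surv (real n) 1 * (\<rho> / 2)"
        using B s surv_nonneg by (intro add_mono mult_right_mono mult_left_mono) auto
      also have "\<dots> = B * (\<rho> * surv (real n) 1)"
        by simp
      also have "\<dots> \<le> B * surv (real (Suc n)) 1"
        using step[of "real n"] B by (intro mult_left_mono) (auto simp: add.commute)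
      finally show ?thesis .
    qed (use B surv_nonneg in \<open>simp add: surv_trap\<close>)
  qed
  \<comment> \<open>Rounding \<open>t\<close> down to an integer costs one more factor
    \<open>\<rho>\<close>.\<close>
  have "surv t x \<le> B / \<rho> * surv t 1" if "0 \<le> t" for t x
  proof -
    define n where "n = nat \<lfloor>t\<rfloor>"
    have n: "real n \<le> t" "t \<le> real n + 1"
      using that by (auto simp: n_def)
    have "surv t x \<le> surv (real n) x"
      using n by (intro surv_antimono) auto
    also have "\<dots> \<le> B * surv (real n) 1" by (rule nat)
    also have "\<dots> = B / \<rho> * (\<rho> * surv (real n) 1)" using \<rho> by simp
    also have "\<dots> \<le> B / \<rho> * surv t 1"
      using step[of "real n"] surv_antimono[OF that n(2), of 1] B \<rho> by (intro mult_left_mono) auto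
    finally show ?thesis .
  qed
  then show ?thesis
    using B \<rho> by (intro exI[of _ "B / \<rho>"]) auto
qed

text \<open>From every \<open>x >= 1\<close> the mean occupation time of 1 is exactly
  \<open>w 1\<close>. At most half of it falls after \<open>T\<close>, since only a fraction 1/2
  survives that long. The other half falls before \<open>T\<close>, so at some \<open>s < T\<close>
  the chain is in 1 with probability at least \<open>w 1 / (4 * T)\<close>; from there it is in 1 at
  time \<open>T\<close> with probability at least \<open>m\<close>.\<close>

lemma uniform_lower_bound: "\<exists>T>0. \<exists>\<delta>>0. \<forall>x\<ge>1. \<delta> \<le> p T x 1"
proof -
  obtain T where T: "T > 0" "\<And>x. surv T x \<le> 1/2"
    using surv_uniform_small[of "1/2"] by auto
  obtain m where m: "m > 0" "\<And>s. s \<in> {0..T} \<Longrightarrow> m \<le> p s 1 1"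
    using p_diag_min[of T 1] T(1) by auto
  have "m * (w 1 / (4 * T)) \<le> p T x 1" if x: "1 \<le> x" for x
  proof -
    have "\<exists>s\<in>{0..<T}. w 1 / (4 * T) \<le> p s x 1"
    proof (rule ccontr)
      assume "\<not> ?thesis"
      then have less: "p s x 1 < w 1 / (4 * T)" if "s \<in> {0..<T}" for s
        using that by (auto simp: not_le)
      have "(\<integral>\<^sup>+s. ennreal (p s x 1) * indicator {T..} s \<partial>lborel)
          = (\<integral>\<^sup>+r. ennreal (p (T + r) x 1) * indicator {0..} r \<partial>lborel)"
        using T(1) by (subst nn_integral_real_affine[where c=1 and t=T])
          (auto intro!: measurable_p_interval[of "{T..}"] nn_integral_cong split: split_indicator)
      also have "\<dots> = (\<Sum>u. ennreal (p T x u) * green u 1)"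
        using T(1) by (subst nn_integral_p_shift) (auto simp: green_def)
      also have "\<dots> = (\<Sum>u. ennreal (p T x u) * (of_bool (u \<noteq> 0) * ennreal (w 1)))"
        using green_0[of 1] green_1 by (intro suminf_cong) (auto simp: Suc_le_eq)
      also have "\<dots> \<le> ennreal (1/2) * ennreal (w 1)"
        unfolding suminf_surv using T(2) by (intro mult_right_mono ennreal_leI) auto
      also have "\<dots> = ennreal (w 1 / 2)"
        using w_pos by (subst ennreal_mult[symmetric]) auto
      finally have late: "(\<integral>\<^sup>+s. ennreal (p s x 1) * indicator {T..} s \<partial>lborel) \<le> ennreal (w 1 / 2)" .
      have "(\<integral>\<^sup>+s. ennreal (p s x 1) * indicator {0..<T} s \<partial>lborel)
          \<le> (\<integral>\<^sup>+s. ennreal (w 1 / (4 * T)) * indicator {0..<T} s \<partial>lborel)"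
        using less by (intro nn_integral_mono) (auto simp: indicator_def intro!: ennreal_leI intro: less_imp_le)
      also have "\<dots> = ennreal (w 1 / 4)"
        using T(1) w_pos by (simp add: nn_integral_cmult_indicator flip: ennreal_mult)
      finally have early: "(\<integral>\<^sup>+s. ennreal (p s x 1) * indicator {0..<T} s \<partial>lborel) \<le> ennreal (w 1 / 4)" .
      have "ennreal (w 1) = (\<integral>\<^sup>+s. ennreal (p s x 1) * indicator {0..<T} s
          + ennreal (p s x 1) * indicator {T..} s \<partial>lborel)"
        unfolding green_1[OF x, symmetric] green_def
        using T(1) by (intro nn_integral_cong) (auto split: split_indicator)
      also have "\<dots> = (\<integral>\<^sup>+s. ennreal (p s x 1) * indicator {0..<T} s \<partial>lborel)
          + (\<integral>\<^sup>+s. ennreal (p s x 1) * indicator {T..} s \<partial>lborel)"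
        using T(1) by (intro nn_integral_add; unfold measurable_lborel2; intro measurable_p_interval) auto
      also have "\<dots> \<le> ennreal (w 1 / 4) + ennreal (w 1 / 2)"
        by (intro add_mono early late)
      also have "\<dots> = ennreal (w 1 / 4 + w 1 / 2)"
        using w_pos by (intro ennreal_plus[symmetric]) auto
      finally have "ennreal (w 1) \<le> ennreal (w 1 / 4 + w 1 / 2)" .
      then show False
        using w_pos by (simp add: ennreal_le_iff)
    qed
    then obtain s where s: "s \<in> {0..<T}" "w 1 / (4 * T) \<le> p s x 1" by blast
    have "m * (w 1 / (4 * T)) \<le> p (T - s) 1 1 * p s x 1"
      using m s w_pos T(1) by (intro mult_mono) auto
    also have "\<dots> \<le> p T x 1"
      using p_add_ge[of s "T - s" x 1 1] s by (simp add: mult.commute)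
    finally show ?thesis .
  qed
  moreover have "0 < m * (w 1 / (4 * T))"
    using T(1) m(1) w_pos by simp
  ultimately show ?thesis
    using T(1) by blast
qed

end

section \<open>Convergence to the quasi-stationary distribution\<close>

context absorbed_semigroup
begin

section \<open>Contraction of conditional expectations\<close>

definition semi :: "real \<Rightarrow> (nat \<Rightarrow> real) \<Rightarrow> nat \<Rightarrow> real" where
  "semi t f x = measure_pmf.expectation (K t x) f"

text \<open>Vanishing at 0 makes \<open>semi\<close> act on these functions as the semigroup killed
  at 0.\<close>

definition unit_fun :: "(nat \<Rightarrow> real) \<Rightarrow> bool" where
  "unit_fun f \<longleftrightarrow> f 0 = 0 \<and> (\<forall>x. 0 \<le> f x \<and> f x \<le> 1)"

lemma unit_fun_integrable: "unit_fun f \<Longrightarrow> integrable (measure_pmf q) f"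
  by (rule integrable_pmf_bounded[where B=1]) (simp add: unit_fun_def abs_of_nonneg)

lemma unit_fun_indicator: "0 \<notin> A \<Longrightarrow> unit_fun (indicator A)"
  by (simp add: unit_fun_def indicator_def)

lemma unit_fun_surv: "0 \<le> t \<Longrightarrow> unit_fun (surv t)"
  by (simp add: unit_fun_def surv_trap surv_nonneg surv_le_1)

lemma unit_fun_p: "0 \<le> t \<Longrightarrow> 1 \<le> y \<Longrightarrow> unit_fun (\<lambda>x. p t x y)"
  by (simp add: unit_fun_def p_trap pmf_le_1)

lemma semi_indicator: "semi t (indicator A) x = measure (K t x) A"
  by (simp add: semi_def)

lemma semi_surv: "0 \<le> s \<Longrightarrow> 0 \<le> t \<Longrightarrow> semi s (surv t) x = surv (s + t) x"
  by (simp add: semi_def surv_add)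

lemma semi_nonneg: "unit_fun f \<Longrightarrow> 0 \<le> semi t f x"
  unfolding semi_def by (rule Bochner_Integration.integral_nonneg) (simp add: unit_fun_def)

lemma semi_le_surv: "unit_fun f \<Longrightarrow> semi t f x \<le> surv t x"
proof -
  assume f: "unit_fun f"
  have "semi t f x \<le> semi t (indicator {0<..}) x"
    unfolding semi_def
  proof (intro integral_mono unit_fun_integrable f unit_fun_indicator)
    fix u show "f u \<le> indicator {0<..} u"
      using f by (cases "u = 0") (auto simp: unit_fun_def)
  qed simp
  then show ?thesis
    by (simp only: semi_indicator surv_measure)
qed

lemma unit_fun_semi: "unit_fun f \<Longrightarrow> 0 \<le> t \<Longrightarrow> unit_fun (semi t f)"
  using semi_le_surv[of f t] surv_le_1[of t] semi_nonneg[of f t]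
  by (auto simp: unit_fun_def intro: order_trans) (simp add: semi_def K_trap)

lemma semi_add: "unit_fun f \<Longrightarrow> 0 \<le> s \<Longrightarrow> 0 \<le> t \<Longrightarrow> semi (s + t) f x = semi s (semi t f) x"
  unfolding semi_def by (subst K_add) (auto simp: unit_fun_def intro!: expectation_bind_pmf[where B=1])

text \<open>The conditional expectation of \<open>f\<close> given survival up to \<open>t\<close>
  lies in \<open>[a,b]\<close> for every starting point. Written without division, so that
  \<open>x = 0\<close> is no exception.\<close>

definition framed :: "real \<Rightarrow> real \<Rightarrow> real \<Rightarrow> (nat \<Rightarrow> real) \<Rightarrow> bool" where
  "framed a b t f \<longleftrightarrow> (\<forall>x. a * surv t x \<le> semi t f x \<and> semi t f x \<le> b * surv t x)"

text \<open>\<open>semi s\<close> is a positive operator that maps \<open>surv t\<close> to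
  \<open>surv (s + t)\<close>, so it preserves both inequalities.\<close>

lemma framed_later:
  assumes "unit_fun f" "framed a b t f" "0 \<le> t" "t \<le> t'"
  shows "framed a b t' f"
proof -
  define s where "s = t' - t"
  have s: "t' = s + t" "0 \<le> s" using assms(4) by (auto simp: s_def)
  have "semi s (\<lambda>y. a * surv t y) x \<le> semi s (semi t f) x"
    "semi s (semi t f) x \<le> semi s (\<lambda>y. b * surv t y) x" for x
    using assms(2) unfolding semi_def[of s] framed_def
    by (intro integral_mono integrable_mult_right integrable_surv
      unit_fun_integrable[OF unit_fun_semi] assms(1,3), simp)+
  moreover have "semi s (\<lambda>y. c * surv t y) x = c * surv t' x" for c x
    unfolding s(1) using surv_add[OF s(2) assms(3)] by (simp add: semi_def)
  ultimately show ?thesis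
    using semi_add[OF assms(1) s(2) assms(3)] by (simp add: framed_def s(1))
qed

lemma framed_cross:
  assumes "unit_fun f" "framed a b t f" "framed a' b' t' f" "0 \<le> t" "0 \<le> t'"
  shows "a \<le> b'"
proof -
  let ?m = "max t t'"
  have "a * surv ?m 1 \<le> semi ?m f 1" "semi ?m f 1 \<le> b' * surv ?m 1"
    using framed_later[OF assms(1,2,4), of ?m] framed_later[OF assms(1,3,5), of ?m]
    by (auto simp: framed_def)
  then show ?thesis
    using surv_pos[of ?m 1] assms by (auto dest: order_trans)
qed

end

context entrance_semigroup
begin

text \<open>Let \<open>r\<close> be the conditional expectation of \<open>f\<close> started from 1.
  From every \<open>x >= 1\<close>, at least the fraction \<open>c\<close> of the paths that survive
  up to \<open>T + t\<close> sits in 1 at time \<open>T\<close> and contributes the same value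
  \<open>r\<close>; the rest stays within \<open>[a,b]\<close>. So the new frame is
  \<open>c * r + (1 - c) * [a,b]\<close>.\<close>

lemma framed_contract:
  "\<exists>T>0. \<exists>c>0. c \<le> 1 \<and> (\<forall>t\<ge>0. \<forall>f a b. unit_fun f \<longrightarrow> framed a b t f \<longrightarrow>
     (\<exists>a' b'. b' - a' = (1 - c) * (b - a) \<and> framed a' b' (T + t) f))"
proof -
  obtain T \<delta> where T: "T > 0" "\<delta> > 0" "\<And>x. 1 \<le> x \<Longrightarrow> \<delta> \<le> p T x 1"
    using uniform_lower_bound by auto
  obtain C where C: "C > 0" "\<And>t x. 0 \<le> t \<Longrightarrow> surv t x \<le> C * surv t 1"
    using surv_compare by auto
  \<comment> \<open>\<open>\<delta>\<close> is the uniform chance of being in 1 at time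
    \<open>T\<close>, and \<open>C\<close> compares survival from any state with survival from 1;
    the minimum keeps \<open>1 - c\<close> nonnegative.\<close>
  define c where "c = min 1 (\<delta> / C)"
  have c: "0 < c" "c \<le> 1" "c * C \<le> \<delta>"
    using T C by (auto simp: c_def min_def field_simps)
  have "\<exists>a' b'. b' - a' = (1 - c) * (b - a) \<and> framed a' b' (T + t) f"
    if t: "0 \<le> t" and f: "unit_fun f" and fr: "framed a b t f" for t f a b
  proof -
    define r where "r = semi t f 1 / surv t 1"
    have s1: "0 < surv t 1" using surv_pos t by simp
    have r: "semi t f 1 = r * surv t 1" "a \<le> r" "r \<le> b"
      using fr s1 by (auto simp: r_def framed_def field_simps)
    have key: "c * surv (T + t) x \<le> p T x 1 * surv t 1" if "1 \<le> x" for x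
    proof -
      have "c * surv (T + t) x \<le> c * (C * surv t 1)"
        using surv_antimono[of t "T + t" x] C(2)[OF t, of x] T(1) t c(1) by (intro mult_left_mono) auto
      also have "\<dots> \<le> \<delta> * surv t 1"
        using c(3) s1 by (simp add: mult.assoc[symmetric])
      also have "\<dots> \<le> p T x 1 * surv t 1"
        using T(3)[OF that] s1 by simp
      finally show ?thesis .
    qed
    \<comment> \<open>The comparison functions are a multiple of \<open>surv t\<close>, corrected at
      the single state 1.\<close>
    have pt: "semi T (\<lambda>y. k * surv t y + (if y = 1 then d else 0)) x = k * surv (T + t) x + p T x 1 * d" for k d x
    proof -
      have "semi T (\<lambda>y. k * surv t y + (if y = 1 then d else 0)) x
          = k * semi T (surv t) x + semi T (\<lambda>y. if y = 1 then d else 0) x"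
        unfolding semi_def
        by (subst Bochner_Integration.integral_add)
          (auto intro!: integrable_mult_right integrable_surv integrable_pmf_bounded[where B="\<bar>d\<bar>"])
      also have "semi T (\<lambda>y. if y = 1 then d else 0) x = p T x 1 * d"
        unfolding semi_def by (subst integral_measure_pmf_real[of "{1}"]) (auto split: if_splits)
      finally show ?thesis
        using T(1) t by (simp add: semi_surv)
    qed
    have int: "integrable (measure_pmf q) (\<lambda>y. k * surv t y + (if y = 1 then d else 0))" for q k d
      by (intro Bochner_Integration.integrable_add integrable_mult_right integrable_surv
        integrable_pmf_bounded[where B="\<bar>d\<bar>"]) auto
    have "framed (c * r + (1 - c) * a) (c * r + (1 - c) * b) (T + t) f"
      unfolding framed_def
    proof (intro allI conjI)
      fix x
      have st: "semi (T + t) f x = semi T (semi t f) x"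
        using semi_add f T(1) t by simp
      \<comment> \<open>The frame bound is used at every state except 1, where the true value
        \<open>r * surv t 1\<close> replaces it; that is where the width is gained.\<close>
      have *: "a * surv (T + t) x + p T x 1 * ((r - a) * surv t 1) \<le> semi (T + t) f x"
        unfolding st pt[symmetric] unfolding semi_def[of T]
        using fr r by (intro integral_mono int unit_fun_integrable[OF unit_fun_semi] f t)
          (auto simp: framed_def algebra_simps)
      have **: "semi (T + t) f x \<le> b * surv (T + t) x + p T x 1 * ((r - b) * surv t 1)"
        unfolding st pt[symmetric] unfolding semi_def[of T]
        using fr r by (intro integral_mono int unit_fun_integrable[OF unit_fun_semi] f t)
          (auto simp: framed_def algebra_simps)
      show "(c * r + (1 - c) * a) * surv (T + t) x \<le> semi (T + t) f x"
      proof (cases "x = 0")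
        case True
        then show ?thesis
          using T(1) t f semi_nonneg[OF f, of "T + t" x] by (simp add: surv_trap)
      next
        case False
        then have "(r - a) * (c * surv (T + t) x) \<le> (r - a) * (p T x 1 * surv t 1)"
          using key[of x] r by (intro mult_left_mono) auto
        with * show ?thesis by (simp add: algebra_simps)
      qed
      show "semi (T + t) f x \<le> (c * r + (1 - c) * b) * surv (T + t) x"
      proof (cases "x = 0")
        case True
        then show ?thesis
          using T(1) t semi_le_surv[OF f, of "T + t" x] by (simp add: surv_trap)
      next
        case False
        then have "(b - r) * (c * surv (T + t) x) \<le> (b - r) * (p T x 1 * surv t 1)"
          using key[of x] r by (intro mult_left_mono) auto
        with ** show ?thesis by (simp add: algebra_simps)
      qed
    qed
    then show ?thesis
      by (intro exI[of _ "c * r + (1 - c) * a"] exI[of _ "c * r + (1 - c) * b"]) (simp add: algebra_simps)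
  qed
  then show ?thesis
    using T(1) c(1,2) by (intro exI[of _ T] conjI exI[of _ c]) auto
qed

text \<open>Starting from the frame \<open>[0,1]\<close> at time 0, \<open>n\<close> contractions
  leave the width \<open>(1 - c) ^ n\<close>.\<close>

lemma framed_narrow:
  assumes "unit_fun f" "0 < e"
  shows "\<exists>t\<ge>0. \<exists>a b. b - a < e \<and> framed a b t f"
proof -
  obtain T c where T: "T > 0" "c > 0" "c \<le> 1" "\<And>t a b. 0 \<le> t \<Longrightarrow> framed a b t f \<Longrightarrow>
     \<exists>a' b'. b' - a' = (1 - c) * (b - a) \<and> framed a' b' (T + t) f"
    using framed_contract assms(1) by meson
  have "\<exists>a b. b - a = (1 - c) ^ n \<and> framed a b (real n * T) f" for n
  proof (induction n)
    case 0
    have "framed 0 1 0 f"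
      using semi_nonneg[OF assms(1)] semi_le_surv[OF assms(1)] by (simp add: framed_def)
    then show ?case
      by (intro exI[of _ 0] exI[of _ 1]) simp
  next
    case (Suc n)
    then obtain a b where "b - a = (1 - c) ^ n" "framed a b (real n * T) f" by blast
    then show ?case
      using T(4)[of "real n * T" a b] T(1) by (simp add: algebra_simps)
  qed
  moreover obtain n where "(1 - c) ^ n < e"
    using real_arch_pow_inv[OF assms(2), of "1 - c"] T by auto
  ultimately obtain a b where "b - a < e" "framed a b (real n * T) f"
    by metis
  then show ?thesis
    using T(1) by (intro exI[of _ "real n * T"]) auto
qed

lemma ratio_limit:
  assumes f: "unit_fun f"
  shows "\<exists>L. \<forall>x\<ge>1. ((\<lambda>t. semi t f x / surv t x) \<longlongrightarrow> L) at_top"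
proof -
  \<comment> \<open>By \<open>framed_cross\<close> every lower end is below every upper end,
    whatever the times, so the supremum of the lower ends lies in all frames.\<close>
  define A where "A = {a. \<exists>t\<ge>0. \<exists>b. framed a b t f}"
  define L where "L = Sup A"
  have L: "a \<le> L" "L \<le> b" if "framed a b t f" "0 \<le> t" for a b t
  proof -
    have le: "a' \<le> b" if "a' \<in> A" for a'
      using that framed_cross[OF f _ \<open>framed a b t f\<close>] \<open>0 \<le> t\<close> by (auto simp: A_def)
    have "a \<in> A" using that by (auto simp: A_def)
    then show "a \<le> L" unfolding L_def
      using le by (intro cSup_upper bdd_aboveI[of A b])
    show "L \<le> b" unfolding L_def
      using le \<open>a \<in> A\<close> by (intro cSup_least) auto
  qed
  have "((\<lambda>t. semi t f x / surv t x) \<longlongrightarrow> L) at_top" if x: "1 \<le> x" for x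
  proof (rule tendstoI)
    fix e :: real assume "0 < e"
    obtain t a b where t: "0 \<le> t" "b - a < e" "framed a b t f"
      using framed_narrow[OF f \<open>0 < e\<close>] by blast
    have "dist (semi t' f x / surv t' x) L < e" if "t \<le> t'" for t'
    proof -
      have "0 < surv t' x" using surv_pos[of t' x] x t that by simp
      then have "a \<le> semi t' f x / surv t' x" "semi t' f x / surv t' x \<le> b"
        using framed_later[OF f t(3,1) that] by (auto simp: framed_def field_simps)
      then show ?thesis
        using L[OF t(3,1)] t(2) by (auto simp: dist_real_def)
    qed
    then show "\<forall>\<^sub>F t in at_top. dist (semi t f x / surv t x) L < e"
      by (auto simp: eventually_at_top_linorder)
  qed
  then show ?thesis by blast
qed

text \<open>The limit law as a functional. It is defined on functions first, because a limit of laws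
  need not be countably additive; \<open>sums_lim_ratio\<close> supplies that afterwards.\<close>

definition lim_ratio :: "(nat \<Rightarrow> real) \<Rightarrow> real" where
  "lim_ratio f = (SOME L. \<forall>x\<ge>1. ((\<lambda>t. semi t f x / surv t x) \<longlongrightarrow> L) at_top)"

lemma tendsto_lim_ratio:
  "unit_fun f \<Longrightarrow> 1 \<le> x \<Longrightarrow> ((\<lambda>t. semi t f x / surv t x) \<longlongrightarrow> lim_ratio f) at_top"
  unfolding lim_ratio_def using someI_ex[OF ratio_limit] by blast

end

text \<open>Additivity and nonnegativity give monotonicity. Comparing \<open>g (n * t)\<close> with
  the values at the neighbouring integers leaves an error of at most \<open>g 1\<close>, which is
  then divided by \<open>n\<close>.\<close>

lemma additive_nonneg_imp_linear:
  fixes g :: "real \<Rightarrow> real"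
  assumes add: "\<And>s t. 0 \<le> s \<Longrightarrow> 0 \<le> t \<Longrightarrow> g (s + t) = g s + g t"
    and nonneg: "\<And>t. 0 \<le> t \<Longrightarrow> 0 \<le> g t" and "0 \<le> t"
  shows "g t = t * g 1"
proof -
  have "g 0 = 0" using add[of 0 0] by simp
  then have mult: "g (real n * s) = real n * g s" if "0 \<le> s" for n s
    using that by (induction n) (simp_all add: add algebra_simps)
  have mono: "g s \<le> g s'" if "0 \<le> s" "s \<le> s'" for s s'
    using add[of s "s' - s"] nonneg[of "s' - s"] that by simp
  have "real n * \<bar>g t - t * g 1\<bar> \<le> g 1" for n
  proof -
    define k where "k = nat \<lfloor>real n * t\<rfloor>"
    have k: "real k \<le> real n * t" "real n * t \<le> real (Suc k)"
    proof -
      have "real k = of_int \<lfloor>real n * t\<rfloor>"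
        using \<open>0 \<le> t\<close> by (simp add: k_def)
      then show "real k \<le> real n * t" "real n * t \<le> real (Suc k)"
        using floor_correct[of "real n * t"] by linarith+
    qed
    have "real k * g 1 \<le> real n * g t" "real n * g t \<le> real (Suc k) * g 1"
      using mono[of "real k" "real n * t"] mono[of "real n * t" "real (Suc k)"] k \<open>0 \<le> t\<close>
        mult[of 1 k] mult[of 1 "Suc k"] mult[of t n] by auto
    moreover have "real k * g 1 \<le> real n * t * g 1" "real n * t * g 1 \<le> real (Suc k) * g 1"
      using k nonneg[of 1] by (auto intro!: mult_right_mono)
    ultimately have "\<bar>real n * g t - real n * t * g 1\<bar> \<le> g 1"
      by (simp add: algebra_simps abs_le_iff add_increasing)
    moreover have "\<bar>real n * g t - real n * t * g 1\<bar> = \<bar>real n\<bar> * \<bar>g t - t * g 1\<bar>"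
      unfolding abs_mult[symmetric] by (simp add: right_diff_distrib mult.assoc)
    ultimately show ?thesis
      by simp
  qed
  then have "\<bar>g t - t * g 1\<bar> = 0"
    using nonneg[of 1] by (intro real_archimedian_rdiv_eq_0) auto
  then show ?thesis by simp
qed

lemma filterlim_add_const_at_top: "filterlim (\<lambda>t. t + s) at_top (at_top :: real filter)"
  using filterlim_tendsto_add_at_top[OF tendsto_const filterlim_ident, of s] by (simp add: add.commute)

section \<open>The limit law and its exponential rate\<close>

context entrance_semigroup
begin

text \<open>The value at 0 is set by hand, since the indicator of 0 is not a
  \<open>unit_fun\<close>.\<close>

definition alpha :: "nat \<Rightarrow> real" where
  "alpha y = (if y = 0 then 0 else lim_ratio (indicator {y}))"

lemma alpha_0: "alpha 0 = 0"
  by (simp add: alpha_def)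

lemma lim_ratio_bounds: assumes "unit_fun f" shows "0 \<le> lim_ratio f" "lim_ratio f \<le> 1"
proof -
  have "0 \<le> semi t f 1 / surv t 1 \<and> semi t f 1 / surv t 1 \<le> 1" if "0 \<le> t" for t
    using semi_nonneg[OF assms, of t 1] semi_le_surv[OF assms, of t 1] surv_pos[OF that, of 1]
    by simp
  then have "\<forall>\<^sub>F t in at_top. 0 \<le> semi t f 1 / surv t 1" "\<forall>\<^sub>F t in at_top. semi t f 1 / surv t 1 \<le> 1"
    by (auto simp: eventually_at_top_linorder)
  then show "0 \<le> lim_ratio f" "lim_ratio f \<le> 1"
    using tendsto_lim_ratio[OF assms, of 1]
    by (auto intro: tendsto_lowerbound tendsto_upperbound)
qed

lemma alpha_nonneg: "0 \<le> alpha y"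
  using lim_ratio_bounds(1)[OF unit_fun_indicator[of "{y}"]] by (simp add: alpha_def)

lemma tendsto_alpha:
  "1 \<le> x \<Longrightarrow> 1 \<le> y \<Longrightarrow> ((\<lambda>t. p t x y / surv t x) \<longlongrightarrow> alpha y) at_top"
  using tendsto_lim_ratio[OF unit_fun_indicator[of "{y}"], of x]
  by (simp add: alpha_def semi_indicator measure_pmf_single)

text \<open>The limit is known to exist, so it is enough to find arbitrarily late times with a small
  ratio. \<open>tail_dip\<close> gives one in each window \<open>[M, M + 1]\<close>; replacing
  \<open>surv M\<close> by survival at the dip costs the factor \<open>p 1 1 1\<close>.\<close>

lemma lim_ratio_tail:
  assumes "(\<Sum>y. w (y + Suc z)) < c"
  shows "lim_ratio (indicator {z<..}) \<le> c / p 1 1 1"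
proof (rule ccontr)
  assume "\<not> ?thesis"
  moreover have "((\<lambda>t. tail z t 1 / surv t 1) \<longlongrightarrow> lim_ratio (indicator {z<..})) at_top"
    using tendsto_lim_ratio[OF unit_fun_indicator[of "{z<..}"], of 1] by (simp add: semi_indicator)
  ultimately have "\<forall>\<^sub>F t in at_top. c / p 1 1 1 < tail z t 1 / surv t 1"
    by (intro order_tendstoD(1)) auto
  then obtain N where N: "\<And>t. N \<le> t \<Longrightarrow> c / p 1 1 1 < tail z t 1 / surv t 1"
    by (auto simp: eventually_at_top_linorder)
  define M where "M = max 0 N"
  obtain s where s: "s \<in> {M..M+1}" "tail z s 1 \<le> c / 1 * surv M 1"
    using tail_dip[of M 1 1 z c] assms by (auto simp: M_def)
  have rho: "0 < p 1 1 1" by (simp add: p_diag_pos)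
  have "p 1 1 1 * surv M 1 \<le> surv (M + 1) 1"
    using surv_add_ge[of 1 M 1 1] by (simp add: M_def add.commute)
  also have "\<dots> \<le> surv s 1"
    using s(1) by (intro surv_antimono) (auto simp: M_def)
  finally have 1: "surv M 1 \<le> surv s 1 / p 1 1 1"
    using rho by (simp add: field_simps)
  have "0 \<le> c * surv M 1" using order_trans[OF measure_nonneg s(2)] by simp
  then have "0 \<le> c" using surv_pos[of M 1] by (simp add: zero_le_mult_iff M_def)
  then have "tail z s 1 \<le> c * (surv s 1 / p 1 1 1)"
    using s(2) mult_left_mono[OF 1, of c] by simp
  moreover have "0 < surv s 1" using s(1) by (intro surv_pos) (auto simp: M_def)
  ultimately have "tail z s 1 / surv s 1 \<le> c / p 1 1 1"
    using rho by (simp add: field_simps)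
  moreover have "N \<le> s" using s(1) by (auto simp: M_def)
  ultimately show False
    using N[of s] by simp
qed

lemma lim_ratio_tail_small: assumes "0 < e" shows "\<exists>z. lim_ratio (indicator {z<..}) < e"
proof -
  have rho: "0 < p 1 1 1" by (simp add: p_diag_pos)
  obtain z where "(\<Sum>y. w (y + Suc z)) < e / 2 * p 1 1 1"
    using tail_small[of "e / 2 * p 1 1 1"] assms rho by auto
  from lim_ratio_tail[OF this] rho have "lim_ratio (indicator {z<..}) \<le> e / 2" by simp
  then show ?thesis using assms by (intro exI[of _ z]) simp
qed

lemma lim_ratio_partial_sum:
  assumes f: "unit_fun f"
  shows "(\<Sum>y\<le>z. alpha y * f y) \<le> lim_ratio f"
    and "lim_ratio f \<le> (\<Sum>y\<le>z. alpha y * f y) + lim_ratio (indicator {z<..})"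
proof -
  have part: "(\<Sum>y\<le>z. p t 1 y * f y) \<le> semi t f 1 \<and> semi t f 1 \<le> (\<Sum>y\<le>z. p t 1 y * f y) + tail z t 1" for t
  proof -
    have e: "(\<Sum>y\<le>z. p t 1 y * f y) = semi t (\<lambda>u. if u \<le> z then f u else 0) 1"
      unfolding semi_def
      by (subst integral_measure_pmf_real[of "{..z}"]) (auto simp: mult.commute split: if_splits)
    have int: "integrable (measure_pmf (K t 1)) (\<lambda>u. if u \<le> z then f u else 0)"
      using f by (intro integrable_pmf_bounded[where B=1]) (auto simp: unit_fun_def)
    have int': "integrable (measure_pmf (K t 1)) (indicator {z<..} :: nat \<Rightarrow> real)"
      by (intro unit_fun_integrable unit_fun_indicator) auto
    have "semi t (\<lambda>u. if u \<le> z then f u else 0) 1 \<le> semi t f 1"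
      unfolding semi_def using f
      by (intro integral_mono int unit_fun_integrable) (auto simp: unit_fun_def)
    moreover have "semi t f 1 \<le> measure_pmf.expectation (K t 1) (\<lambda>u. (if u \<le> z then f u else 0) + indicator {z<..} u)"
      unfolding semi_def using f
      by (intro integral_mono unit_fun_integrable Bochner_Integration.integrable_add int int')
        (auto simp: unit_fun_def indicator_def)
    moreover have "\<dots> = semi t (\<lambda>u. if u \<le> z then f u else 0) 1 + tail z t 1"
      unfolding semi_def using Bochner_Integration.integral_add[OF int int'] by simp
    ultimately show ?thesis
      unfolding e by simp
  qed
  have lim: "((\<lambda>t. (\<Sum>y\<le>z. p t 1 y * f y) / surv t 1) \<longlongrightarrow> (\<Sum>y\<le>z. alpha y * f y)) at_top"
  proof -
    have "((\<lambda>t. p t 1 y / surv t 1 * f y) \<longlongrightarrow> alpha y * f y) at_top" for y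
      using f tendsto_mult_right[OF tendsto_alpha[of 1 y], of "f y"] by (cases "y = 0") (auto simp: unit_fun_def)
    then have "((\<lambda>t. \<Sum>y\<le>z. p t 1 y / surv t 1 * f y) \<longlongrightarrow> (\<Sum>y\<le>z. alpha y * f y)) at_top"
      by (intro tendsto_sum)
    then show ?thesis by (simp add: sum_divide_distrib)
  qed
  have tl: "((\<lambda>t. tail z t 1 / surv t 1) \<longlongrightarrow> lim_ratio (indicator {z<..})) at_top"
    using tendsto_lim_ratio[OF unit_fun_indicator[of "{z<..}"], of 1] by (simp add: semi_indicator)
  have fl: "((\<lambda>t. semi t f 1 / surv t 1) \<longlongrightarrow> lim_ratio f) at_top"
    using tendsto_lim_ratio[OF f, of 1] by simp
  show "(\<Sum>y\<le>z. alpha y * f y) \<le> lim_ratio f"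
    by (rule tendsto_le[OF _ fl lim]) (use part surv_nonneg in \<open>auto intro!: always_eventually divide_right_mono\<close>)
  show "lim_ratio f \<le> (\<Sum>y\<le>z. alpha y * f y) + lim_ratio (indicator {z<..})"
    by (rule tendsto_le[OF _ tendsto_add[OF lim tl] fl])
      (use part surv_nonneg in \<open>auto intro!: always_eventually divide_right_mono simp: add_divide_distrib[symmetric]\<close>)
qed

text \<open>Tightness: the limiting mass above \<open>z\<close> is small, so nothing escapes to
  infinity and the functional is integration against \<open>alpha\<close>.\<close>

lemma sums_lim_ratio: assumes f: "unit_fun f" shows "(\<lambda>y. alpha y * f y) sums lim_ratio f"
  unfolding sums_def_le
proof (rule LIMSEQ_I)
  fix e :: real assume "0 < e"
  then obtain z where z: "lim_ratio (indicator {z<..}) < e"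
    using lim_ratio_tail_small by blast
  have "norm ((\<Sum>y\<le>n. alpha y * f y) - lim_ratio f) < e" if "z \<le> n" for n
  proof -
    have "(\<Sum>y\<le>z. alpha y * f y) \<le> (\<Sum>y\<le>n. alpha y * f y)"
      using that f alpha_nonneg by (intro sum_mono2) (auto simp: unit_fun_def)
    then show ?thesis
      using lim_ratio_partial_sum[OF f, of z] lim_ratio_partial_sum(1)[OF f, of n] z by simp
  qed
  then show "\<exists>N. \<forall>n\<ge>N. norm ((\<Sum>y\<le>n. alpha y * f y) - lim_ratio f) < e"
    by blast
qed

lemma alpha_sums_1: "alpha sums 1"
proof -
  have "((\<lambda>t. semi t (indicator {0<..}) 1 / surv t 1) \<longlongrightarrow> 1) at_top"
  proof (rule tendsto_eventually)
    have "semi t (indicator {0<..}) 1 / surv t 1 = 1" if "0 \<le> t" for t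
      using surv_pos[OF that, of 1] by (simp add: semi_indicator surv_measure)
    then show "\<forall>\<^sub>F t in at_top. semi t (indicator {0<..}) 1 / surv t 1 = 1"
      by (auto simp: eventually_at_top_linorder)
  qed
  then have "lim_ratio (indicator {0<..}) = 1"
    using tendsto_lim_ratio[OF unit_fun_indicator[of "{0<..}"], of 1]
    by (intro tendsto_unique[OF trivial_limit_at_top_linorder]) auto
  moreover have "(\<lambda>y. alpha y * indicator {0<..} y) = alpha"
  proof
    show "alpha y * indicator {0<..} y = alpha y" for y
      by (cases "y = 0") (simp_all add: alpha_0)
  qed
  ultimately show ?thesis
    using sums_lim_ratio[OF unit_fun_indicator[of "{0<..}"]] by simp
qed

lemma tendsto_surv_ratio:
  "0 \<le> s \<Longrightarrow> ((\<lambda>t. surv (t + s) 1 / surv t 1) \<longlongrightarrow> lim_ratio (surv s)) at_top"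
proof -
  assume s: "0 \<le> s"
  have "\<forall>\<^sub>F t in at_top. semi t (surv s) 1 / surv t 1 = surv (t + s) 1 / surv t 1"
    unfolding eventually_at_top_linorder using s by (intro exI[of _ 0]) (simp add: semi_surv)
  then show ?thesis
    by (rule Lim_transform_eventually[OF tendsto_lim_ratio[OF unit_fun_surv[OF s] order_refl]])
qed

text \<open>Quasi-stationarity in functional form: \<open>semi (t + s) f 1 / surv t 1\<close> is
  either the ratio for \<open>semi s f\<close> at time \<open>t\<close>, or the ratio for
  \<open>f\<close> at time \<open>t + s\<close> multiplied by
  \<open>surv (t + s) 1 / surv t 1\<close>.\<close>

lemma lim_ratio_semi:
  assumes f: "unit_fun f" and s: "0 \<le> s"
  shows "lim_ratio (semi s f) = lim_ratio (surv s) * lim_ratio f"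
proof -
  have "((\<lambda>t. semi (t + s) f 1 / surv (t + s) 1) \<longlongrightarrow> lim_ratio f) at_top"
    by (rule filterlim_compose[OF tendsto_lim_ratio[OF f] filterlim_add_const_at_top]) simp
  then have "((\<lambda>t. (surv (t + s) 1 / surv t 1) * (semi (t + s) f 1 / surv (t + s) 1))
      \<longlongrightarrow> lim_ratio (surv s) * lim_ratio f) at_top"
    by (intro tendsto_mult tendsto_surv_ratio s)
  moreover have "\<forall>\<^sub>F t in at_top. (surv (t + s) 1 / surv t 1) * (semi (t + s) f 1 / surv (t + s) 1)
      = semi t (semi s f) 1 / surv t 1"
  proof -
    have "(surv (t + s) 1 / surv t 1) * (semi (t + s) f 1 / surv (t + s) 1)
      = semi t (semi s f) 1 / surv t 1" if "0 \<le> t" for t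
      using surv_pos[of "t + s" 1] semi_add[OF f that s, of 1] that s by simp
    then show ?thesis
      unfolding eventually_at_top_linorder by blast
  qed
  ultimately have "((\<lambda>t. semi t (semi s f) 1 / surv t 1) \<longlongrightarrow> lim_ratio (surv s) * lim_ratio f) at_top"
    by (rule Lim_transform_eventually)
  then show ?thesis
    using tendsto_lim_ratio[OF unit_fun_semi[OF f s], of 1]
    by (intro tendsto_unique[OF trivial_limit_at_top_linorder]) auto
qed

definition rate :: real where
  "rate = - ln (lim_ratio (surv 1))"

lemma lim_ratio_surv_pos: assumes "0 \<le> s" shows "0 < lim_ratio (surv s)"
proof -
  have "p s 1 1 \<le> surv (t + s) 1 / surv t 1" if "0 \<le> t" for t
    using surv_add_ge[OF assms that, of 1 1] surv_pos[OF that, of 1] by (simp add: field_simps)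
  then have "p s 1 1 \<le> lim_ratio (surv s)"
    by (intro tendsto_lowerbound[OF tendsto_surv_ratio[OF assms]]) (auto simp: eventually_at_top_linorder)
  then show ?thesis
    using p_diag_pos[OF assms, of 1] by simp
qed

text \<open>By \<open>lim_ratio_semi\<close> survival under \<open>alpha\<close> is multiplicative
  in time; its logarithm is then additive and of constant sign, hence linear.\<close>

lemma lim_ratio_surv: assumes "0 \<le> t" shows "lim_ratio (surv t) = exp (- rate * t)"
proof -
  define g where "g t = - ln (lim_ratio (surv t))" for t
  have add: "g (s + t) = g s + g t" if "0 \<le> s" "0 \<le> t" for s t
  proof -
    have "surv (s + t) = semi s (surv t)"
      using that by (simp add: fun_eq_iff semi_surv)
    then have "lim_ratio (surv (s + t)) = lim_ratio (surv s) * lim_ratio (surv t)"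
      using lim_ratio_semi[OF unit_fun_surv[OF that(2)] that(1)] by simp
    then show ?thesis
      using lim_ratio_surv_pos[OF that(1)] lim_ratio_surv_pos[OF that(2)] by (simp add: g_def ln_mult)
  qed
  have nonneg: "0 \<le> g t" if "0 \<le> t" for t
    using lim_ratio_surv_pos[OF that] lim_ratio_bounds(2)[OF unit_fun_surv[OF that]] by (simp add: g_def)
  have "g t = t * g 1"
    using additive_nonneg_imp_linear[of g t] add nonneg assms by simp
  then have "ln (lim_ratio (surv t)) = - rate * t"
    by (simp add: g_def rate_def)
  then show ?thesis
    using lim_ratio_surv_pos[OF assms] by (metis exp_ln)
qed

text \<open>Survival halves over a suitable time \<open>T\<close>, uniformly in the starting
  point.\<close>

lemma rate_pos: "0 < rate"
proof -
  obtain T where T: "T > 0" "\<And>x. surv T x \<le> 1/2"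
    using surv_uniform_small[of "1/2"] by auto
  \<comment> \<open>Doubling keeps the values below 1, so \<open>semi_le_surv\<close> applies to
    \<open>2 * surv T\<close> and yields the halving.\<close>
  have u: "unit_fun (\<lambda>x. 2 * surv T x)"
    using T surv_nonneg surv_trap[of T] by (simp add: unit_fun_def mult.commute pos_le_divide_eq[symmetric])
  have "surv (t + T) 1 / surv t 1 \<le> 1/2" if "0 \<le> t" for t
  proof -
    have "2 * surv (t + T) 1 = semi t (\<lambda>x. 2 * surv T x) 1"
      using semi_surv[OF that, of T 1] T(1) by (simp add: semi_def)
    also have "\<dots> \<le> surv t 1" by (rule semi_le_surv[OF u])
    finally show ?thesis
      using surv_pos[OF that, of 1] by (simp add: field_simps)
  qed
  then have "lim_ratio (surv T) \<le> 1/2"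
    using T(1) by (intro tendsto_upperbound[OF tendsto_surv_ratio]) (auto simp: eventually_at_top_linorder)
  moreover have "lim_ratio (surv T) = exp (- rate * T)"
    using T(1) by (intro lim_ratio_surv) simp
  ultimately have "exp (- rate * T) < exp 0"
    unfolding exp_zero by linarith
  then have "0 < rate * T"
    unfolding exp_less_cancel_iff by simp
  then show ?thesis
    using T(1) by (simp add: zero_less_mult_iff)
qed

lemma alpha_surv_sums: "0 \<le> t \<Longrightarrow> (\<lambda>x. alpha x * surv t x) sums exp (- rate * t)"
  using sums_lim_ratio[OF unit_fun_surv] by (simp add: lim_ratio_surv)

lemma alpha_p_sums:
  assumes "0 \<le> t" "1 \<le> y"
  shows "(\<lambda>x. alpha x * p t x y) sums (exp (- rate * t) * alpha y)"
proof -
  have e: "(\<lambda>x. p t x y) = semi t (indicator {y})"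
    by (simp add: fun_eq_iff semi_indicator measure_pmf_single)
  have "lim_ratio (\<lambda>x. p t x y) = exp (- rate * t) * alpha y"
    unfolding e using assms
    by (subst lim_ratio_semi) (auto intro!: unit_fun_indicator simp: lim_ratio_surv alpha_def)
  then show ?thesis
    using sums_lim_ratio[OF unit_fun_p[OF assms]] by simp
qed

text \<open>Quasi-stationarity at time \<open>T\<close> combined with the uniform chance of being in
  1 at that time.\<close>

lemma alpha_1_pos: "0 < alpha 1"
proof -
  obtain T \<delta> where T: "T > 0" "\<delta> > 0" "\<And>x. 1 \<le> x \<Longrightarrow> \<delta> \<le> p T x 1"
    using uniform_lower_bound by auto
  have le: "alpha x * \<delta> \<le> alpha x * p T x 1" for x
    using T(3)[of x] alpha_nonneg[of x] by (cases "x = 0") (auto simp: alpha_0 intro!: mult_left_mono)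
  have "1 * \<delta> \<le> exp (- rate * T) * alpha 1"
    using T(1) by (intro sums_le[OF le sums_mult2[OF alpha_sums_1] alpha_p_sums]) auto
  then have "0 < exp (- rate * T) * alpha 1" using T(2) by simp
  then show ?thesis by (simp add: zero_less_mult_iff)
qed

text \<open>Survival under \<open>alpha\<close> is exactly exponential and \<open>alpha\<close>
  charges 1, which bounds survival from 1; \<open>surv_compare\<close> extends the bound to all
  states.\<close>

lemma surv_upper: "\<exists>C>0. \<forall>t\<ge>0. \<forall>x. surv t x \<le> C * exp (- rate * t)"
proof -
  obtain C where C: "C > 0" "\<And>t x. 0 \<le> t \<Longrightarrow> surv t x \<le> C * surv t 1"
    using surv_compare by auto
  have "surv t x \<le> C / alpha 1 * exp (- rate * t)" if "0 \<le> t" for t x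
  proof -
    have "alpha 1 * surv t 1 \<le> exp (- rate * t)"
      using sums_le[OF _ sums_single[of 1 "\<lambda>x. alpha x * surv t x"] alpha_surv_sums[OF that]]
        alpha_nonneg surv_nonneg by auto
    then have "C * surv t 1 \<le> C / alpha 1 * exp (- rate * t)"
      using alpha_1_pos C(1) by (simp add: field_simps)
    then show ?thesis
      using C(2)[OF that, of x] by simp
  qed
  then show ?thesis
    using C(1) alpha_1_pos by (intro exI[of _ "C / alpha 1"]) auto
qed

text \<open>The average of \<open>surv t\<close> under \<open>alpha\<close> is at most
  \<open>C * surv t 1\<close>, so survival from 1 cannot be smaller than exponential; every other
  state first moves to 1.\<close>

lemma surv_lower: "\<exists>c>0. \<forall>t\<ge>0. \<forall>x\<ge>1. c * exp (- rate * t) \<le> surv t x"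
proof -
  obtain C where C: "C > 0" "\<And>t x. 0 \<le> t \<Longrightarrow> surv t x \<le> C * surv t 1"
    using surv_compare by auto
  obtain T \<delta> where T: "T > 0" "\<delta> > 0" "\<And>x. 1 \<le> x \<Longrightarrow> \<delta> \<le> p T x 1"
    using uniform_lower_bound by auto
  have "\<delta> / C * exp (- rate * t) \<le> surv t x" if "0 \<le> t" "1 \<le> x" for t x
  proof -
    have "exp (- rate * t) \<le> 1 * (C * surv t 1)"
      using C(2)[OF that(1)] alpha_nonneg
      by (intro sums_le[OF _ alpha_surv_sums[OF that(1)] sums_mult2[OF alpha_sums_1]]) (auto intro: mult_left_mono)
    then have "\<delta> / C * exp (- rate * t) \<le> \<delta> * surv t 1"
      using C(1) T(2) by (simp add: field_simps)
    also have "\<dots> \<le> p T x 1 * surv t 1"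
      using T(3)[OF that(2)] surv_nonneg[of t 1] by (intro mult_right_mono)
    also have "\<dots> \<le> surv (T + t) x"
      using T(1) that by (intro surv_add_ge) auto
    also have "\<dots> \<le> surv t x"
      using T(1) that by (intro surv_antimono) auto
    finally show ?thesis .
  qed
  then show ?thesis
    using C(1) T(2) by (intro exI[of _ "\<delta> / C"]) auto
qed

lemma alpha_green:
  assumes y: "1 \<le> y"
  shows "(\<Sum>x. ennreal (alpha x) * green x y) = ennreal (alpha y / rate)"
proof -
  have m: "(\<lambda>t. ennreal (p t x y) * indicator {0..} t) \<in> borel_measurable lborel" for x
    unfolding measurable_lborel2 by (rule measurable_p_interval) auto
  have "(\<Sum>x. ennreal (alpha x) * green x y)
      = (\<Sum>x. \<integral>\<^sup>+t. ennreal (alpha x) * (ennreal (p t x y) * indicator {0..} t) \<partial>lborel)"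
    unfolding green_def by (simp only: nn_integral_cmult[OF m])
  also have "\<dots> = (\<integral>\<^sup>+t. (\<Sum>x. ennreal (alpha x) * (ennreal (p t x y) * indicator {0..} t)) \<partial>lborel)"
    by (intro nn_integral_suminf[symmetric] borel_measurable_times_ennreal[OF borel_measurable_const m])
  also have "\<dots> = (\<integral>\<^sup>+t. ennreal (exp (- rate * t) * alpha y) * indicator {0..} t \<partial>lborel)"
  proof (intro nn_integral_cong)
    fix t :: real
    show "(\<Sum>x. ennreal (alpha x) * (ennreal (p t x y) * indicator {0..} t))
      = ennreal (exp (- rate * t) * alpha y) * indicator {0..} t"
    proof (cases "0 \<le> t")
      case True
      have "(\<Sum>x. ennreal (alpha x * p t x y)) = ennreal (exp (- rate * t) * alpha y)"
        using sums_unique[OF alpha_p_sums[OF True y]] sums_summable[OF alpha_p_sums[OF True y]] alpha_nonneg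
        by (subst suminf_ennreal2) auto
      then show ?thesis
        using True alpha_nonneg by (simp add: ennreal_mult)
    qed simp
  qed
  also have "\<dots> = ennreal (0 - (- exp (- rate * 0) * alpha y / rate))"
  proof (rule nn_integral_FTC_atLeast)
    show "(\<lambda>t. exp (- rate * t) * alpha y) \<in> borel_measurable borel" by simp
    show "DERIV (\<lambda>t. - exp (- rate * t) * alpha y / rate) t :> exp (- rate * t) * alpha y" for t
      using rate_pos by (auto intro!: derivative_eq_intros)
    show "0 \<le> exp (- rate * t) * alpha y" for t
      by (simp add: alpha_nonneg)
    have "((\<lambda>t. exp (- (rate * t))) \<longlongrightarrow> 0) at_top"
      using rate_pos
      by (intro filterlim_compose[OF exp_at_bot] filterlim_compose[OF filterlim_uminus_at_bot_at_top]
        filterlim_tendsto_pos_mult_at_top[OF tendsto_const] filterlim_ident)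
    then have "((\<lambda>t. - exp (- (rate * t)) * (alpha y / rate)) \<longlongrightarrow> - 0 * (alpha y / rate)) at_top"
      by (intro tendsto_mult tendsto_minus tendsto_const)
    then show "((\<lambda>t. - exp (- rate * t) * alpha y / rate) \<longlongrightarrow> 0) at_top"
      by simp
  qed
  finally show ?thesis by simp
qed

end

section \<open>Transition function and path regularity\<close>

context ctmc
begin

text \<open>Plain real numbers at this stage: that they sum to 1 over \<open>y\<close> is known only
  after explosion has been excluded.\<close>

definition tr :: "real \<Rightarrow> nat \<Rightarrow> nat \<Rightarrow> real" where
  "tr t x y = \<P>(\<omega> in P x. X t \<omega> = Some y)"

lemma space_P: "space (P x) = space M"
  using sets_P by (rule sets_eq_imp_space_eq)

lemma state_set [measurable]: "0 \<le> t \<Longrightarrow> Measurable.pred M (\<lambda>\<omega>. X t \<omega> = c)"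
  using measurable_X[of t] by measurable

lemma markov_tr:
  assumes "0 \<le> s" "0 \<le> t" "A \<in> past M X s"
  shows "\<P>(\<omega> in P x. \<omega> \<in> A \<and> X s \<omega> = Some y \<and> X (s + t) \<omega> = Some z)
    = \<P>(\<omega> in P x. \<omega> \<in> A \<and> X s \<omega> = Some y) * tr t y z"
  unfolding tr_def by (rule markov[OF assms])

lemma not_None_mono:
  assumes "\<omega> \<in> space M" "0 \<le> s" "s \<le> t" "X t \<omega> \<noteq> None"
  shows "X s \<omega> \<noteq> None"
proof -
  have "ereal t < explosion_time X \<omega>"
    using killed[of \<omega> t] assms by force
  then have "ereal s < explosion_time X \<omega>"
    using assms(3) by (simp add: order.strict_trans1[of _ "ereal t"])
  then show ?thesis using alive assms by blast
qed

lemma state_right_constant: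
  assumes "\<omega> \<in> space M" "0 \<le> t" "X t \<omega> = Some y"
  shows "\<exists>e>t. \<forall>s. t \<le> s \<longrightarrow> s < e \<longrightarrow> X s \<omega> = Some y"
proof -
  have "ereal t < explosion_time X \<omega>"
    using killed[of \<omega> t] assms by force
  then have "\<forall>\<^sub>F s in at_right t. X s \<omega> = X t \<omega>"
    using right_continuous assms by blast
  then obtain e where "e > t" "\<And>s. t < s \<Longrightarrow> s < e \<Longrightarrow> X s \<omega> = X t \<omega>"
    unfolding eventually_at_right_field by blast
  then have "\<And>s. t \<le> s \<Longrightarrow> s < e \<Longrightarrow> X s \<omega> = Some y"
    using assms(3) by (metis order_le_less)
  then show ?thesis
    using \<open>e > t\<close> by blast
qed

text \<open>Visits last for a while by right-continuity, so rational times detect them. This makes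
  hitting and return times measurable and lets null sets be collected over countably many
  times.\<close>

lemma state_at_rational:
  assumes "\<omega> \<in> space M" "0 \<le> t" "X t \<omega> = Some y" "ereal t < u"
  shows "\<exists>q\<in>\<rat>. t < q \<and> ereal q < u \<and> X q \<omega> = Some y"
proof -
  obtain e where e: "e > t" "\<And>s. t \<le> s \<Longrightarrow> s < e \<Longrightarrow> X s \<omega> = Some y"
    using state_right_constant[OF assms(1-3)] by blast
  obtain u' where u': "t < u'" "ereal u' \<le> u"
    using assms(4) by (cases u) (auto intro: that[of "t + 1"])
  obtain q where "q \<in> \<rat>" "t < q" "q < min e u'"
    using Rats_dense_in_real[of t "min e u'"] e(1) u'(1) by auto
  then show ?thesis
    using e(2)[of q] u'(2) by (intro bexI[of _ q]) (auto intro: order.strict_trans2[of _ "ereal u'"])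
qed

lemma hitting_time_less_iff:
  assumes "\<omega> \<in> space M"
  shows "hitting_time X A \<omega> < u \<longleftrightarrow> (\<exists>q\<in>\<rat>. 0 < q \<and> ereal q < u \<and> X q \<omega> \<in> Some ` A)"
proof
  assume "hitting_time X A \<omega> < u"
  then obtain t y where t: "0 < t" "X t \<omega> = Some y" "y \<in> A" "ereal t < u"
    by (auto simp: hitting_time_def INF_less_iff)
  then obtain q where "q \<in> \<rat>" "t < q" "ereal q < u" "X q \<omega> = Some y"
    using state_at_rational[OF assms, of t y u] by auto
  then show "\<exists>q\<in>\<rat>. 0 < q \<and> ereal q < u \<and> X q \<omega> \<in> Some ` A"
    using t by (intro bexI[of _ q]) auto
qed (auto simp: hitting_time_def INF_less_iff)

lemma hitting_time_nonneg: "0 \<le> hitting_time X A \<omega>"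
  unfolding hitting_time_def by (rule INF_greatest) auto

lemma exit_time_nonneg: "0 \<le> exit_time X z \<omega>"
  unfolding exit_time_def by (rule hitting_time_nonneg)

lemma return_time_less_iff:
  assumes "\<omega> \<in> space M"
  shows "return_time X z \<omega> < u \<longleftrightarrow>
    (\<exists>q\<in>\<rat>. 0 < q \<and> exit_time X z \<omega> < ereal q \<and> ereal q < u \<and> X q \<omega> = Some z)"
proof
  assume "return_time X z \<omega> < u"
  then obtain t where t: "exit_time X z \<omega> < ereal t" "X t \<omega> = Some z" "ereal t < u"
    by (auto simp: return_time_def INF_less_iff)
  then have "0 < t"
    using exit_time_nonneg[of z \<omega>] by (metis ereal_less(2) order.strict_trans1)
  then show "\<exists>q\<in>\<rat>. 0 < q \<and> exit_time X z \<omega> < ereal q \<and> ereal q < u \<and> X q \<omega> = Some z"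
    using state_at_rational[OF assms, of t z u] t
    by (metis ereal_less_eq(3) less_imp_le order.strict_trans order.strict_trans2)
qed (auto simp: return_time_def INF_less_iff)

lemma measurable_hitting_time [measurable]: "hitting_time X A \<in> borel_measurable M"
proof (rule borel_measurableI_less)
  fix u :: ereal
  have "{\<omega> \<in> space M. hitting_time X A \<omega> < u}
      = (\<Union>q\<in>{q\<in>\<rat>. 0 < q \<and> ereal q < u}. \<Union>y\<in>A. {\<omega> \<in> space M. X q \<omega> = Some y})"
    by (intro set_eqI) (simp add: hitting_time_less_iff image_iff cong: conj_cong, blast)
  also have "\<dots> \<in> sets M"
    by (intro sets.countable_UN'' countable_subset[OF _ countable_rat]) (auto intro!: state_set[unfolded pred_def])
  finally show "{\<omega> \<in> space M. hitting_time X A \<omega> < u} \<in> sets M" .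
qed

lemma measurable_exit_time [measurable]: "exit_time X z \<in> borel_measurable M"
  unfolding exit_time_def by measurable

lemma measurable_return_time [measurable]: "return_time X z \<in> borel_measurable M"
proof (rule borel_measurableI_less)
  fix u :: ereal
  have "{\<omega> \<in> space M. return_time X z \<omega> < u}
      = (\<Union>q\<in>{q\<in>\<rat>. 0 < q \<and> ereal q < u}. {\<omega> \<in> space M. exit_time X z \<omega> < ereal q \<and> X q \<omega> = Some z})"
    by (intro set_eqI) (simp add: return_time_less_iff cong: conj_cong, blast)
  also have "\<dots> \<in> sets M"
  proof (intro sets.countable_UN'' countable_subset[OF _ countable_rat])
    fix q assume "q \<in> {q\<in>\<rat>. 0 < q \<and> ereal q < u}"
    then have [simp]: "0 \<le> q" by simp
    show "{\<omega> \<in> space M. exit_time X z \<omega> < ereal q \<and> X q \<omega> = Some z} \<in> sets M"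
      by measurable
  qed auto
  finally show "{\<omega> \<in> space M. return_time X z \<omega> < u} \<in> sets M" .
qed

lemma past_top: "space M \<in> past M X s"
  unfolding past_def by (rule sigma_sets_top)

lemma tr_two_times:
  assumes "0 \<le> s" "0 \<le> t"
  shows "\<P>(\<omega> in P x. X s \<omega> = Some y \<and> X (s + t) \<omega> = Some z) = tr s x y * tr t y z"
  using markov_tr[OF assms past_top, of x y z] by (simp add: tr_def space_P cong: conj_cong)

lemma tr_start: "tr 0 x y = of_bool (x = y)"
proof -
  interpret prob_space "P x" by (rule prob_space_P)
  have ae: "AE \<omega> in P x. X 0 \<omega> = Some x"
    using AE_prob_1[OF start[of x]] by simp
  have "tr 0 x y = prob {\<omega> \<in> space (P x). x = y}"
    unfolding tr_def by (rule finite_measure_eq_AE)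
      (use ae in \<open>auto simp: sets_P space_P intro!: state_set[unfolded pred_def] elim!: eventually_mono\<close>)
  then show ?thesis
    using prob_space by auto
qed

lemma tr_sums: "0 \<le> t \<Longrightarrow> tr t x sums \<P>(\<omega> in P x. X t \<omega> \<noteq> None)"
proof -
  assume t: "0 \<le> t"
  interpret prob_space "P x" by (rule prob_space_P)
  have "(\<lambda>y. prob {\<omega> \<in> space (P x). X t \<omega> = Some y}) sums prob (\<Union>y. {\<omega> \<in> space (P x). X t \<omega> = Some y})"
    by (rule finite_measure_UNION)
      (use t in \<open>auto simp: disjoint_family_on_def sets_P space_P intro!: state_set[unfolded pred_def]\<close>)
  moreover have "(\<Union>y. {\<omega> \<in> space (P x). X t \<omega> = Some y}) = {\<omega> \<in> space (P x). X t \<omega> \<noteq> None}"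
    by auto
  ultimately show ?thesis
    unfolding tr_def by simp
qed

lemma chapman_kolmogorov:
  assumes "0 \<le> s" "0 \<le> t"
  shows "(\<lambda>y. tr s x y * tr t y z) sums tr (s + t) x z"
proof -
  interpret prob_space "P x" by (rule prob_space_P)
  let ?E = "\<lambda>y. {\<omega> \<in> space (P x). X s \<omega> = Some y \<and> X (s + t) \<omega> = Some z}"
  have "(\<lambda>y. prob (?E y)) sums prob (\<Union>y. ?E y)"
  proof (rule finite_measure_UNION)
    show "range ?E \<subseteq> events"
      using assms by (auto simp: sets_P space_P)
  qed (auto simp: disjoint_family_on_def)
  \<comment> \<open>No mass is missed at the intermediate time, because a path alive at
    \<open>s + t\<close> was alive at \<open>s\<close>.\<close>
  moreover have "(\<Union>y. ?E y) = {\<omega> \<in> space (P x). X (s + t) \<omega> = Some z}"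
    using not_None_mono[of _ s "s + t"] assms by (auto simp: space_P)
  ultimately show ?thesis
    unfolding tr_two_times[OF assms, symmetric] tr_def[of "s + t"] by simp
qed

lemma tr_nonneg: "0 \<le> tr t x y" and tr_le_1: "tr t x y \<le> 1"
  using prob_space.prob_le_1[OF prob_space_P] by (simp_all add: tr_def)

text \<open>A finite derivative at 0 forces continuity there.\<close>

lemma tr_tendsto_1: "((\<lambda>t. tr t x x) \<longlongrightarrow> 1) (at_right 0)"
proof -
  have "((\<lambda>t. (tr t x x - 1) / t * t + 1) \<longlongrightarrow> Q x x * 0 + 1) (at_right 0)"
    using Q_matrix[of x x] by (intro tendsto_intros) (simp add: tr_def)
  moreover have "\<forall>\<^sub>F t in at_right 0. (tr t x x - 1) / t * t + 1 = tr t x x"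
    unfolding eventually_at_right_field by (intro exI[of _ 1]) simp
  ultimately show ?thesis
    using Lim_transform_eventually by fastforce
qed

end

section \<open>Dyadic grids and skip-free paths\<close>

definition mesh :: "nat \<Rightarrow> real" where
  "mesh n = (1 / 2) ^ n"

lemma mesh_pos: "0 < mesh n"
  by (simp add: mesh_def)

lemma mesh_tendsto_0: "mesh \<longlonglongrightarrow> 0"
  unfolding mesh_def by (rule LIMSEQ_power_zero) simp

lemma mesh_filterlim: "filterlim mesh (at_right 0) sequentially"
  by (rule tendsto_imp_filterlim_at_right[OF mesh_tendsto_0]) (simp add: mesh_pos)

lemma grid_point_after:
  assumes "0 \<le> t" "0 < h"
  obtains k where "t \<le> real k * h" "real k * h < t + h" "\<And>i. i < k \<Longrightarrow> real i * h < t"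
proof -
  define k where "k = nat \<lceil>t / h\<rceil>"
  have "real k = of_int \<lceil>t / h\<rceil>"
    using assms by (simp add: k_def)
  then have "t / h \<le> real k" "real k < t / h + 1"
    using ceiling_correct[of "t / h"] by linarith+
  then have k: "t \<le> real k * h" "real k * h < t + h"
    using assms(2) by (simp_all add: field_simps)
  have "real i * h < t" if "i < k" for i
  proof -
    have "real i * h \<le> (real k - 1) * h"
      using that assms(2) by (intro mult_right_mono) auto
    then show ?thesis using k(2) by (simp add: algebra_simps)
  qed
  then show ?thesis using that k by blast
qed

text \<open>The second clause forbids downward jumps by more than one without mentioning the left
  limit.\<close>

definition skip_free_path :: "(real \<Rightarrow> nat) \<Rightarrow> bool" where
  "skip_free_path f \<longleftrightarrow>
    (\<forall>t\<ge>0. \<exists>e>t. \<forall>s. t \<le> s \<longrightarrow> s < e \<longrightarrow> f s = f t) \<and>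
    (\<forall>t>0. \<exists>e<t. \<forall>s. e < s \<longrightarrow> s < t \<longrightarrow> f s \<le> f t + 1) \<and>
    (\<exists>t>0. f t = 0)"

lemma skip_free_path_right:
  assumes "skip_free_path f" "0 \<le> t"
  obtains e where "t < e" "\<And>s. t \<le> s \<Longrightarrow> s < e \<Longrightarrow> f s = f t"
  using assms unfolding skip_free_path_def by blast

text \<open>The infimum of the visiting times is attained, since the path is constant immediately to
  its right.\<close>

lemma first_time:
  assumes f: "skip_free_path f" and "0 \<le> a" "a \<le> b" "f b \<in> B"
  obtains t where "a \<le> t" "t \<le> b" "f t \<in> B" "\<And>s. a \<le> s \<Longrightarrow> s < t \<Longrightarrow> f s \<notin> B"
proof -
  define S where "S = {s. a \<le> s \<and> f s \<in> B}"
  define t where "t = Inf S"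
  have S: "b \<in> S" "bdd_below S"
    using assms by (auto simp: S_def intro: bdd_belowI[of _ a])
  have at: "a \<le> t" "t \<le> b"
    unfolding t_def using S by (auto intro!: cInf_greatest cInf_lower simp: S_def)
  obtain e where e: "t < e" "\<And>s. t \<le> s \<Longrightarrow> s < e \<Longrightarrow> f s = f t"
    using skip_free_path_right[OF f, of t] at assms(2) by auto
  obtain s where "s \<in> S" "s < e"
    using cInf_lessD[of S e] e(1) S(1) by (auto simp: t_def)
  moreover from this have "t \<le> s"
    unfolding t_def using S(2) by (intro cInf_lower)
  ultimately have "f t \<in> B"
    using e(2)[of s] by (auto simp: S_def)
  moreover have "f s \<notin> B" if "a \<le> s" "s < t" for s
    using that cInf_lower[of s S] S(2) by (auto simp: S_def t_def)
  ultimately show ?thesis using that at by blast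
qed

text \<open>At the first entrance into \<open>{..y}\<close> the values just before exceed
  \<open>y\<close> and are at most one above the value reached, which must therefore be
  \<open>y\<close>.\<close>

lemma skip_free_crossing:
  assumes f: "skip_free_path f" and "0 \<le> a" "a \<le> b" "y < f a" "f b \<le> y"
  obtains t where "a < t" "t \<le> b" "f t = y"
proof -
  obtain t where t: "a \<le> t" "t \<le> b" "f t \<in> {..y}" "\<And>s. a \<le> s \<Longrightarrow> s < t \<Longrightarrow> f s \<notin> {..y}"
    using first_time[OF f assms(2,3), of "{..y}"] assms(5) by auto
  have "a \<noteq> t" using t(3) assms(4) by auto
  then have "a < t" using t(1) by simp
  then obtain e where e: "e < t" "\<And>s. e < s \<Longrightarrow> s < t \<Longrightarrow> f s \<le> f t + 1"
    using f assms(2) unfolding skip_free_path_def by (meson le_less_trans)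
  obtain s where s: "max a e < s" "s < t"
    using dense[of "max a e" t] e(1) \<open>a < t\<close> by auto
  have "y < f s" "f s \<le> f t + 1"
    using t(4)[of s] e(2)[of s] s by auto
  then have "f t = y" using t(3) by simp
  then show ?thesis using that \<open>a < t\<close> t(2) by blast
qed

text \<open>Stops at or before the first departure from z are ignored, so that a chain started in z stops at
  the end of its first excursion, and a chain started elsewhere at its first visit to B.\<close>

definition stopped :: "nat option set \<Rightarrow> nat \<Rightarrow> (nat \<Rightarrow> nat option) \<Rightarrow> nat \<Rightarrow> bool" where
  "stopped B z \<sigma> m \<longleftrightarrow> \<sigma> m \<in> B \<and> (\<exists>j\<le>m. \<sigma> j \<noteq> Some z)"

definition first_stop :: "nat option set \<Rightarrow> nat \<Rightarrow> (nat \<Rightarrow> nat option) \<Rightarrow> nat \<Rightarrow> nat \<Rightarrow> bool" where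
  "first_stop B z \<sigma> m v \<longleftrightarrow> stopped B z \<sigma> m \<and> (\<forall>j<m. \<not> stopped B z \<sigma> j) \<and> \<sigma> m = Some v"

lemma first_stop_unique:
  "first_stop B z \<sigma> m v \<Longrightarrow> first_stop B z \<sigma> m' v' \<Longrightarrow> m = m' \<and> v = v'"
  unfolding first_stop_def by (metis linorder_neqE_nat option.inject)

text \<open>The path keeps its value for a while after the exit time \<open>e\<close> and after the
  stopping time \<open>j\<close>. A mesh finer than both holding periods sees the exit and the stop,
  and no grid time before \<open>j\<close> can stop. The case \<open>e = 0\<close> covers a start
  outside \<open>z\<close>.\<close>

lemma first_stop_grid_eventually:
  assumes f: "skip_free_path f"
    and e: "0 \<le> e" "f e \<noteq> z" "\<And>s. 0 \<le> s \<Longrightarrow> s < e \<Longrightarrow> f s = z"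
    and j: "e \<le> j" "f j \<in> B" "\<And>s. e \<le> s \<Longrightarrow> s < j \<Longrightarrow> f s \<notin> B" and "z \<in> B"
  shows "\<forall>\<^sub>F n in sequentially. \<forall>v. (\<exists>m. first_stop (Some ` B) z (\<lambda>k. Some (f (real k * mesh n))) m v) \<longleftrightarrow> v = f j"
proof -
  obtain d where d: "j < d" "\<And>s. j \<le> s \<Longrightarrow> s < d \<Longrightarrow> f s = f j"
    using skip_free_path_right[OF f, of j] e j by auto
  obtain c where c: "e < c" "\<And>s. e \<le> s \<Longrightarrow> s < c \<Longrightarrow> f s = f e"
    using skip_free_path_right[OF f, of e] e by auto
  have "\<forall>\<^sub>F n in sequentially. mesh n < min (d - j) (c - e)"
    by (rule order_tendstoD(2)[OF mesh_tendsto_0]) (use d(1) c(1) in simp)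
  then show ?thesis
  proof eventually_elim
    case (elim n)
    let ?h = "mesh n"
    let ?\<sigma> = "\<lambda>k. Some (f (real k * ?h))"
    obtain k where k: "j \<le> real k * ?h" "real k * ?h < j + ?h" "\<And>i. i < k \<Longrightarrow> real i * ?h < j"
      by (rule grid_point_after[OF order_trans[OF e(1) j(1)] mesh_pos]) blast
    have fk: "f (real k * ?h) = f j"
      using d(2)[of "real k * ?h"] k elim by auto
    obtain i where i: "e \<le> real i * ?h" "real i * ?h < e + ?h" "\<And>i'. i' < i \<Longrightarrow> real i' * ?h < e"
      by (rule grid_point_after[OF e(1) mesh_pos]) blast
    have "f (real i * ?h) \<noteq> z"
      using c(2)[of "real i * ?h"] i elim e by auto
    moreover have "i \<le> k"
      using i(3)[of k] k(1) j(1) by (meson not_le order_trans not_less)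
    ultimately have stop: "stopped (Some ` B) z ?\<sigma> k"
      using fk j(2) by (auto simp: stopped_def)
    have nostop: "\<not> stopped (Some ` B) z ?\<sigma> l" if "l < k" for l
    proof (cases "real l * ?h < e")
      case True
      have "f (real l' * ?h) = z" if "l' \<le> l" for l'
      proof -
        have "real l' * ?h \<le> real l * ?h" using that mesh_pos[of n] by (intro mult_right_mono) auto
        then have "real l' * ?h < e" using True by linarith
        then show ?thesis using mesh_pos[of n] by (intro e(3)) simp_all
      qed
      then show ?thesis by (auto simp: stopped_def)
    next
      case False
      then show ?thesis
        using j(3)[of "real l * ?h"] k(3)[OF that] by (auto simp: stopped_def)
    qed
    have "first_stop (Some ` B) z ?\<sigma> k (f j)"
      using stop nostop fk by (simp add: first_stop_def)
    then show ?case
      using first_stop_unique by blast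
  qed
qed

locale absorbed_chain = downward_skip_free_chain +
  assumes absorbed: "\<And>x. \<P>(\<omega> in P x. hitting_time X {0} \<omega> < \<infinity>) = 1"
begin

section \<open>Almost sure path properties and honesty\<close>

lemma AE_start: "AE \<omega> in P x. X 0 \<omega> = Some x"
  using prob_space.AE_prob_1[OF prob_space_P start[of x]] by simp

lemma AE_hits_0: "AE \<omega> in P x. hitting_time X {0} \<omega> < \<infinity>"
  using prob_space.AE_prob_1[OF prob_space_P absorbed[of x]] by simp

lemma AE_trap_two_times:
  assumes "0 \<le> q" "q \<le> q'"
  shows "AE \<omega> in P x. X q \<omega> = Some 0 \<longrightarrow> X q' \<omega> = Some 0"
proof -
  interpret prob_space "P x" by (rule prob_space_P)
  let ?A = "{\<omega> \<in> space (P x). X q \<omega> = Some 0}"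
  let ?B = "{\<omega> \<in> space (P x). X q \<omega> = Some 0 \<and> X q' \<omega> = Some 0}"
  have [simp]: "0 \<le> q'" using assms by simp
  have ev: "?A \<in> events" "?B \<in> events"
    using assms(1) by (simp_all add: sets_P space_P)
  have "prob ?B = prob ?A"
    using tr_two_times[of q "q' - q" x 0 0] trap[of "q' - q"] assms by (simp add: tr_def)
  then have "prob (?A - ?B) = 0"
    using ev by (subst finite_measure_Diff) auto
  then have "?A - ?B \<in> null_sets (P x)"
    using ev by (auto simp: emeasure_eq_measure)
  from AE_not_in[OF this] show ?thesis
    by (auto elim!: eventually_mono)
qed

text \<open>The expected number of such steps on the grid is at most \<open>T * tr h u v / h\<close>
  with \<open>h = mesh n\<close>, which vanishes as \<open>Q u v = 0\<close>. This excludes the step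
  on infinitely many grids only, which is enough: a genuine jump would show on every fine
  grid.\<close>

lemma AE_no_down_jump:
  assumes "v + 2 \<le> u"
  shows "AE \<omega> in P x. \<forall>N. \<exists>n\<ge>N. \<not> (\<exists>k<T * 2 ^ n.
    X (real k * mesh n) \<omega> = Some u \<and> X (real k * mesh n + mesh n) \<omega> = Some v)"
proof -
  interpret prob_space "P x" by (rule prob_space_P)
  define D where "D n = {\<omega> \<in> space (P x). \<exists>k<T * 2 ^ n.
    X (real k * mesh n) \<omega> = Some u \<and> X (real k * mesh n + mesh n) \<omega> = Some v}" for n
  have [simp]: "0 \<le> real k * mesh n" for k n
    using mesh_pos[of n] by simp
  have De: "D n \<in> events" for n
  proof -
    have "D n = (\<Union>k<T * 2 ^ n. {\<omega> \<in> space (P x).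
        X (real k * mesh n) \<omega> = Some u \<and> X (real k * mesh n + mesh n) \<omega> = Some v})"
      unfolding D_def by blast
    also have "\<dots> \<in> events"
      using mesh_pos[of n] by (intro sets.finite_UN) (simp_all add: sets_P space_P)
    finally show ?thesis .
  qed
  have le: "prob (D n) \<le> real T * (tr (mesh n) u v / mesh n)" for n
  proof -
    have "prob (D n) = prob (\<Union>k<T * 2 ^ n. {\<omega> \<in> space (P x).
        X (real k * mesh n) \<omega> = Some u \<and> X (real k * mesh n + mesh n) \<omega> = Some v})"
      by (rule arg_cong[where f=prob]) (unfold D_def, blast)
    also have "\<dots> \<le> (\<Sum>k<T * 2 ^ n. tr (real k * mesh n) x u * tr (mesh n) u v)"
      using mesh_pos[of n]
      by (subst tr_two_times[symmetric]) (auto intro!: finite_measure_subadditive_finite simp: sets_P space_P)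
    also have "\<dots> \<le> (\<Sum>k<T * 2 ^ n. tr (mesh n) u v)"
      using tr_nonneg tr_le_1 by (intro sum_mono mult_left_le_one_le) auto
    \<comment> \<open>\<open>T * 2 ^ n\<close> steps of length \<open>mesh n\<close> fill the
      interval \<open>[0,T]\<close>.\<close>
    also have "\<dots> = real T * (tr (mesh n) u v / mesh n)"
      by (simp add: mesh_def power_one_over)
    finally show ?thesis .
  qed
  have "((\<lambda>t. tr t u v / t) \<longlongrightarrow> 0) (at_right 0)"
    using Q_matrix[of u v] skip_free[OF assms] assms by (simp add: tr_def)
  then have "(\<lambda>n. real T * (tr (mesh n) u v / mesh n)) \<longlonglongrightarrow> real T * 0"
    by (intro tendsto_mult_left filterlim_compose[OF _ mesh_filterlim])
  then have lim0: "(\<lambda>n. real T * (tr (mesh n) u v / mesh n)) \<longlonglongrightarrow> 0"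
    by simp
  have lim: "(\<lambda>n. prob (D n)) \<longlonglongrightarrow> 0"
    by (rule tendsto_sandwich[OF _ _ tendsto_const lim0])
      (intro always_eventually allI measure_nonneg le)+
  have "(\<Inter>n\<in>{N..}. D n) \<in> null_sets (P x)" for N
  proof -
    have ev: "(\<Inter>n\<in>{N..}. D n) \<in> events"
      using De by (intro sets.countable_INT') auto
    have "prob (\<Inter>n\<in>{N..}. D n) \<le> 0"
    proof (rule tendsto_lowerbound[OF lim])
      show "\<forall>\<^sub>F n in sequentially. prob (\<Inter>n\<in>{N..}. D n) \<le> prob (D n)"
        unfolding eventually_sequentially using De
        by (intro exI[of _ N] allI impI finite_measure_mono) auto
    qed simp
    then have "prob (\<Inter>n\<in>{N..}. D n) = 0"
      using measure_nonneg[of "P x"] by (intro antisym)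
    then show ?thesis
      using ev by (auto simp: emeasure_eq_measure)
  qed
  then have "AE \<omega> in P x. \<forall>N. \<omega> \<notin> (\<Inter>n\<in>{N..}. D n)"
    by (intro AE_all_countable[THEN iffD2] allI AE_not_in)
  then show ?thesis
    using AE_space
  proof eventually_elim
    case (elim \<omega>)
    then have "\<exists>n\<ge>N. \<omega> \<notin> D n" for N
      by blast
    then show ?case
      using elim(2) by (simp add: D_def)
  qed
qed

definition good_path :: "'a \<Rightarrow> bool" where
  "good_path \<omega> \<longleftrightarrow> \<omega> \<in> space M \<and> (\<forall>t\<ge>0. X t \<omega> \<noteq> None) \<and>
     (\<forall>s t. 0 \<le> s \<longrightarrow> s \<le> t \<longrightarrow> X s \<omega> = Some 0 \<longrightarrow> X t \<omega> = Some 0) \<and>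
     skip_free_path (\<lambda>t. the (X t \<omega>))"

text \<open>Exceptional sets are collected over rational times, pairs of states and grids;
  right-continuity then extends the properties to all times.\<close>

lemma AE_good_path: "AE \<omega> in P x. good_path \<omega>"
proof -
  have "AE \<omega> in P x. \<forall>q\<in>\<rat>. \<forall>q'\<in>\<rat>. 0 \<le> q \<longrightarrow> q \<le> q' \<longrightarrow> X q \<omega> = Some 0 \<longrightarrow> X q' \<omega> = Some 0"
    using AE_trap_two_times by (intro AE_ball_countable[THEN iffD2] ballI countable_rat AE_impI) auto
  moreover have "AE \<omega> in P x. \<forall>v u. v + 2 \<le> u \<longrightarrow> (\<forall>T N. \<exists>n\<ge>N. \<not> (\<exists>k<T * 2 ^ n.
    X (real k * mesh n) \<omega> = Some u \<and> X (real k * mesh n + mesh n) \<omega> = Some v))"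
  proof -
    have "AE \<omega> in P x. \<forall>T N. \<exists>n\<ge>N. \<not> (\<exists>k<T * 2 ^ n.
      X (real k * mesh n) \<omega> = Some u \<and> X (real k * mesh n + mesh n) \<omega> = Some v)" if "v + 2 \<le> u" for u v
      by (rule AE_all_countable[THEN iffD2], rule allI, rule AE_no_down_jump[OF that])
    note * = this
    show ?thesis
    proof (intro AE_all_countable[THEN iffD2] allI)
      fix v u
      show "AE \<omega> in P x. v + 2 \<le> u \<longrightarrow> (\<forall>T N. \<exists>n\<ge>N. \<not> (\<exists>k<T * 2 ^ n.
          X (real k * mesh n) \<omega> = Some u \<and> X (real k * mesh n + mesh n) \<omega> = Some v))"
        by (cases "v + 2 \<le> u") (use *[of v u] in simp_all)
    qed
  qed
  moreover have "AE \<omega> in P x. \<omega> \<in> space M"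
    using AE_space[of "P x"] by (simp add: space_P)
  ultimately show ?thesis
    using AE_hits_0
  proof eventually_elim
    case (elim \<omega>)
    note trapq = elim(1) and nojump = elim(2) and sp = elim(3)
    obtain q where q: "q \<in> \<rat>" "0 < q" "X q \<omega> = Some 0"
      using elim(4) hitting_time_less_iff[OF sp, of "{0}" \<infinity>] by auto
    \<comment> \<open>Certain absorption excludes explosion: the path is in the trap at arbitrarily
      late rational times, and a path alive later was alive before.\<close>
    have alive': "X t \<omega> \<noteq> None" if t: "0 \<le> t" for t
    proof -
      obtain q' where q': "q' \<in> \<rat>" "max q t < q'"
        using Rats_dense_in_real[of "max q t" "max q t + 1"] by auto
      then have "X q' \<omega> = Some 0"
        using trapq q by force
      then show ?thesis
        using not_None_mono[OF sp t, of q'] q' by auto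
    qed
    have trap': "X t \<omega> = Some 0" if st: "0 \<le> s" "s \<le> t" "X s \<omega> = Some 0" for s t
    proof (cases "s = t")
      case False
      then obtain q1 where q1: "q1 \<in> \<rat>" "s < q1" "q1 < t" "X q1 \<omega> = Some 0"
        using state_at_rational[OF sp st(1,3), of "ereal t"] st(2) by auto
      obtain y where y: "X t \<omega> = Some y"
        using alive'[of t] st by auto
      obtain q2 where q2: "q2 \<in> \<rat>" "t < q2" "X q2 \<omega> = Some y"
        using state_at_rational[OF sp _ y, of \<infinity>] st by auto
      have "X q2 \<omega> = Some 0"
        using trapq[rule_format, OF q1(1) q2(1)] q1 q2(2) st by simp
      then show ?thesis
        using q2(3) y by simp
    qed (use st in simp)
    have right: "\<exists>e>t. \<forall>s. t \<le> s \<longrightarrow> s < e \<longrightarrow> X s \<omega> = X t \<omega>" if "0 \<le> t" for t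
      using state_right_constant[OF sp that] alive'[OF that] by force
    have left: "\<exists>e<t. \<forall>s. e < s \<longrightarrow> s < t \<longrightarrow> the (X s \<omega>) \<le> the (X t \<omega>) + 1" if t: "0 < t" for t
    proof -
      have "ereal t < explosion_time X \<omega>"
        using killed[of \<omega> t] sp t alive'[of t] by force
      then obtain u where "\<forall>\<^sub>F s in at_left t. X s \<omega> = Some u"
        using left_limits sp t by blast
      then obtain e where e: "e < t" "\<And>s. e < s \<Longrightarrow> s < t \<Longrightarrow> X s \<omega> = Some u"
        unfolding eventually_at_left_field by blast
      obtain v where v: "X t \<omega> = Some v"
        using alive'[of t] t by auto
      obtain e' where e': "t < e'" "\<And>s. t \<le> s \<Longrightarrow> s < e' \<Longrightarrow> X s \<omega> = Some v"
        using right[of t] t v by auto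
      \<comment> \<open>Otherwise, on every fine grid, the last point before \<open>t\<close> sees
        \<open>u\<close> and the first point from \<open>t\<close> on sees \<open>v\<close>, against
        the choice of a grid without such a step.\<close>
      have "u \<le> v + 1"
      proof (rule ccontr)
        assume "\<not> u \<le> v + 1"
        then have uv: "v + 2 \<le> u" by simp
        obtain T :: nat where T: "t + 1 < real T"
          using reals_Archimedean2 by blast
        have "\<forall>\<^sub>F n in sequentially. mesh n < min (min 1 t) (min (t - e) (e' - t))"
          by (rule order_tendstoD(2)[OF mesh_tendsto_0]) (use e(1) e'(1) t in simp)
        then obtain N where N: "\<And>n. N \<le> n \<Longrightarrow> mesh n < min (min 1 t) (min (t - e) (e' - t))"
          by (auto simp: eventually_sequentially)
        obtain n where n: "N \<le> n" "\<not> (\<exists>k<T * 2 ^ n.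
            X (real k * mesh n) \<omega> = Some u \<and> X (real k * mesh n + mesh n) \<omega> = Some v)"
          using nojump uv by blast
        note h = N[OF n(1)]
        obtain k' where k': "t \<le> real k' * mesh n" "real k' * mesh n < t + mesh n"
            "\<And>i. i < k' \<Longrightarrow> real i * mesh n < t"
          by (rule grid_point_after[OF less_imp_le[OF t] mesh_pos]) blast
        have "k' \<noteq> 0" using k'(1) t by (cases k') auto
        then obtain k where k: "k' = Suc k" by (cases k') auto
        have 1: "real k * mesh n < t" using k'(3)[of k] k by simp
        have 2: "t - mesh n \<le> real k * mesh n" using k'(1) k by (simp add: algebra_simps)
        have "X (real k * mesh n) \<omega> = Some u" using 1 2 h by (intro e(2)) auto
        moreover have "X (real k * mesh n + mesh n) \<omega> = Some v"
          using k'(1,2) k h by (intro e'(2)) (auto simp: algebra_simps)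
        moreover have "k < T * 2 ^ n"
        proof -
          have "real k * mesh n < real T" using 1 T by simp
          then have "real k < real T * 2 ^ n" by (simp add: mesh_def field_simps)
          then have "real k < real (T * 2 ^ n)" by simp
          then show ?thesis by (simp only: of_nat_less_iff)
        qed
        ultimately show False using n(2) by blast
      qed
      then show ?thesis
        using e v by (intro exI[of _ e]) auto
    qed
    have "skip_free_path (\<lambda>t. the (X t \<omega>))"
      unfolding skip_free_path_def
    proof (intro conjI allI impI)
      show "\<exists>e>t. \<forall>s. t \<le> s \<longrightarrow> s < e \<longrightarrow> the (X s \<omega>) = the (X t \<omega>)" if "0 \<le> t" for t
        using right[OF that] by metis
      show "\<exists>t>0. the (X t \<omega>) = 0" using q by (intro exI[of _ q]) auto
    qed (rule left)
    then show ?case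
      using sp alive' trap' by (auto simp: good_path_def)
  qed
qed

lemma tr_sums_1: assumes "0 \<le> t" shows "tr t x sums 1"
proof -
  interpret prob_space "P x" by (rule prob_space_P)
  have "AE \<omega> in P x. X t \<omega> \<noteq> None"
    using AE_good_path by eventually_elim (use assms in \<open>simp add: good_path_def\<close>)
  moreover have "{\<omega> \<in> space (P x). X t \<omega> \<noteq> None} \<in> events"
    using assms by (simp add: sets_P space_P)
  ultimately have "\<P>(\<omega> in P x. X t \<omega> \<noteq> None) = 1"
    by (subst prob_Collect_eq_1) auto
  then show ?thesis using tr_sums[OF assms, of x] by simp
qed

definition K :: "real \<Rightarrow> nat \<Rightarrow> nat pmf" where
  "K t x = embed_pmf (tr t x)"

lemma pmf_K: assumes "0 \<le> t" shows "pmf (K t x) y = tr t x y"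
  unfolding K_def
proof (rule pmf_embed_pmf)
  have "(\<Sum>y. ennreal (tr t x y)) = 1"
    using tr_sums_1[OF assms, of x] by (subst suminf_ennreal2) (auto simp: tr_nonneg sums_iff)
  then show "(\<integral>\<^sup>+y. ennreal (tr t x y) \<partial>count_space UNIV) = 1"
    by (simp add: nn_integral_count_space_nat)
qed (rule tr_nonneg)

sublocale absorbed_semigroup K
proof
  show "K 0 x = return_pmf x" for x
    by (rule pmf_eqI) (simp add: pmf_K tr_start pmf_return indicator_def)
  show "K (s + t) x = bind_pmf (K s x) (K t)" if st: "0 \<le> s" "0 \<le> t" for s t x
  proof (rule pmf_eqI)
    fix z
    have "ennreal (pmf (bind_pmf (K s x) (K t)) z) = (\<Sum>y. ennreal (tr s x y * tr t y z))"
      using st by (simp add: ennreal_pmf_bind nn_integral_measure_pmf nn_integral_count_space_nat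
        pmf_K ennreal_mult tr_nonneg)
    also have "\<dots> = ennreal (tr (s + t) x z)"
      using chapman_kolmogorov[OF st, of x z] by (subst suminf_ennreal2) (auto simp: tr_nonneg sums_iff)
    finally show "pmf (K (s + t) x) z = pmf (bind_pmf (K s x) (K t)) z"
      using st by (simp add: pmf_K tr_nonneg)
  qed
  show "K t 0 = return_pmf 0" if "0 \<le> t" for t
  proof -
    have "pmf (K t 0) 0 = 1" using trap[OF that] that by (simp add: pmf_K tr_def)
    then have "measure (K t 0) {0} = 1" by (simp add: measure_pmf_single)
    then have "AE y in K t 0. y \<in> {0}" by (rule measure_pmf.AE_prob_1)
    then show ?thesis
      unfolding set_pmf_subset_singleton[symmetric] by (auto simp: AE_measure_pmf_iff)
  qed
  show "((\<lambda>t. pmf (K t x) x) \<longlongrightarrow> 1) (at_right 0)" for x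
  proof (rule Lim_transform_eventually[OF tr_tendsto_1])
    show "\<forall>\<^sub>F t in at_right 0. tr t x x = pmf (K t x) x"
      unfolding eventually_at_right_field by (intro exI[of _ 1]) (simp add: pmf_K)
  qed
  \<comment> \<open>Otherwise the chain almost surely avoids \<open>y\<close> at all rational times
    and hence never hits it, against irreducibility.\<close>
  show "\<exists>t>0. 0 < pmf (K t x) y" if x: "1 \<le> x" for x y
  proof (rule ccontr)
    assume "\<not> ?thesis"
    then have zero: "tr t x y = 0" if "0 < t" for t
    proof -
      have "\<not> 0 < pmf (K t x) y"
        using \<open>\<not> (\<exists>t>0. 0 < pmf (K t x) y)\<close> that by blast
      then show ?thesis
        using that tr_nonneg[of t x y] by (simp add: pmf_K)
    qed
    interpret prob_space "P x" by (rule prob_space_P)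
    have c: "countable {q \<in> \<rat>. 0 < (q::real)}"
      by (rule countable_subset[OF _ countable_rat]) auto
    have null: "{\<omega> \<in> space (P x). X q \<omega> = Some y} \<in> null_sets (P x)" if "0 < q" for q
      using zero[OF that] that by (auto simp: emeasure_eq_measure tr_def sets_P space_P)
    have "(\<Union>q\<in>{q\<in>\<rat>. 0 < q}. {\<omega> \<in> space (P x). X q \<omega> = Some y}) \<in> null_sets (P x)"
      by (rule null_sets_UN'[OF c], rule null) simp
    moreover have "{\<omega> \<in> space (P x). hitting_time X {y} \<omega> < \<infinity>}
        = (\<Union>q\<in>{q\<in>\<rat>. 0 < q}. {\<omega> \<in> space (P x). X q \<omega> = Some y})"
      using hitting_time_less_iff[of _ "{y}" \<infinity>] by (auto simp: space_P)
    ultimately have "\<P>(\<omega> in P x. hitting_time X {y} \<omega> < \<infinity>) = 0"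
      by (simp add: null_setsD1 measure_def)
    then show False using irreducible[OF x, of y] by simp
  qed
qed

end

section \<open>Excursions seen on a grid\<close>

context absorbed_chain
begin

section \<open>Events determined by the path on a grid\<close>

definition hist :: "real \<Rightarrow> 'a measure" where
  "hist s = sigma (space M) {{\<omega> \<in> space M. X u \<omega> = c} | u c. 0 \<le> u \<and> u \<le> s}"

lemma sets_hist: "sets (hist s) = past M X s"
  unfolding past_def hist_def by (rule sets_measure_of) auto

lemma space_hist: "space (hist s) = space M"
  by (simp add: hist_def space_measure_of_conv)

lemma measurable_hist:
  assumes "0 \<le> u" "u \<le> s"
  shows "X u \<in> measurable (hist s) (count_space UNIV)"
proof (rule measurable_count_space_eq2_countable[THEN iffD2], intro conjI ballI)
  fix c
  have "X u -` {c} \<inter> space (hist s) = {\<omega> \<in> space M. X u \<omega> = c}"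
    by (auto simp: space_hist)
  also have "\<dots> \<in> sets (hist s)"
    unfolding sets_hist past_def using assms by (intro sigma_sets.Basic) auto
  finally show "X u -` {c} \<inter> space (hist s) \<in> sets (hist s)" .
qed auto

lemma grid_event_past:
  assumes "0 \<le> h" and \<phi>: "\<And>\<sigma> \<sigma>'. (\<And>j. j \<le> m \<Longrightarrow> \<sigma> j = \<sigma>' j) \<Longrightarrow> \<phi> \<sigma> \<longleftrightarrow> \<phi> \<sigma>'"
    and meas: "Measurable.pred (PiM UNIV (\<lambda>_. count_space UNIV)) \<phi>"
  shows "{\<omega> \<in> space M. \<phi> (\<lambda>j. X (real j * h) \<omega>)} \<in> past M X (real m * h)"
proof -
  \<comment> \<open>Freezing the index at \<open>m\<close> turns the whole sequence into a function
    of the history up to \<open>m * h\<close>; \<open>\<phi>\<close> does not notice the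
    change.\<close>
  have "(\<lambda>\<omega> j. X (real (min j m) * h) \<omega>) \<in> measurable (hist (real m * h)) (PiM UNIV (\<lambda>_. count_space UNIV))"
  proof (rule measurable_PiM_single')
    show "(\<lambda>\<omega>. X (real (min j m) * h) \<omega>) \<in> measurable (hist (real m * h)) (count_space UNIV)" for j
      using assms(1) by (intro measurable_hist mult_right_mono) auto
  qed auto
  from measurable_compose[OF this meas]
  have "{\<omega> \<in> space (hist (real m * h)). \<phi> (\<lambda>j. X (real (min j m) * h) \<omega>)} \<in> sets (hist (real m * h))"
    by (simp only: pred_def)
  moreover have "\<phi> (\<lambda>j. X (real (min j m) * h) \<omega>) \<longleftrightarrow> \<phi> (\<lambda>j. X (real j * h) \<omega>)" for \<omega>
    by (rule \<phi>) simp
  ultimately show ?thesis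
    by (simp only: sets_hist space_hist)
qed

lemma first_stop_past:
  assumes "0 \<le> h"
  shows "{\<omega> \<in> space M. first_stop B z (\<lambda>j. X (real j * h) \<omega>) m v} \<in> past M X (real m * h)"
proof (rule grid_event_past[OF assms])
  show "first_stop B z \<sigma> m v \<longleftrightarrow> first_stop B z \<sigma>' m v" if eq: "\<And>j. j \<le> m \<Longrightarrow> \<sigma> j = \<sigma>' j" for \<sigma> \<sigma>'
  proof -
    have "stopped B z \<sigma> j \<longleftrightarrow> stopped B z \<sigma>' j" if "j \<le> m" for j
      unfolding stopped_def using that eq by (intro conj_cong ex_cong1) auto
    then show ?thesis
      unfolding first_stop_def using eq by (intro conj_cong all_cong1) auto
  qed
  show "Measurable.pred (PiM UNIV (\<lambda>_. count_space UNIV)) (\<lambda>\<sigma>. first_stop B z \<sigma> m v)"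
    unfolding first_stop_def stopped_def by measurable
qed

lemma stay_past:
  assumes "0 \<le> h"
  shows "{\<omega> \<in> space M. \<forall>j\<le>k. X (real j * h) \<omega> = Some z} \<in> past M X (real k * h)"
proof (rule grid_event_past[OF assms, where \<phi>="\<lambda>\<sigma>. \<forall>j\<le>k. \<sigma> j = Some z"])
  show "Measurable.pred (PiM UNIV (\<lambda>_. count_space UNIV)) (\<lambda>\<sigma>. \<forall>j\<le>k. \<sigma> j = Some z)"
    by measurable
qed simp

lemma past_subset: "0 \<le> s \<Longrightarrow> past M X s \<subseteq> sets M"
  unfolding past_def by (rule sets.sigma_sets_subset) (auto intro!: state_set[unfolded pred_def])

lemma stay_prob:
  assumes "0 \<le> h"
  shows "\<P>(\<omega> in P u. \<forall>j\<le>k. X (real j * h) \<omega> = Some z) = of_bool (u = z) * tr h z z ^ k"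
proof (induction k)
  case 0
  show ?case using tr_start[of u z] by (simp add: tr_def)
next
  case (Suc k)
  let ?A = "{\<omega> \<in> space M. \<forall>j\<le>k. X (real j * h) \<omega> = Some z}"
  have suc: "real (Suc k) * h = real k * h + h"
    by (simp add: algebra_simps)
  have 1: "{\<omega> \<in> space (P u). \<forall>j\<le>Suc k. X (real j * h) \<omega> = Some z}
      = {\<omega> \<in> space (P u). \<omega> \<in> ?A \<and> X (real k * h) \<omega> = Some z \<and> X (real k * h + h) \<omega> = Some z}"
    unfolding suc[symmetric] space_P le_Suc_eq by blast
  have 2: "{\<omega> \<in> space (P u). \<omega> \<in> ?A \<and> X (real k * h) \<omega> = Some z}
      = {\<omega> \<in> space (P u). \<forall>j\<le>k. X (real j * h) \<omega> = Some z}"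
    unfolding space_P by blast
  have "0 \<le> real k * h" using assms by simp
  then show ?case
    using markov_tr[OF _ assms stay_past[OF assms], where k1=k and x=u and y=z and z=z and z1=z]
    unfolding 1 2 Suc.IH by simp
qed

definition stop_prob :: "real \<Rightarrow> nat set \<Rightarrow> nat \<Rightarrow> nat \<Rightarrow> nat \<Rightarrow> nat \<Rightarrow> real" where
  "stop_prob h B z u m v = \<P>(\<omega> in P u. first_stop (Some ` B) z (\<lambda>j. X (real j * h) \<omega>) m v)"

lemma first_stop_event:
  assumes "0 \<le> h"
  shows "{\<omega> \<in> space (P u). first_stop B z (\<lambda>j. X (real j * h) \<omega>) m v} \<in> sets (P u)"
  unfolding space_P sets_P
  by (rule subsetD[OF past_subset first_stop_past[OF assms]]) (use assms in simp)

text \<open>If the sequence has left \<open>z\<close> at some index up to \<open>k\<close>, then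
  \<open>k\<close> itself counts as stopped, so a first stop exists no later than
  \<open>k\<close>.\<close>

lemma first_stop_or_stay:
  assumes "z \<in> B" "\<sigma> k = Some z"
  shows "(\<forall>j\<le>k. \<sigma> j = Some z) \<or> (\<exists>m\<le>k. \<exists>v\<in>B. first_stop (Some ` B) z \<sigma> m v)"
proof (rule disjCI)
  assume "\<not> (\<exists>m\<le>k. \<exists>v\<in>B. first_stop (Some ` B) z \<sigma> m v)"
  then have no: "\<not> first_stop (Some ` B) z \<sigma> m v" if "m \<le> k" "v \<in> B" for m v
    using that by blast
  have "\<not> stopped (Some ` B) z \<sigma> m" if "m \<le> k" for m
    using that
  proof (induction m rule: less_induct)
    case (less m)
    show ?case
    proof
      assume st: "stopped (Some ` B) z \<sigma> m"
      then obtain v where v: "v \<in> B" "\<sigma> m = Some v"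
        by (auto simp: stopped_def)
      have "\<not> stopped (Some ` B) z \<sigma> j" if "j < m" for j
        using less.IH[OF that] that less.prems by simp
      then have "first_stop (Some ` B) z \<sigma> m v"
        using st v by (simp add: first_stop_def)
      then show False
        using no[OF less.prems v(1)] by simp
    qed
  qed
  then have "\<not> stopped (Some ` B) z \<sigma> k"
    by simp
  then show "\<forall>j\<le>k. \<sigma> j = Some z"
    using assms unfolding stopped_def by blast
qed

text \<open>Being in \<open>z\<close> at step \<open>k\<close> is split by the index and place of
  the first stop. These events are disjoint and each is determined up to a fixed grid time, so the
  Markov property at that time replaces a strong Markov property.\<close>

lemma renewal:
  assumes h: "0 \<le> h" and B: "finite B" "z \<in> B"
  shows "p (real k * h) u z = of_bool (u = z) * p h z z ^ k
    + (\<Sum>v\<in>B. \<Sum>m\<le>k. stop_prob h B z u m v * p (real (k - m) * h) v z)"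
proof -
  interpret prob_space "P u" by (rule prob_space_P)
  let ?fs = "\<lambda>\<omega> m v. first_stop (Some ` B) z (\<lambda>j. X (real j * h) \<omega>) m v"
  let ?E = "\<lambda>(v, m). {\<omega> \<in> space (P u). ?fs \<omega> m v \<and> X (real k * h) \<omega> = Some z}"
  let ?S = "{\<omega> \<in> space (P u). \<forall>j\<le>k. X (real j * h) \<omega> = Some z}"
  let ?I = "B \<times> {..k}"
  have [simp]: "0 \<le> real j * h" for j using h by simp
  have E: "?E i \<in> events" for i
  proof -
    obtain v m where i: "i = (v, m)" by (rule prod.exhaust)
    have "{\<omega> \<in> space (P u). X (real k * h) \<omega> = Some z} \<in> events"
      by (simp add: sets_P space_P)
    from sets.Int[OF first_stop_event[OF h] this] show ?thesis
      unfolding i prod.case by (rule back_subst[where P="\<lambda>A. A \<in> events"]) blast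
  qed
  have S: "?S \<in> events"
    using stay_past[OF h, of k z] past_subset[of "real k * h"] by (auto simp: space_P sets_P)
  have split: "{\<omega> \<in> space (P u). X (real k * h) \<omega> = Some z} = ?S \<union> (\<Union>i\<in>?I. ?E i)"
    using first_stop_or_stay[OF B(2), of "\<lambda>j. X (real j * h) _" k] by auto
  have "tr (real k * h) u z = prob ?S + prob (\<Union>i\<in>?I. ?E i)"
    unfolding tr_def split
  proof (rule finite_measure_Union)
    show "?S \<inter> (\<Union>i\<in>?I. ?E i) = {}"
      by (auto simp: first_stop_def stopped_def)
    show "(\<Union>i\<in>?I. ?E i) \<in> events"
      by (rule sets.finite_UN[OF finite_cartesian_product[OF B(1) finite_atMost] E])
  qed (rule S)
  also have "prob (\<Union>i\<in>?I. ?E i) = (\<Sum>i\<in>?I. prob (?E i))"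
  proof (rule finite_measure_finite_Union)
    show "disjoint_family_on ?E ?I"
      unfolding disjoint_family_on_def
    proof (intro ballI impI)
      fix i i' :: "nat \<times> nat" assume ne: "i \<noteq> i'"
      obtain v m where i: "i = (v, m)" by (rule prod.exhaust)
      obtain v' m' where i': "i' = (v', m')" by (rule prod.exhaust)
      show "?E i \<inter> ?E i' = {}"
        using ne first_stop_unique[of "Some ` B" z _ m v m' v'] unfolding i i' prod.case by blast
    qed
    show "?E ` ?I \<subseteq> events"
      by (rule image_subsetI[OF E])
    show "finite ?I"
      using B(1) by simp
  qed
  also have "\<dots> = (\<Sum>i\<in>?I. stop_prob h B z u (snd i) (fst i) * p (real (k - snd i) * h) (fst i) z)"
  proof (rule sum.cong[OF refl])
    fix i assume "i \<in> ?I"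
    then obtain v m where i: "i = (v, m)" "m \<le> k" by auto
    have sum: "real m * h + real (k - m) * h = real k * h"
      using i(2) by (simp add: of_nat_diff algebra_simps)
    have 1: "?fs \<omega> m v \<and> X (real k * h) \<omega> = Some z \<longleftrightarrow>
        ?fs \<omega> m v \<and> X (real m * h) \<omega> = Some v \<and> X (real m * h + real (k - m) * h) \<omega> = Some z" for \<omega>
      unfolding sum by (auto simp: first_stop_def)
    have 2: "?fs \<omega> m v \<longleftrightarrow> ?fs \<omega> m v \<and> X (real m * h) \<omega> = Some v" for \<omega>
      by (auto simp: first_stop_def)
    have "prob (?E i) = stop_prob h B z u m v * tr (real (k - m) * h) v z"
    proof -
      let ?A = "{\<omega> \<in> space M. ?fs \<omega> m v}"
      have e1: "{\<omega> \<in> space (P u). ?fs \<omega> m v \<and> X (real k * h) \<omega> = Some z}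
          = {\<omega> \<in> space (P u). \<omega> \<in> ?A \<and> X (real m * h) \<omega> = Some v \<and> X (real m * h + real (k - m) * h) \<omega> = Some z}"
        using 1 unfolding space_P by blast
      have e2: "{\<omega> \<in> space (P u). ?fs \<omega> m v} = {\<omega> \<in> space (P u). \<omega> \<in> ?A \<and> X (real m * h) \<omega> = Some v}"
        using 2 unfolding space_P by blast
      show ?thesis
        unfolding i(1) prod.case stop_prob_def e1 e2
        by (rule markov_tr[OF _ _ first_stop_past[OF h]]) simp_all
    qed
    then show "prob (?E i) = stop_prob h B z u (snd i) (fst i) * p (real (k - snd i) * h) (fst i) z"
      by (simp add: i(1) pmf_K)
  qed
  also have "\<dots> = (\<Sum>v\<in>B. \<Sum>m\<le>k. stop_prob h B z u m v * p (real (k - m) * h) v z)"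
    by (simp only: sum.cartesian_product split_def)
  finally show ?thesis
    using h by (simp add: stay_prob pmf_K)
qed

section \<open>The renewal equation summed over all grid times\<close>

definition hit_prob :: "real \<Rightarrow> nat set \<Rightarrow> nat \<Rightarrow> nat \<Rightarrow> nat \<Rightarrow> real" where
  "hit_prob h B z u v = \<P>(\<omega> in P u. \<exists>m. first_stop (Some ` B) z (\<lambda>j. X (real j * h) \<omega>) m v)"

lemma stop_prob_sums: assumes "0 \<le> h" shows "(\<lambda>m. stop_prob h B z u m v) sums hit_prob h B z u v"
proof -
  interpret prob_space "P u" by (rule prob_space_P)
  let ?E = "\<lambda>m. {\<omega> \<in> space (P u). first_stop (Some ` B) z (\<lambda>j. X (real j * h) \<omega>) m v}"
  have "(\<lambda>m. prob (?E m)) sums prob (\<Union>m. ?E m)"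
  proof (rule finite_measure_UNION)
    show "disjoint_family ?E"
      unfolding disjoint_family_on_def using first_stop_unique by blast
  qed (use first_stop_event[OF assms] in auto)
  moreover have "(\<Union>m. ?E m) = {\<omega> \<in> space (P u). \<exists>m. first_stop (Some ` B) z (\<lambda>j. X (real j * h) \<omega>) m v}"
    by auto
  ultimately show ?thesis
    by (simp add: stop_prob_def hit_prob_def)
qed

lemma grid_sum_sums:
  assumes "grid_sum h x y < \<infinity>"
  shows "(\<lambda>k. p (real k * h) x y) sums enn2real (grid_sum h x y)"
proof -
  have "summable (\<lambda>k. p (real k * h) x y)"
    using assms unfolding grid_sum_def by (intro summable_suminf_not_top) (auto simp: less_top)
  then show ?thesis
    unfolding grid_sum_def by (simp add: suminf_ennreal2 suminf_nonneg summable_sums)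
qed

text \<open>Summed over \<open>k\<close>, the convolution becomes a Cauchy product. The geometric
  term is the mean number of grid times spent in \<open>z\<close> before the first departure; it
  converges because its terms are dominated by those of the finite sum
  \<open>grid_sum h z z\<close>.\<close>

lemma renewal_sum:
  assumes h: "0 < h" and B: "finite B" "z \<in> B" and fin: "\<And>v. grid_sum h v z < \<infinity>"
  shows "enn2real (grid_sum h u z) = of_bool (u = z) / (1 - p h z z)
    + (\<Sum>v\<in>B. hit_prob h B z u v * enn2real (grid_sum h v z))"
    and "p h z z < 1"
proof -
  have pow: "p h z z ^ k \<le> p (real k * h) z z" for k
    using p_pow_le[of h z k] h by simp
  have "summable (\<lambda>k. p h z z ^ k)"
    by (rule summable_comparison_test'[OF sums_summable[OF grid_sum_sums[OF fin[of z]]], of 0])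
      (use pow in simp)
  then show less: "p h z z < 1"
    by (simp add: summable_geometric_iff)
  have conv: "(\<lambda>k. \<Sum>m\<le>k. stop_prob h B z u m v * p (real (k - m) * h) v z)
      sums (hit_prob h B z u v * enn2real (grid_sum h v z))" for v
  proof -
    have a: "summable (\<lambda>m. norm (stop_prob h B z u m v))" "(\<Sum>m. stop_prob h B z u m v) = hit_prob h B z u v"
      using stop_prob_sums[of h B z u v] h by (auto simp: sums_iff stop_prob_def)
    have b: "summable (\<lambda>k. norm (p (real k * h) v z))" "(\<Sum>k. p (real k * h) v z) = enn2real (grid_sum h v z)"
      using grid_sum_sums[OF fin[of v]] by (auto simp: sums_iff)
    show ?thesis
      using Cauchy_product_sums[OF a(1) b(1)] by (simp add: a(2) b(2))
  qed
  have "(\<lambda>k. of_bool (u = z) * p h z z ^ k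
      + (\<Sum>v\<in>B. \<Sum>m\<le>k. stop_prob h B z u m v * p (real (k - m) * h) v z))
    sums (of_bool (u = z) * (1 / (1 - p h z z)) + (\<Sum>v\<in>B. hit_prob h B z u v * enn2real (grid_sum h v z)))"
    using less by (intro sums_add sums_mult geometric_sums sums_sum conv) simp
  then have "(\<lambda>k. p (real k * h) u z)
    sums (of_bool (u = z) * (1 / (1 - p h z z)) + (\<Sum>v\<in>B. hit_prob h B z u v * enn2real (grid_sum h v z)))"
    using renewal[OF less_imp_le[OF h] B] by simp
  from sums_unique2[OF grid_sum_sums[OF fin[of u]] this]
  show "enn2real (grid_sum h u z) = of_bool (u = z) / (1 - p h z z)
    + (\<Sum>v\<in>B. hit_prob h B z u v * enn2real (grid_sum h v z))" by simp
qed

text \<open>The grid events stabilise path by path; dominated convergence turns this into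
  convergence of their probabilities.\<close>

lemma hit_prob_tendsto:
  assumes \<Phi>: "Measurable.pred M \<Phi>"
    and ae: "AE \<omega> in P u. \<forall>\<^sub>F n in sequentially.
      (\<exists>m. first_stop (Some ` B) z (\<lambda>j. X (real j * mesh n) \<omega>) m v) \<longleftrightarrow> \<Phi> \<omega>"
  shows "(\<lambda>n. hit_prob (mesh n) B z u v) \<longlonglongrightarrow> \<P>(\<omega> in P u. \<Phi> \<omega>)"
proof -
  interpret prob_space "P u" by (rule prob_space_P)
  let ?E = "\<lambda>n. {\<omega> \<in> space (P u). \<exists>m. first_stop (Some ` B) z (\<lambda>j. X (real j * mesh n) \<omega>) m v}"
  let ?F = "{\<omega> \<in> space (P u). \<Phi> \<omega>}"
  have un: "?E n = (\<Union>m. {\<omega> \<in> space (P u). first_stop (Some ` B) z (\<lambda>j. X (real j * mesh n) \<omega>) m v})" for n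
    by blast
  have E: "?E n \<in> events" for n
    unfolding un using first_stop_event[OF less_imp_le[OF mesh_pos]]
    by (intro sets.countable_nat_UN) blast
  have F: "?F \<in> events"
    using \<Phi> by (simp add: pred_def sets_P space_P)
  have "(\<lambda>n. \<integral>\<omega>. indicator (?E n) \<omega> \<partial>P u) \<longlonglongrightarrow> (\<integral>\<omega>. indicator ?F \<omega> \<partial>P u :: real)"
  proof (rule integral_dominated_convergence[where w="\<lambda>_. 1"])
    show "AE \<omega> in P u. (\<lambda>n. indicator (?E n) \<omega>) \<longlonglongrightarrow> (indicator ?F \<omega> :: real)"
      using ae AE_space
    proof eventually_elim
      case (elim \<omega>)
      then have "\<forall>\<^sub>F n in sequentially. indicator (?E n) \<omega> = (indicator ?F \<omega> :: real)"
        by (auto elim!: eventually_mono simp: indicator_def)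
      then show ?case by (rule tendsto_eventually)
    qed
  qed (use E F in \<open>auto simp: indicator_def\<close>)
  then show ?thesis
    using E F by (simp add: hit_prob_def)
qed

lemma grid_sum_finite:
  assumes "0 < h" "1 \<le> y" shows "grid_sum h x y < \<infinity>"
proof -
  obtain m where m: "m > 0" "\<And>s. s \<in> {0..h} \<Longrightarrow> m \<le> p s y y"
    using p_diag_min[of h y] assms(1) by auto
  have "ennreal (m * h) * grid_sum h x y \<le> green x y"
    using m assms(1) by (intro grid_sum_le_green) auto
  also have "\<dots> < \<infinity>" by (rule green_finite[OF assms(2)])
  finally show ?thesis
    using m(1) assms(1) by (auto simp: ennreal_mult_less_top)
qed

lemma grid_sum_0: "0 \<le> h \<Longrightarrow> 1 \<le> y \<Longrightarrow> grid_sum h 0 y = 0"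
  by (simp add: grid_sum_def p_trap)

section \<open>Green function and excursions\<close>

lemma stop_eventually:
  assumes \<omega>: "good_path \<omega>"
    and e: "0 \<le> e" "the (X e \<omega>) \<noteq> z" "\<And>s. 0 \<le> s \<Longrightarrow> s < e \<Longrightarrow> the (X s \<omega>) = z"
    and j: "e \<le> j" "the (X j \<omega>) \<in> B" "\<And>s. e \<le> s \<Longrightarrow> s < j \<Longrightarrow> the (X s \<omega>) \<notin> B" and "z \<in> B"
  shows "\<forall>\<^sub>F n in sequentially.
    (\<exists>m. first_stop (Some ` B) z (\<lambda>k. X (real k * mesh n) \<omega>) m v) \<longleftrightarrow> v = the (X j \<omega>)"
proof -
  have sf: "skip_free_path (\<lambda>t. the (X t \<omega>))"
    using \<omega> by (simp add: good_path_def)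
  have eq: "(\<lambda>k. Some (the (X (real k * mesh n) \<omega>))) = (\<lambda>k. X (real k * mesh n) \<omega>)" for n
  proof
    fix k
    have "0 \<le> real k * mesh n" using mesh_pos[of n] by simp
    then show "Some (the (X (real k * mesh n) \<omega>)) = X (real k * mesh n) \<omega>"
      using \<omega> by (simp add: good_path_def)
  qed
  show ?thesis
    by (rule eventually_mono[OF first_stop_grid_eventually[OF sf e j assms(8), unfolded eq]]) (assumption | erule spec)+
qed

text \<open>On the way from \<open>x\<close> down to 0 a skip-free path must visit \<open>z\<close>,
  so the first visit to \<open>{0, z}\<close> is at \<open>z\<close>.\<close>

lemma reach_from_above:
  assumes "1 \<le> z" "z < x" and \<omega>: "good_path \<omega>" "X 0 \<omega> = Some x"
  shows "\<forall>\<^sub>F n in sequentially.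
    \<exists>m. first_stop (Some ` {0, z}) z (\<lambda>k. X (real k * mesh n) \<omega>) m z"
proof -
  let ?f = "\<lambda>t. the (X t \<omega>)"
  have sf: "skip_free_path ?f" using \<omega> by (simp add: good_path_def)
  then obtain b where b: "0 < b" "?f b = 0"
    unfolding skip_free_path_def by blast
  obtain j where j: "0 \<le> j" "j \<le> b" "?f j \<in> {0, z}" "\<And>s. 0 \<le> s \<Longrightarrow> s < j \<Longrightarrow> ?f s \<notin> {0, z}"
    using first_time[OF sf order_refl less_imp_le[OF b(1)], of "{0, z}"] b(2) by auto
  have "?f j = z"
  proof (rule ccontr)
    assume "?f j \<noteq> z"
    then have "?f j \<le> z" using j(3) by simp
    then obtain t where "0 < t" "t \<le> j" "?f t = z"
      using skip_free_crossing[OF sf order_refl j(1), of z] assms(2) \<omega>(2) by auto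
    then show False
      using j(4)[of t] \<open>?f j \<noteq> z\<close> by (cases "t = j") auto
  qed
  moreover have "\<forall>\<^sub>F n in sequentially.
      (\<exists>m. first_stop (Some ` {0, z}) z (\<lambda>k. X (real k * mesh n) \<omega>) m z) \<longleftrightarrow> z = ?f j"
    by (rule stop_eventually[OF \<omega>(1), of 0]) (use assms j in auto)
  ultimately show ?thesis
    by simp
qed

text \<open>With stopping set \<open>{0, z}\<close> the trap contributes nothing, and the
  probability of stopping at \<open>z\<close> tends to 1.\<close>

lemma green_above:
  assumes z: "1 \<le> z" "z < x"
  shows "green x z = green z z"
proof -
  interpret prob_space "P x" by (rule prob_space_P)
  have "AE \<omega> in P x. \<forall>\<^sub>F n in sequentially.
      (\<exists>m. first_stop (Some ` {0, z}) z (\<lambda>k. X (real k * mesh n) \<omega>) m z) \<longleftrightarrow> True"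
    using AE_good_path AE_start by eventually_elim (use reach_from_above[OF z] in simp)
  then have "(\<lambda>n. hit_prob (mesh n) {0, z} z x z) \<longlonglongrightarrow> \<P>(\<omega> in P x. True)"
    by (intro hit_prob_tendsto) simp_all
  then have one: "(\<lambda>n. hit_prob (mesh n) {0, z} z x z) \<longlonglongrightarrow> 1"
    by (simp add: prob_space)
  have eq: "mesh n * enn2real (grid_sum (mesh n) x z)
      = hit_prob (mesh n) {0, z} z x z * (mesh n * enn2real (grid_sum (mesh n) z z))" for n
    using renewal_sum(1)[OF mesh_pos, of "{0, z}" z n x] grid_sum_finite[OF mesh_pos z(1)]
      grid_sum_0[OF less_imp_le[OF mesh_pos] z(1)] z by simp
  have "(\<lambda>n. mesh n * enn2real (grid_sum (mesh n) x z)) \<longlonglongrightarrow> 1 * enn2real (green z z)"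
    unfolding eq by (intro tendsto_mult one tendsto_grid_sum[OF z(1) mesh_pos mesh_tendsto_0])
  then have "enn2real (green x z) = enn2real (green z z)"
    using tendsto_grid_sum(1)[OF z(1) mesh_pos mesh_tendsto_0, of x] by (auto intro: LIMSEQ_unique)
  then show ?thesis
    using green_finite[OF z(1)] by (metis ennreal_enn2real infinity_ennreal_def)
qed

lemma excursion_from_below:
  assumes "1 \<le> z" "x < z" and \<omega>: "good_path \<omega>" "X 0 \<omega> = Some z"
  shows "\<exists>j. the (X j \<omega>) = (if hitting_time X {x} \<omega> < return_time X z \<omega> then x else z) \<and>
    (\<forall>v. \<forall>\<^sub>F n in sequentially.
      (\<exists>m. first_stop (Some ` {0, x, z}) z (\<lambda>k. X (real k * mesh n) \<omega>) m v) \<longleftrightarrow> v = the (X j \<omega>))"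
proof -
  let ?f = "\<lambda>t. the (X t \<omega>)"
  let ?B = "{0, x, z}"
  have sf: "skip_free_path ?f" using \<omega> by (simp add: good_path_def)
  have Some: "X t \<omega> = Some (?f t)" if "0 \<le> t" for t
    using \<omega>(1) that by (simp add: good_path_def)
  obtain b where b: "0 < b" "?f b = 0"
    using sf unfolding skip_free_path_def by blast
  obtain e where e: "0 \<le> e" "e \<le> b" "?f e \<in> - {z}" "\<And>s. 0 \<le> s \<Longrightarrow> s < e \<Longrightarrow> ?f s \<notin> - {z}"
    using first_time[OF sf order_refl less_imp_le[OF b(1)], of "- {z}"] b(2) assms(1) by auto
  \<comment> \<open>\<open>j\<close> ends the excursion; \<open>j = e\<close> when the exit from
    \<open>z\<close> lands in \<open>?B\<close> at once.\<close>
  obtain j where j: "e \<le> j" "j \<le> b" "?f j \<in> ?B" "\<And>s. e \<le> s \<Longrightarrow> s < j \<Longrightarrow> ?f s \<notin> ?B"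
    using first_time[OF sf e(1,2), of ?B] b(2) by auto
  have e0: "0 < e"
    using e(1,3) \<omega>(2) by (cases "e = 0") auto
  have exit: "exit_time X z \<omega> = ereal e"
    unfolding exit_time_def hitting_time_def
  proof (rule antisym)
    show "(INF t\<in>{t. 0 < t \<and> X t \<omega> \<in> Some ` (- {z})}. ereal t) \<le> ereal e"
      using e0 e(1,3) Some[of e] by (intro INF_lower) auto
    show "ereal e \<le> (INF t\<in>{t. 0 < t \<and> X t \<omega> \<in> Some ` (- {z})}. ereal t)"
    proof (rule INF_greatest)
      fix t assume t: "t \<in> {t. 0 < t \<and> X t \<omega> \<in> Some ` (- {z})}"
      then have "?f t \<in> - {z}" by auto
      then have "\<not> t < e" using e(4)[of t] t by auto
      then show "ereal e \<le> ereal t" by simp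
    qed
  qed
  have fj: "?f j = x \<or> ?f j = z"
  proof (rule ccontr)
    assume ne: "\<not> ?thesis"
    then have j0: "?f j = 0" "0 < x" using j(3) by auto
    \<comment> \<open>An exit to \<open>x\<close> itself would already stop the excursion there; an
      exit below \<open>x\<close> would have crossed \<open>x\<close> before \<open>e\<close>, while
      the path still sat in \<open>z\<close>.\<close>
    have "x < ?f e"
    proof (rule ccontr)
      assume "\<not> x < ?f e"
      then obtain t where t: "0 < t" "t \<le> e" "?f t = x"
        using skip_free_crossing[OF sf order_refl e(1), of x] assms(2) \<omega>(2) by auto
      then have "t = e" using e(4)[of t] assms(2) by force
      then show False using j(1) j(4)[of e] t ne by (cases "j = e") auto
    qed
    then obtain t where t: "e < t" "t \<le> j" "?f t = x"
      using skip_free_crossing[OF sf e(1) j(1), of x] j0 by auto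
    then show False
      using j(4)[of t] ne by (cases "t = j") auto
  qed
  have notx: "j \<le> t" if "0 < t" "?f t = x" for t
  proof (rule ccontr)
    assume "\<not> j \<le> t"
    then show False
      using that e(4)[of t] j(4)[of t] assms(2) by (cases "t < e") auto
  qed
  have notz: "j \<le> t" if "e < t" "?f t = z" for t
    using that j(4)[of t] by force
  have hit_ge: "ereal j \<le> hitting_time X {x} \<omega>"
    unfolding hitting_time_def by (rule INF_greatest) (use notx in auto)
  have iff: "hitting_time X {x} \<omega> < return_time X z \<omega> \<longleftrightarrow> ?f j = x"
  proof
    assume lt: "hitting_time X {x} \<omega> < return_time X z \<omega>"
    show "?f j = x"
    proof (rule ccontr)
      assume "?f j \<noteq> x"
      then have "?f j = z" using fj by simp
      then have "e < j" using j(1) e(3) by (cases "e = j") auto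
      have "return_time X z \<omega> \<le> ereal j"
        unfolding return_time_def exit
        using \<open>e < j\<close> Some[of j] e(1) \<open>?f j = z\<close> by (intro INF_lower) auto
      with hit_ge lt show False by (meson leD order_trans)
    qed
  next
    \<comment> \<open>The path stays in \<open>x\<close> up to \<open>d > j\<close>, which separates
      the return time strictly from the hitting time.\<close>
    assume fx: "?f j = x"
    have "0 \<le> j" using e(1) j(1) by simp
    then obtain d where d: "j < d" "\<And>s. j \<le> s \<Longrightarrow> s < d \<Longrightarrow> ?f s = ?f j"
      using skip_free_path_right[OF sf] by blast
    have "hitting_time X {x} \<omega> \<le> ereal j"
      unfolding hitting_time_def using fx Some[of j] e0 j(1) by (intro INF_lower) auto
    also have "ereal j < ereal d" using d(1) by simp
    also have "ereal d \<le> return_time X z \<omega>"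
      unfolding return_time_def exit
    proof (rule INF_greatest)
      fix t assume "t \<in> {t. ereal e < ereal t \<and> X t \<omega> = Some z}"
      then have t: "e < t" "?f t = z" by auto
      have "\<not> t < d"
        using notz[OF t] d(2)[of t] fx t(2) assms(2) by auto
      then show "ereal d \<le> ereal t" by simp
    qed
    finally show "hitting_time X {x} \<omega> < return_time X z \<omega>" .
  qed
  have "\<forall>\<^sub>F n in sequentially.
      (\<exists>m. first_stop (Some ` ?B) z (\<lambda>k. X (real k * mesh n) \<omega>) m v) \<longleftrightarrow> v = ?f j" for v
    by (rule stop_eventually[OF \<omega>(1) e(1)]) (use e j in auto)
  then show ?thesis
    using iff fj by (intro exI[of _ j]) auto
qed

text \<open>The renewal equation at \<open>z\<close> with stopping set \<open>{0, x, z}\<close>, in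
  the limit of small mesh. The product form also shows that no factor vanishes, which justifies the
  division in \<open>scale0_eq_green\<close>.\<close>

lemma green_below:
  assumes z: "1 \<le> z" "x < z"
  defines "R \<equiv> \<P>(\<omega> in P z. hitting_time X {x} \<omega> < return_time X z \<omega>)"
  shows "- Q z z * R * (enn2real (green z z) - enn2real (green x z)) = 1"
proof -
  interpret prob_space "P z" by (rule prob_space_P)
  let ?B = "{0, x, z}"
  let ?\<Phi> = "\<lambda>\<omega>. hitting_time X {x} \<omega> < return_time X z \<omega>"
  have \<Phi>: "Measurable.pred M ?\<Phi>" by measurable
  have ae: "AE \<omega> in P z. \<exists>j. the (X j \<omega>) = (if ?\<Phi> \<omega> then x else z) \<and>
    (\<forall>v. \<forall>\<^sub>F n in sequentially.
      (\<exists>m. first_stop (Some ` ?B) z (\<lambda>k. X (real k * mesh n) \<omega>) m v) \<longleftrightarrow> v = the (X j \<omega>))"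
    using AE_good_path AE_start by eventually_elim (rule excursion_from_below[OF z])
  have "AE \<omega> in P z. \<forall>\<^sub>F n in sequentially.
      (\<exists>m. first_stop (Some ` ?B) z (\<lambda>k. X (real k * mesh n) \<omega>) m x) \<longleftrightarrow> ?\<Phi> \<omega>"
    using ae
  proof eventually_elim
    case (elim \<omega>)
    then obtain j where j: "the (X j \<omega>) = (if ?\<Phi> \<omega> then x else z)"
      "\<forall>v. \<forall>\<^sub>F n in sequentially.
      (\<exists>m. first_stop (Some ` ?B) z (\<lambda>k. X (real k * mesh n) \<omega>) m v) \<longleftrightarrow> v = the (X j \<omega>)" by blast
    show ?case
      using j(2)[rule_format, of x] by (rule eventually_mono) (use j(1) z(2) in simp)
  qed
  then have hx: "(\<lambda>n. hit_prob (mesh n) ?B z z x) \<longlonglongrightarrow> R"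
    unfolding R_def by (rule hit_prob_tendsto[OF \<Phi>])
  have "AE \<omega> in P z. \<forall>\<^sub>F n in sequentially.
      (\<exists>m. first_stop (Some ` ?B) z (\<lambda>k. X (real k * mesh n) \<omega>) m z) \<longleftrightarrow> \<not> ?\<Phi> \<omega>"
    using ae
  proof eventually_elim
    case (elim \<omega>)
    then obtain j where j: "the (X j \<omega>) = (if ?\<Phi> \<omega> then x else z)"
      "\<forall>v. \<forall>\<^sub>F n in sequentially.
      (\<exists>m. first_stop (Some ` ?B) z (\<lambda>k. X (real k * mesh n) \<omega>) m v) \<longleftrightarrow> v = the (X j \<omega>)" by blast
    show ?case
      using j(2)[rule_format, of z] by (rule eventually_mono) (use j(1) z(2) in simp)
  qed
  then have "(\<lambda>n. hit_prob (mesh n) ?B z z z) \<longlonglongrightarrow> \<P>(\<omega> in P z. \<not> ?\<Phi> \<omega>)"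
    using \<Phi> by (intro hit_prob_tendsto) simp_all
  moreover have "\<P>(\<omega> in P z. \<not> ?\<Phi> \<omega>) = 1 - R"
    unfolding R_def using \<Phi> by (intro prob_neg) (simp add: pred_def sets_P space_P)
  ultimately have hz: "(\<lambda>n. hit_prob (mesh n) ?B z z z) \<longlonglongrightarrow> 1 - R"
    by simp
  define g where "g n v = mesh n * enn2real (grid_sum (mesh n) v z)" for n v
  have g: "(\<lambda>n. g n v) \<longlonglongrightarrow> enn2real (green v z)" for v
    unfolding g_def by (rule tendsto_grid_sum(1)[OF z(1) mesh_pos mesh_tendsto_0])
  \<comment> \<open>The renewal equation multiplied by \<open>(1 - p (mesh n) z z) / mesh n\<close>:
    this factor tends to \<open>- Q z z\<close>, and every other term has a limit as well.\<close>
  have eq: "(1 - p (mesh n) z z) / mesh n * (g n z - hit_prob (mesh n) ?B z z z * g n z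
      - hit_prob (mesh n) ?B z z x * g n x) = 1" for n
  proof -
    let ?\<rho> = "p (mesh n) z z" and ?h = "hit_prob (mesh n) ?B z z"
    note ren = renewal_sum(1)[OF mesh_pos, of ?B z n z] renewal_sum(2)[OF mesh_pos, of ?B z n] grid_sum_finite[OF mesh_pos z(1)]
    have less: "?\<rho> < 1" using ren by simp
    have zero: "enn2real (grid_sum (mesh n) 0 z) = 0"
      using grid_sum_0[OF less_imp_le[OF mesh_pos] z(1)] by simp
    have "(\<Sum>v\<in>?B. ?h v * enn2real (grid_sum (mesh n) v z))
        = ?h x * enn2real (grid_sum (mesh n) x z) + ?h z * enn2real (grid_sum (mesh n) z z)"
      using z zero by (cases "x = 0") auto
    then have "enn2real (grid_sum (mesh n) z z) = 1 / (1 - ?\<rho>)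
        + (?h x * enn2real (grid_sum (mesh n) x z) + ?h z * enn2real (grid_sum (mesh n) z z))"
      using ren by simp
    then have "g n z = mesh n * (1 / (1 - ?\<rho>)
        + (?h x * enn2real (grid_sum (mesh n) x z) + ?h z * enn2real (grid_sum (mesh n) z z)))"
      unfolding g_def by (rule arg_cong)
    moreover have "mesh n * (1 / (1 - ?\<rho>)
        + (?h x * enn2real (grid_sum (mesh n) x z) + ?h z * enn2real (grid_sum (mesh n) z z)))
        = mesh n / (1 - ?\<rho>) + ?h x * g n x + ?h z * g n z"
      by (simp add: g_def distrib_left mult.left_commute)
    ultimately have "g n z - ?h z * g n z - ?h x * g n x = mesh n / (1 - ?\<rho>)"
      by linarith
    then show ?thesis
      using less mesh_pos[of n] by simp
  qed
  have "((\<lambda>t. - ((tr t z z - 1) / t)) \<longlongrightarrow> - Q z z) (at_right 0)"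
    using Q_matrix[of z z] by (intro tendsto_minus) (simp add: tr_def)
  from filterlim_compose[OF this mesh_filterlim]
  have "(\<lambda>n. - ((tr (mesh n) z z - 1) / mesh n)) \<longlonglongrightarrow> - Q z z" .
  moreover have "- ((tr (mesh n) z z - 1) / mesh n) = (1 - p (mesh n) z z) / mesh n" for n
    using mesh_pos[of n] by (simp add: pmf_K minus_divide_left[symmetric] diff_divide_distrib)
  ultimately have q: "(\<lambda>n. (1 - p (mesh n) z z) / mesh n) \<longlonglongrightarrow> - Q z z"
    by simp
  have "(\<lambda>n. (1 - p (mesh n) z z) / mesh n * (g n z - hit_prob (mesh n) ?B z z z * g n z
      - hit_prob (mesh n) ?B z z x * g n x))
      \<longlonglongrightarrow> - Q z z * (enn2real (green z z) - (1 - R) * enn2real (green z z) - R * enn2real (green x z))"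
    by (intro tendsto_intros q g hx hz)
  then have "- Q z z * (enn2real (green z z) - (1 - R) * enn2real (green z z) - R * enn2real (green x z)) = 1"
    unfolding eq by (simp add: LIMSEQ_const_iff)
  then show ?thesis
    by (simp add: algebra_simps)
qed

lemma excursion_transform_0:
  "excursion_transform P X Q 0 x z = - Q z z * \<P>(\<omega> in P z. hitting_time X {x} \<omega> < return_time X z \<omega>)"
proof -
  interpret prob_space "P z" by (rule prob_space_P)
  let ?F = "{\<omega> \<in> space (P z). hitting_time X {x} \<omega> < return_time X z \<omega>}"
  have F: "?F \<in> events"
    unfolding sets_P space_P by measurable
  have "(\<integral>\<omega>. exp (- 0 * real_of_ereal (hitting_time X {x} \<omega> - exit_time X z \<omega>))
      * of_bool (hitting_time X {x} \<omega> < return_time X z \<omega>) \<partial>P z) = (\<integral>\<omega>. indicator ?F \<omega> \<partial>P z :: real)"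
    by (intro Bochner_Integration.integral_cong) (auto simp: indicator_def)
  then show ?thesis
    using F by (simp add: excursion_transform_def)
qed

text \<open>For \<open>x >= z\<close> both sides vanish, the left by convention and the right by
  \<open>green_above\<close>.\<close>

lemma scale0_eq_green:
  assumes z: "1 \<le> z"
  shows "scale0 P X Q x z = enn2real (green z z) - enn2real (green x z)"
proof (cases "x < z")
  case True
  have *: "excursion_transform P X Q 0 x z * (enn2real (green z z) - enn2real (green x z)) = 1"
    using green_below[OF z True] by (simp add: excursion_transform_0)
  then have "excursion_transform P X Q 0 x z \<noteq> 0" by auto
  then have "1 / excursion_transform P X Q 0 x z = enn2real (green z z) - enn2real (green x z)"
    using * by (simp add: field_simps)
  then show ?thesis
    using True by (simp add: excursion_scale_def)
next
  case False
  then show ?thesis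
    using green_above[OF z, of x] by (cases "x = z") (auto simp: excursion_scale_def)
qed

lemma Q_diag_nonpos: "0 \<le> - Q z z"
proof -
  have "((\<lambda>t. - ((tr t z z - 1) / t)) \<longlongrightarrow> - Q z z) (at_right 0)"
    using Q_matrix[of z z] by (intro tendsto_minus) (simp add: tr_def)
  moreover have "\<forall>\<^sub>F t in at_right 0. 0 \<le> - ((tr t z z - 1) / t)"
    unfolding eventually_at_right_field using tr_le_1 by (intro exI[of _ 1]) (simp add: divide_nonpos_pos)
  ultimately show ?thesis
    by (intro tendsto_lowerbound) auto
qed

lemma scale0_nonneg: "0 \<le> scale0 P X Q x z"
  using mult_nonneg_nonneg[OF Q_diag_nonpos measure_nonneg, of z "P z"]
  by (simp add: excursion_scale_def excursion_transform_0)

lemma entrance_imp_entrance_semigroup: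
  assumes "entrance P X Q"
  shows "entrance_semigroup K (scale0 P X Q 0)"
proof unfold_locales
  show "summable (scale0 P X Q 0)"
    using assms by (simp add: entrance_def)
  \<comment> \<open>The trap spends no time in \<open>y\<close>, so the difference of Green values
    at \<open>x = 0\<close> is the full diagonal value.\<close>
  have diag: "green y y = ennreal (scale0 P X Q 0 y)" if "1 \<le> y" for y
    using scale0_eq_green[OF that, of 0] green_0[OF that] green_finite[OF that, of y] by simp
  show "green x y \<le> ennreal (scale0 P X Q 0 y)" if "1 \<le> y" for x y
  proof -
    have "enn2real (green x y) \<le> scale0 P X Q 0 y"
      using scale0_eq_green[OF that, of x] scale0_eq_green[OF that, of 0] scale0_nonneg[of x y]
        green_0[OF that] by simp
    then show ?thesis
      using green_finite[OF that, of x] by (metis ennreal_enn2real ennreal_leI infinity_ennreal_def)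
  qed
  show "green x 1 = ennreal (scale0 P X Q 0 1)" if "1 \<le> x" for x
    using that green_above[of 1 x] diag[of 1] by (cases "x = 1") auto
qed (rule scale0_nonneg)

end

section \<open>Identification of the limit\<close>

text \<open>Each factor of a strictly upper triangular matrix raises the index by at least
  one.\<close>

lemma matpow_upper_triangular:
  assumes A: "\<And>x y. y \<le> x \<Longrightarrow> A x y = 0"
  shows "y < x + n \<Longrightarrow> matpow A n x y = 0"
proof (induction n arbitrary: y)
  case (Suc n)
  have "matpow A n x u * A u y = 0" for u
    using Suc.IH[of u] Suc.prems A[of y u] by (cases "u < x + n") auto
  then show ?case
    unfolding matpow.simps by (simp only: suminf_zero)
qed simp

lemma matpow_Suc_finite:
  assumes "\<And>x y. y \<le> x \<Longrightarrow> A x y = 0"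
  shows "matpow A (Suc n) x y = (\<Sum>u<y. matpow A n x u * A u y)"
  using assms by (simp, intro suminf_finite) auto

locale entrance_chain = absorbed_chain +
  assumes entrance: "entrance P X Q"

sublocale entrance_chain \<subseteq> entrance_semigroup K "scale0 P X Q 0"
  by (rule entrance_imp_entrance_semigroup[OF entrance])

context entrance_chain
begin

section \<open>Recursions for the scale function and for the limit law\<close>

abbreviation W :: "nat \<Rightarrow> nat \<Rightarrow> real" where
  "W \<equiv> scale0 P X Q"

lemma W_upper_triangular: "y \<le> x \<Longrightarrow> W x y = 0"
  by (simp add: excursion_scale_def)

text \<open>Row 0 of the resolvent-type identity \<open>W^(q) = W + q W^(q) W\<close>, obtained by
  splitting off the first term of the series.\<close>

lemma scale_recursion:
  fixes q :: real
  shows "scale P X Q q 0 y = W 0 y + q * (\<Sum>u<y. scale P X Q q 0 u * W u y)"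
proof -
  have m0: "matpow W n x u = 0" if "u < x + n" for n x u
    by (rule matpow_upper_triangular[OF _ that]) (rule W_upper_triangular)
  have mS: "matpow W (Suc n) x u = (\<Sum>v<u. matpow W n x v * W v u)" for n x u
    by (rule matpow_Suc_finite) (rule W_upper_triangular)
  \<comment> \<open>A truncation index common to all columns up to \<open>y\<close> permits
    exchanging the sums.\<close>
  have fin: "scale P X Q q 0 u = (\<Sum>n<N. q ^ n * matpow W (Suc n) 0 u)" if "u \<le> N" for u N
  proof -
    have "matpow W (Suc n) 0 u = 0" if "n \<notin> {..<N}" for n
    proof -
      have "N \<le> n" using that by simp
      with \<open>u \<le> N\<close> have "u < 0 + Suc n" by linarith
      then show ?thesis by (rule m0)
    qed
    then show ?thesis
      unfolding scale_def of_real_eq_id id_apply by (intro suminf_finite) (simp_all del: matpow.simps)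
  qed
  have 1: "matpow W (Suc 0) 0 y = W 0 y"
    unfolding mS
    by (cases "y = 0") (simp_all add: W_upper_triangular of_bool_def if_distrib[of "\<lambda>a. a * _"] cong: if_cong)
  have "scale P X Q q 0 y = (\<Sum>n<Suc y. q ^ n * matpow W (Suc n) 0 y)"
    by (rule fin) simp
  also have "\<dots> = W 0 y + (\<Sum>n<y. q ^ Suc n * matpow W (Suc (Suc n)) 0 y)"
    unfolding sum.lessThan_Suc_shift by (simp only: 1 power_0 mult_1_left)
  also have "(\<Sum>n<y. q ^ Suc n * matpow W (Suc (Suc n)) 0 y)
      = (\<Sum>n<y. \<Sum>u<y. q * (q ^ n * matpow W (Suc n) 0 u * W u y))"
    by (intro sum.cong refl, subst mS) (simp only: sum_distrib_left power_Suc mult.assoc)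
  also have "\<dots> = q * (\<Sum>u<y. (\<Sum>n<y. q ^ n * matpow W (Suc n) 0 u) * W u y)"
    by (subst sum.swap) (simp only: sum_distrib_left sum_distrib_right)
  also have "\<dots> = q * (\<Sum>u<y. scale P X Q q 0 u * W u y)"
    by (intro arg_cong[where f="(*) q"] sum.cong) (simp_all add: fin[of _ y])
  finally show ?thesis .
qed

text \<open>\<open>alpha_green\<close> with the Green function rewritten as
  \<open>W 0 y - W x y\<close>; the first term is summed by the total mass 1 of
  \<open>alpha\<close>, and triangularity makes the second sum finite.\<close>

lemma alpha_recursion:
  assumes y: "1 \<le> y"
  shows "alpha y = rate * (W 0 y - (\<Sum>x<y. alpha x * W x y))"
proof -
  have weight: "ennreal (alpha x) * green x y = ennreal (alpha x * (W 0 y - W x y))" for x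
  proof -
    have "green x y = ennreal (W 0 y - W x y)"
      using scale0_eq_green[OF y, of x] scale0_eq_green[OF y, of 0] green_0[OF y]
        green_finite[OF y, of x] by simp
    then show ?thesis
      by (simp add: ennreal_mult' alpha_nonneg)
  qed
  have nonneg: "0 \<le> alpha x * (W 0 y - W x y)" for x
    using scale0_eq_green[OF y, of x] scale0_eq_green[OF y, of 0] green_0[OF y]
    by (simp add: alpha_nonneg)
  have "(\<lambda>x. alpha x * W x y) sums (\<Sum>x<y. alpha x * W x y)"
    by (rule sums_finite) (auto simp: W_upper_triangular)
  from sums_diff[OF sums_mult2[OF alpha_sums_1, of "W 0 y"] this]
  have s: "(\<lambda>x. alpha x * (W 0 y - W x y)) sums (W 0 y - (\<Sum>x<y. alpha x * W x y))"
    by (simp add: right_diff_distrib)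
  have "ennreal (W 0 y - (\<Sum>x<y. alpha x * W x y)) = ennreal (alpha y / rate)"
    using alpha_green[OF y] s nonneg unfolding weight by (subst (asm) suminf_ennreal2) (auto simp: sums_iff)
  moreover have "0 \<le> W 0 y - (\<Sum>x<y. alpha x * W x y)"
    using sums_le[OF nonneg sums_zero s] by simp
  moreover have "0 \<le> alpha y / rate"
    using alpha_nonneg rate_pos by simp
  ultimately have "W 0 y - (\<Sum>x<y. alpha x * W x y) = alpha y / rate"
    by simp
  then show ?thesis
    using rate_pos by simp
qed

lemma alpha_eq_scale: "alpha y = rate * scale P X Q (- rate) 0 y"
proof (induction y rule: less_induct)
  case (less y)
  show ?case
  proof (cases "y = 0")
    case True
    then show ?thesis
      using scale_recursion[of "- rate" 0] by (simp add: alpha_0 W_upper_triangular)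
  next
    case False
    have "(\<Sum>x<y. alpha x * W x y) = (\<Sum>x<y. rate * (scale P X Q (- rate) 0 x * W x y))"
      using less.IH by (intro sum.cong) (auto simp: mult.assoc)
    then show ?thesis
      using False alpha_recursion[of y] scale_recursion[of "- rate" y]
      by (simp add: sum_distrib_left[symmetric])
  qed
qed

text \<open>A path in 0 at time \<open>t\<close> started elsewhere, so \<open>t > 0\<close> and the
  hitting time is at most \<open>t\<close>; conversely the trap excludes earlier visits to
  0.\<close>

lemma AE_survival_iff:
  assumes "1 \<le> x" "0 \<le> t"
  shows "AE \<omega> in P x. ereal t < hitting_time X {0} \<omega> \<longleftrightarrow> X t \<omega> \<noteq> Some 0"
  using AE_good_path AE_start
proof eventually_elim
  case (elim \<omega>)
  note good = elim(1)[unfolded good_path_def] and start = elim(2)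
  show ?case
  proof
    assume lt: "ereal t < hitting_time X {0} \<omega>"
    show "X t \<omega> \<noteq> Some 0"
    proof
      assume zero: "X t \<omega> = Some 0"
      then have "0 < t" using assms start by (cases "t = 0") auto
      then have "hitting_time X {0} \<omega> \<le> ereal t"
        unfolding hitting_time_def using zero by (intro INF_lower) auto
      then show False using lt by simp
    qed
  next
    assume nz: "X t \<omega> \<noteq> Some 0"
    have sf: "skip_free_path (\<lambda>t. the (X t \<omega>))" using good by simp
    obtain e where e: "t < e" "\<And>s. t \<le> s \<Longrightarrow> s < e \<Longrightarrow> the (X s \<omega>) = the (X t \<omega>)"
      using skip_free_path_right[OF sf assms(2)] by blast
    have "X t \<omega> \<noteq> None" using good assms(2) by blast
    then obtain y where y: "X t \<omega> = Some y" "y \<noteq> 0"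
      using nz by auto
    \<comment> \<open>The holding period after \<open>t\<close> makes the inequality strict.\<close>
    have "ereal e \<le> hitting_time X {0} \<omega>"
      unfolding hitting_time_def
    proof (rule INF_greatest)
      fix s assume "s \<in> {s. 0 < s \<and> X s \<omega> \<in> Some ` {0}}"
      then have s: "0 < s" "X s \<omega> = Some 0" by auto
      have "\<not> s \<le> t"
        using good s nz less_imp_le by blast
      moreover have "\<not> (t \<le> s \<and> s < e)"
        using e(2)[of s] s y by auto
      ultimately show "ereal e \<le> ereal s" by auto
    qed
    then show "ereal t < hitting_time X {0} \<omega>"
      using e(1) by (metis ereal_less_eq(3) less_ereal.simps(1) order.strict_trans2)
  qed
qed

section \<open>Exponential moments of the absorption time and the decay parameter\<close>

lemma prob_survival:
  assumes "1 \<le> x" "0 \<le> t"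
  shows "\<P>(\<omega> in P x. ereal t < hitting_time X {0} \<omega>) = surv t x"
proof -
  interpret prob_space "P x" by (rule prob_space_P)
  have "\<P>(\<omega> in P x. ereal t < hitting_time X {0} \<omega>) = \<P>(\<omega> in P x. X t \<omega> \<noteq> Some 0)"
  proof (rule finite_measure_eq_AE)
    show "AE \<omega> in P x. \<omega> \<in> {\<omega> \<in> space (P x). ereal t < hitting_time X {0} \<omega>}
        \<longleftrightarrow> \<omega> \<in> {\<omega> \<in> space (P x). X t \<omega> \<noteq> Some 0}"
      using AE_survival_iff[OF assms] by eventually_elim simp
    show "{\<omega> \<in> space (P x). ereal t < hitting_time X {0} \<omega>} \<in> events"
      unfolding sets_P space_P by measurable
    show "{\<omega> \<in> space (P x). X t \<omega> \<noteq> Some 0} \<in> events"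
      using assms(2) by (simp add: sets_P space_P)
  qed
  also have "\<dots> = 1 - \<P>(\<omega> in P x. X t \<omega> = Some 0)"
    using assms(2) by (intro prob_neg) (simp add: sets_P space_P)
  finally show ?thesis
    using assms(2) by (simp add: surv_def pmf_K tr_def)
qed

lemma prob_survival_state:
  assumes "1 \<le> x" "0 \<le> t"
  shows "\<P>(\<omega> in P x. X t \<omega> = Some y \<and> ereal t < hitting_time X {0} \<omega>) = (if y = 0 then 0 else p t x y)"
proof -
  interpret prob_space "P x" by (rule prob_space_P)
  have "\<P>(\<omega> in P x. X t \<omega> = Some y \<and> ereal t < hitting_time X {0} \<omega>)
      = \<P>(\<omega> in P x. X t \<omega> = Some y \<and> y \<noteq> 0)"
  proof (rule finite_measure_eq_AE)
    show "AE \<omega> in P x. \<omega> \<in> {\<omega> \<in> space (P x). X t \<omega> = Some y \<and> ereal t < hitting_time X {0} \<omega>}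
        \<longleftrightarrow> \<omega> \<in> {\<omega> \<in> space (P x). X t \<omega> = Some y \<and> y \<noteq> 0}"
      using AE_survival_iff[OF assms] by eventually_elim auto
    show "{\<omega> \<in> space (P x). X t \<omega> = Some y \<and> ereal t < hitting_time X {0} \<omega>} \<in> events"
      unfolding sets_P space_P using assms(2) by measurable
    show "{\<omega> \<in> space (P x). X t \<omega> = Some y \<and> y \<noteq> 0} \<in> events"
      unfolding sets_P space_P using assms(2) by measurable
  qed
  then show ?thesis
    using assms(2) by (simp add: pmf_K tr_def)
qed

text \<open>A finite moment \<open>I\<close> would bound \<open>exp (lam * t) * surv t x\<close> for
  all \<open>t\<close> by Markov's inequality, whereas \<open>surv_lower\<close> makes this grow
  like \<open>exp ((lam - rate) * t)\<close>.\<close>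

lemma exponential_moment_infinite:
  assumes x: "1 \<le> x" and "rate < lam"
  shows "(\<integral>\<^sup>+\<omega>. exp_time lam (hitting_time X {0} \<omega>) \<partial>P x) = \<infinity>"
proof (rule ccontr)
  assume "\<not> ?thesis"
  then obtain I where I: "(\<integral>\<^sup>+\<omega>. exp_time lam (hitting_time X {0} \<omega>) \<partial>P x) = ennreal I" "0 \<le> I"
    by (cases "\<integral>\<^sup>+\<omega>. exp_time lam (hitting_time X {0} \<omega>) \<partial>P x") auto
  interpret prob_space "P x" by (rule prob_space_P)
  obtain c where c: "c > 0" "\<And>t. 0 \<le> t \<Longrightarrow> c * exp (- rate * t) \<le> surv t x"
    using surv_lower x by blast
  have lam: "0 < lam" using assms(2) rate_pos by simp
  have bound: "exp (lam * t) * surv t x \<le> I" if t: "0 \<le> t" for t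
  proof -
    let ?E = "{\<omega> \<in> space (P x). ereal t < hitting_time X {0} \<omega>}"
    have E: "?E \<in> events" unfolding sets_P space_P by measurable
    have le: "ennreal (exp (lam * t)) * indicator ?E \<omega> \<le> exp_time lam (hitting_time X {0} \<omega>)" for \<omega>
    proof (cases "\<omega> \<in> ?E")
      case True
      then show ?thesis
        using lam by (cases "hitting_time X {0} \<omega>") (auto simp: exp_time_def intro!: ennreal_leI)
    qed simp
    have "ennreal (exp (lam * t) * surv t x) = (\<integral>\<^sup>+\<omega>. ennreal (exp (lam * t)) * indicator ?E \<omega> \<partial>P x)"
      using E prob_survival[OF x t]
      by (simp add: nn_integral_cmult_indicator emeasure_eq_measure ennreal_mult surv_nonneg)
    also have "\<dots> \<le> ennreal I"
      unfolding I(1)[symmetric] by (intro nn_integral_mono le)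
    finally show ?thesis using I(2) by simp
  qed
  \<comment> \<open>Chosen so that the linear lower bound \<open>c * (1 + (lam - rate) * t)\<close>
    for the exponential equals \<open>c + I\<close>, which exceeds \<open>I\<close>.\<close>
  define t where "t = I / (c * (lam - rate))"
  have t: "0 \<le> t" "c * ((lam - rate) * t) = I"
    using I(2) c(1) assms(2) by (auto simp: t_def)
  have "c + I = c * (1 + (lam - rate) * t)"
    using t(2) by (simp add: distrib_left)
  also have "\<dots> \<le> c * exp ((lam - rate) * t)"
    using c(1) by (intro mult_left_mono) (auto simp: exp_ge_add_one_self add.commute)
  also have "\<dots> = exp (lam * t) * (c * exp (- rate * t))"
    by (simp add: exp_add[symmetric] left_diff_distrib)
  also have "\<dots> \<le> exp (lam * t) * surv t x"
    using c(2)[OF t(1)] by (intro mult_left_mono) auto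
  also have "\<dots> \<le> I" by (rule bound[OF t(1)])
  finally show False using c(1) by simp
qed

text \<open>If the absorption time lies in \<open>(n, n + 1]\<close>, its exponential is at most
  \<open>exp (lam * (n + 1))\<close> on the event of survival past \<open>n\<close>; by
  \<open>surv_upper\<close> the resulting series is geometric with ratio
  \<open>exp (lam - rate)\<close>.\<close>

lemma exponential_moment_finite:
  assumes "0 \<le> lam" "lam < rate"
  shows "(\<integral>\<^sup>+\<omega>. exp_time lam (hitting_time X {0} \<omega>) \<partial>P 1) < \<infinity>"
proof -
  interpret prob_space "P 1" by (rule prob_space_P)
  obtain C where C: "C > 0" "\<And>t x. 0 \<le> t \<Longrightarrow> surv t x \<le> C * exp (- rate * t)"
    using surv_upper by blast
  let ?E = "\<lambda>n. {\<omega> \<in> space (P 1). ereal (real n) < hitting_time X {0} \<omega>}"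
  have E: "?E n \<in> events" for n unfolding sets_P space_P by measurable
  have "prob (?E 0) = 1"
    using prob_survival[of 1 0] by (simp add: surv_0 zero_ereal_def)
  then have pos: "AE \<omega> in P 1. \<omega> \<in> ?E 0"
    by (rule AE_prob_1)
  have le: "AE \<omega> in P 1. exp_time lam (hitting_time X {0} \<omega>)
      \<le> (\<Sum>n. ennreal (exp (lam * real (Suc n))) * indicator (?E n) \<omega>)"
    using pos AE_hits_0 AE_space
  proof eventually_elim
    case (elim \<omega>)
    obtain r where r: "hitting_time X {0} \<omega> = ereal r" "0 < r"
      using elim by (cases "hitting_time X {0} \<omega>") auto
    define n where "n = nat (\<lceil>r\<rceil> - 1)"
    have "real n = of_int \<lceil>r\<rceil> - 1" using r(2) by (simp add: n_def)
    then have n: "real n < r" "r \<le> real (Suc n)"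
      using ceiling_correct[of r] by linarith+
    have "exp_time lam (hitting_time X {0} \<omega>) \<le> ennreal (exp (lam * real (Suc n))) * indicator (?E n) \<omega>"
      using n r elim(3) assms(1) by (auto simp: exp_time_def intro!: ennreal_leI mult_left_mono simp del: of_nat_Suc)
    also have "\<dots> \<le> (\<Sum>n. ennreal (exp (lam * real (Suc n))) * indicator (?E n) \<omega>)"
    proof -
      have "f n \<le> suminf f" for f :: "nat \<Rightarrow> ennreal"
        using sum_le_suminf[OF summableI, of "{n}" f] by simp
      then show ?thesis .
    qed
    finally show ?case .
  qed
  have "(\<integral>\<^sup>+\<omega>. exp_time lam (hitting_time X {0} \<omega>) \<partial>P 1)
      \<le> (\<integral>\<^sup>+\<omega>. (\<Sum>n. ennreal (exp (lam * real (Suc n))) * indicator (?E n) \<omega>) \<partial>P 1)"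
    by (rule nn_integral_mono_AE[OF le])
  also have "\<dots> = (\<Sum>n. \<integral>\<^sup>+\<omega>. ennreal (exp (lam * real (Suc n))) * indicator (?E n) \<omega> \<partial>P 1)"
    using E by (intro nn_integral_suminf) simp
  also have "\<dots> = (\<Sum>n. ennreal (exp (lam * real (Suc n)) * surv (real n) 1))"
  proof -
    have "emeasure (P 1) (?E n) = ennreal (surv (real n) 1)" for n
      by (subst emeasure_eq_measure) (use prob_survival[of 1 "real n"] in simp)
    then show ?thesis
      by (simp only: nn_integral_cmult_indicator[OF E] ennreal_mult[OF exp_ge_zero surv_nonneg])
  qed
  also have "\<dots> \<le> (\<Sum>n. ennreal (C * exp lam * exp (lam - rate) ^ n))"
  proof (intro suminf_le summableI ennreal_leI)
    fix n
    have "exp (lam * real (Suc n)) * surv (real n) 1 \<le> exp (lam * real (Suc n)) * (C * exp (- rate * real n))"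
      using C(2)[of "real n"] by (intro mult_left_mono) auto
    also have "\<dots> = C * exp lam * exp (lam - rate) ^ n"
      by (simp add: exp_of_nat_mult[symmetric] exp_add[symmetric] algebra_simps)
    finally show "exp (lam * real (Suc n)) * surv (real n) 1 \<le> C * exp lam * exp (lam - rate) ^ n" .
  qed
  also have "\<dots> < \<infinity>"
  proof -
    have "summable (\<lambda>n. C * exp lam * exp (lam - rate) ^ n)"
      using assms(2) by (intro summable_mult summable_geometric) simp
    then show ?thesis
      using C(1) by (subst suminf_ennreal2) auto
  qed
  finally show ?thesis .
qed

text \<open>The admissible exponents contain \<open>[0, rate)\<close> and are contained in
  \<open>[0, rate]\<close>, so the supremum is the same whatever happens at the endpoint.\<close>

lemma decay_parameter_eq_rate: "decay_parameter P X = rate"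
proof -
  define D where "D = {lam. 0 \<le> lam \<and> (\<exists>x\<ge>1. (\<integral>\<^sup>+ \<omega>. exp_time lam (hitting_time X {0} \<omega>) \<partial>P x) < \<infinity>)}"
  have lower: "lam \<in> D" if "0 \<le> lam" "lam < rate" for lam
    using that exponential_moment_finite[OF that] by (auto simp: D_def)
  have upper: "lam \<le> rate" if "lam \<in> D" for lam
    using that exponential_moment_infinite[of _ lam] by (force simp: D_def not_le)
  have "Sup D = rate"
  proof (rule cSup_eq_non_empty)
    show "D \<noteq> {}" using lower[of 0] rate_pos by auto
    fix u assume u: "\<And>lam. lam \<in> D \<Longrightarrow> lam \<le> u"
    show "rate \<le> u"
    proof (rule ccontr)
      assume "\<not> rate \<le> u"
      then obtain l where "max 0 u < l" "l < rate"
        using dense[of "max 0 u" rate] rate_pos by auto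
      then show False using u[OF lower[of l]] by auto
    qed
  qed (rule upper)
  then show ?thesis
    by (simp add: decay_parameter_def D_def)
qed

lemma nu_decay_eq_alpha: "nu_decay P X Q = alpha"
  by (simp add: fun_eq_iff nu_decay_def decay_parameter_eq_rate alpha_eq_scale)

lemma quasi_stationary_alpha: "quasi_stationary P X alpha"
proof -
  have "alpha y = prob_from P alpha (\<lambda>\<omega>. X t \<omega> = Some y \<and> ereal t < hitting_time X {0} \<omega>)
      / prob_from P alpha (\<lambda>\<omega>. ereal t < hitting_time X {0} \<omega>)" if t: "0 \<le> t" for y t
  proof -
    \<comment> \<open>The survival formulas hold for \<open>x >= 1\<close>; the law started in 0 has
      weight \<open>alpha 0 = 0\<close>.\<close>
    have m: "alpha x * \<P>(\<omega> in P x. ereal t < hitting_time X {0} \<omega>) = alpha x * surv t x" for x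
      using prob_survival[of x t] t by (cases "x = 0") (simp_all add: alpha_0)
    have d: "prob_from P alpha (\<lambda>\<omega>. ereal t < hitting_time X {0} \<omega>) = exp (- rate * t)"
      unfolding prob_from_def m using sums_unique[OF alpha_surv_sums[OF t]] by simp
    have n: "alpha x * \<P>(\<omega> in P x. X t \<omega> = Some y \<and> ereal t < hitting_time X {0} \<omega>)
        = (if y = 0 then 0 else alpha x * p t x y)" for x
      using prob_survival_state[of x t y] t by (cases "x = 0") (simp_all add: alpha_0)
    show ?thesis
    proof (cases "y = 0")
      case True
      then show ?thesis
        unfolding prob_from_def n by (simp add: alpha_0)
    next
      case False
      then show ?thesis
        using sums_unique[OF alpha_p_sums[OF t, of y], symmetric] unfolding d unfolding prob_from_def n by simp
    qed
  qed
  then show ?thesis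
    using alpha_nonneg alpha_sums_1 by (simp add: quasi_stationary_def)
qed

lemma yaglom_limit:
  assumes "0 < x" "0 < y"
  shows "((\<lambda>t. \<P>(\<omega> in P x. X t \<omega> = Some y \<bar> ereal t < hitting_time X {0} \<omega>)) \<longlongrightarrow> alpha y) at_top"
proof (rule Lim_transform_eventually[OF tendsto_alpha[of x y]])
  show "\<forall>\<^sub>F t in at_top. p t x y / surv t x
      = \<P>(\<omega> in P x. X t \<omega> = Some y \<bar> ereal t < hitting_time X {0} \<omega>)"
    unfolding eventually_at_top_linorder cond_prob_def
    using assms by (intro exI[of _ 0]) (simp add: prob_survival prob_survival_state)
qed (use assms in simp_all)

end

theorem theorem1p7:
  fixes M :: "'w measure"
    and P :: "nat \<Rightarrow> 'w measure"
    and X :: "real \<Rightarrow> 'w \<Rightarrow> nat option"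
    and Q :: "nat \<Rightarrow> nat \<Rightarrow> real"
  assumes "downward_skip_free_chain M P X Q"
    and "\<And>x. \<P>(\<omega> in P x. hitting_time X {0} \<omega> < \<infinity>) = 1"
    and "entrance P X Q"
  shows "quasi_stationary P X (nu_decay P X Q) \<and>
    (\<forall>x>0. \<forall>y>0.
      ((\<lambda>t. \<P>(\<omega> in P x. X t \<omega> = Some y \<bar> hitting_time X {0} \<omega> > ereal t))
        \<longlongrightarrow> nu_decay P X Q y) at_top)"
proof -
  interpret downward_skip_free_chain M P X Q by (rule assms(1))
  interpret entrance_chain M P X Q
    by unfold_locales (rule assms(2), rule assms(3))
  show ?thesis
    unfolding nu_decay_eq_alpha using quasi_stationary_alpha yaglom_limit by simp
qed

end
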